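(* Let $B$ be a uniform barrier on $\omega$. Given $V\in\mathcal E_B$ and an equivalence relation $R$ on a front $\mathcal F$ on $V$, there is $W\in\mathcal E_B$ with $W\subseteq V$ such that $R$ restricted to $\mathcal F|W$ is canonical; that is, there is an irreducible map $\varphi$ on the front $\mathcal F|W$ (on $W$) such that for all $u,v\in\mathcal F|W$, $u\,R\,v$ if and only if $\varphi(u)=\varphi(v)$.
   Context: Notation. For finite $a,b\subseteq\omega$, $a\trianglelefteq b$ means $a$ is an initial segment of $b$ (i.e. $a=b$ or $a=\{x\in b: x<\min(b\setminus a)\}$); $\hat{B}=\{a: \exists b\in B\ (a\trianglelefteq b)\}$. Uniform barriers. A family $B$ of finite subsets of $\omega$ is a barrier on $\omega$ if $a\not\subseteq b$ for distinct $a,b\in B$ and every infinite $M\subseteq\omega$ has an initial segment in $B$. For $n\in\omega$ let $B_{\{n\}}=\{a:\min a>n,\ \{n\}\cup a\in B\}$. For $\alpha<\omega_1$ and infinite $M$, $B$ is $\alpha$-uniform on $M$ if: $\alpha=0$ and $B=\{\emptyset\}$; or $\alpha=\beta+1$, $\emptyset\notin B$ and $B_{\{n\}}$ is $\beta$-uniform on $M\setminus(n+1)$ for all $n\in M$; or $\alpha$ is a limit and there are $\alpha_n$ ($n\in M$) increasing to $\alpha$ with $B_{\{n\}}$ $\alpha_n$-uniform on $M\setminus(n+1)$. A uniform barrier on $\omega$ is a barrier on $\omega$ that is $\alpha$-uniform on $\omega$ for some $1\le\alpha<\omega_1$. Sequences. $\sigma(\{a_0<\dots<a_n\})=(a_0,a_1-1,\dots,a_n-n)$,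 $\sigma(\emptyset)=()$. For finite non-decreasing sequences, $s\prec t$ iff $\max s<\max t$, or $\max s=\max t$ and $s$ is lexicographically below $t$ (proper initial segments being smaller); $()$ is $\prec$-least. $S_{\hat B}=\sigma[\hat B]$, $S_B=\sigma[B]$, $\nu_B:(S_{\hat B},\prec)\to(\omega,<)$ the order isomorphism, $\psi_B(s)=\{\nu_B(s\restriction m):1\le m\le\mathrm{lh}(s)\}$, $\rho_B=\psi_B\circ\sigma$. For a set $F$ of nonempty sequences $\widehat F=\{s\restriction m:s\in F,1\le m\le \mathrm{lh}(s)\}$; $T\prec T'$ means $s\prec s'$ for all $s\in T,s'\in T'$; for $S\subseteq S_B$, $S_n=\{s\in S:s(0)=n\}$. Domain spaces (recursion on rank). Rank 0 ($B=\{\emptyset\}$): $D_B=\{\{()\}\}$, $\mathfrak a_0=\emptyset$, $\mathfrak a_k(\{()\})=\{()\}$ for $k\ge1$. $B=[\omega]^1$: $D_B$ = infinite subsets of $S_B$, $\mathfrak a^B_k(S)$ = the $k$ $\prec$-least elements of $S$. Rank $\alpha\ge 2$: $C^n=\{\{c-(n+1):c\in a\}:a\in B_{\{n\}}\}$, $B_n=\{b\in B:\min b=n\}$, $\upsilon_n:S_{C^n}\to S_{B_n}$, $\upsilon_n(\sigma(c))=\sigma(\{n\}\cup\{x+n+1:x\in c\})$, $D_{B_n}=\{\upsilon_n[T]:T\in D_{C^n}\}$, $\mathfrak a^{B_n}_k(T)=\upsilon_n[\mathfrak a^{C^n}_k(\upsilon_n^{-1}[T])]$. $S\subseteq S_B$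 is in $D_B$ iff infinitely many $S_n$ are nonempty and, listing those $n$ as $n_0<n_1<\cdots$: (1) each $S_{n_i}\in D_{B_{n_i}}$; (2) with $\mathfrak a^B_0(S)=\emptyset$, $\mathfrak a^B_1(S)=\mathfrak a^{B_{n_0}}_1(S_{n_0})$, for every $k\ge1$: (a) $\mathfrak a^B_k(S)\prec\widehat{\mathfrak a^{B_{n_0}}_{k+1}(S_{n_0})}\setminus\widehat{\mathfrak a^B_k(S)}$ and (b) for $1\le i\le k$, $\mathfrak a^{B_{n_{i-1}}}_{k-i}(S_{n_{i-1}})\prec\widehat{\mathfrak a^{B_{n_i}}_{k+1-i}(S_{n_i})}\setminus\widehat{\mathfrak a^{B_{n_i}}_{k-i}(S_{n_i})}$; where $\mathfrak a^B_{k+1}(S)=\mathfrak a^B_k(S)\cup\mathfrak a^{B_{n_0}}_{k+1}(S_{n_0})\cup\dots\cup\mathfrak a^{B_{n_k}}_1(S_{n_k})$. The space. $\mathcal E_B=\{\psi_B[S]:S\in D_B\}$, ordered by inclusion; $r_k(X)$ is the set of the $k$ members of $X$ with smallest maxima (the image of the $k$ $\prec$-least members of $S$ when $X=\psi_B[S]$); $\mathcal{AE}^B=\{r_k(X):X\in\mathcal E_B,k<\omega\}$. Fronts. For $X\in\mathcal E_B$, $\mathcal F\subseteq\mathcal{AE}^B$ is a front on $X$ if (1) for every $Y\in\mathcal E_B$ with $Y\subseteq X$ there are $u\in\mathcal F$ and $n$ with $u=r_n(Y)$, and (2) for distinct $u,v\in\mathcal F$, $v\neq r_m(u)$ for all $m$.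 For $W\in\mathcal E_B$, $\mathcal F|W=\{u\in\mathcal F:u\subseteq W\}$. Irreducible maps. For $u\in\mathcal{AE}^B$ (a finite set of finite subsets of $\omega$), $\hat u$ is the set of all $\trianglelefteq$-initial segments of members of $u$; a projection of $u$ is a set of pairwise $\trianglelefteq$-incomparable members of $\hat u$; $u\wedge v$ is the set of $\trianglelefteq$-maximal elements of $\hat u\cap\hat v$. A map $\varphi$ on a front $\mathcal F$ on $X$ is irreducible if $\varphi(u)$ is a projection of $u$ for every $u\in\mathcal F$, and $( * )$: there is $Y\in\mathcal E_B$, $Y\subseteq X$, such that for every $u\in\mathcal F|Y$ there is $v\in\mathcal F$ with $\varphi(u)=\varphi(v)=u\wedge v$.
   Formalization: In clause (2)(b) of the definition of D_B the left-hand index k-i is corrected to k+2-i; with k-i the theorem fails already for B=[ω]^2, since the relation "the two least members lie in one row or not" on the front of all r_2(Y) admits no irreducible map. *)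

theory Defs
  imports Main "HOL-Library.Infinite_Set"
begin

section \<open>Countable ordinals\<close>

text \<open>\<open>cardSuc natLeq\<close> is the initial well-order of type \<open>\<omega>\<^sub>1\<close>; its elements are the countable
  ordinals.\<close>

typedef omega1 = "Field (cardSuc natLeq)"
proof -
  have "infinite (Field (cardSuc natLeq))"
    using cardSuc_finite[OF natLeq_Card_order] by (simp add: Field_natLeq)
  then have "Field (cardSuc natLeq) \<noteq> {}" by (metis finite.emptyI)
  then show ?thesis by (simp only: ex_in_conv not_False_eq_True)
qed

setup_lifting type_definition_omega1

instantiation omega1 :: wellorder
begin

lift_definition less_eq_omega1 :: "omega1 \<Rightarrow> omega1 \<Rightarrow> bool"
  is "\<lambda>a b. (a, b) \<in> cardSuc natLeq" .

definition less_omega1 :: "omega1 \<Rightarrow> omega1 \<Rightarrow> bool"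
  where "\<alpha> < \<beta> \<longleftrightarrow> \<alpha> \<le> \<beta> \<and> \<not> \<beta> \<le> (\<alpha> :: omega1)"

instance
proof -
  let ?r = "cardSuc natLeq"
  have W: "Well_order ?r"
    using cardSuc_Card_order natLeq_Card_order card_order_on_well_order_on by blast
  then have "Linear_order ?r" and wf: "wf (?r - Id)"
    by (auto simp: well_order_on_def)
  then have R: "refl_on (Field ?r) ?r" and T: "trans ?r" and A: "antisym ?r"
    and L: "total_on (Field ?r) ?r"
    by (auto simp: order_on_defs)
  show "OFCLASS(omega1, wellorder_class)"
  proof (intro_classes)
    fix x y z :: omega1
    show "(x < y) = (x \<le> y \<and> \<not> y \<le> x)" by (rule less_omega1_def)
    show "x \<le> x" using R by transfer (auto simp: refl_on_def)
    show "x \<le> y \<Longrightarrow> y \<le> z \<Longrightarrow> x \<le> z" using T by transfer (auto dest: transD)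
    show *: "x \<le> y \<Longrightarrow> y \<le> x \<Longrightarrow> x = y" for x y :: omega1
      using A by transfer (auto dest: antisymD)
    show "x \<le> y \<or> y \<le> x"
      using L R by transfer (unfold total_on_def refl_on_def, metis)
    fix P :: "omega1 \<Rightarrow> bool" and a
    assume step: "\<And>x. (\<And>y. y < x \<Longrightarrow> P y) \<Longrightarrow> P x"
    have "wf (inv_image (?r - Id) Rep_omega1)" using wf by (rule wf_inv_image)
    moreover have "{(y, x). y < x} \<subseteq> inv_image (?r - Id) Rep_omega1"
      by (auto simp: less_omega1_def less_eq_omega1.rep_eq Rep_omega1_inject)
    ultimately have "wf {(y :: omega1, x). y < x}" by (rule wf_subset)
    then show "P a" by (rule wf_induct_rule) (use step in auto)
  qed
qed

end

section \<open>Uniform barriers\<close>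

definition init_seg :: "nat set \<Rightarrow> nat set \<Rightarrow> bool" (infix "\<unlhd>" 50)
  where "a \<unlhd> b \<longleftrightarrow> a = b \<or> a = {x \<in> b. x < Inf (b - a)}"

definition hat :: "nat set set \<Rightarrow> nat set set"
  where "hat B = {a. \<exists>b\<in>B. a \<unlhd> b}"

definition barrier :: "nat set set \<Rightarrow> bool"
  where "barrier B \<longleftrightarrow>
    (\<forall>b\<in>B. finite b) \<and>
    (\<forall>a\<in>B. \<forall>b\<in>B. a \<noteq> b \<longrightarrow> \<not> a \<subseteq> b) \<and>
    (\<forall>M. infinite M \<longrightarrow> (\<exists>a\<in>B. a \<unlhd> M))"

definition section_at :: "nat set set \<Rightarrow> nat \<Rightarrow> nat set set"
  where "section_at B n = {a. (\<forall>x\<in>a. n < x) \<and> insert n a \<in> B}"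

text \<open>The premises on \<open>\<alpha>\<close> say, in turn, that \<open>\<alpha>\<close> is the least ordinal, that \<open>\<alpha> = \<beta> + 1\<close>, and that \<open>\<alpha>\<close>
  is a limit with \<open>f n\<close> (\<open>n \<in> M\<close>) strictly increasing and cofinal in it.\<close>

inductive uniform_on :: "omega1 \<Rightarrow> nat set \<Rightarrow> nat set set \<Rightarrow> bool"
where
  zero: "infinite M \<Longrightarrow> (\<And>\<beta>. \<alpha> \<le> \<beta>) \<Longrightarrow> uniform_on \<alpha> M {{}}"
| succ: "infinite M \<Longrightarrow> \<beta> < \<alpha> \<Longrightarrow> (\<And>\<gamma>. \<gamma> < \<alpha> \<Longrightarrow> \<gamma> \<le> \<beta>) \<Longrightarrow> {} \<notin> B \<Longrightarrow>
    (\<And>n. n \<in> M \<Longrightarrow> uniform_on \<beta> (M - {..n}) (section_at B n)) \<Longrightarrow>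
    uniform_on \<alpha> M B"
| limit: "infinite M \<Longrightarrow> \<beta>\<^sub>0 < \<alpha> \<Longrightarrow> (\<And>\<beta>. \<beta> < \<alpha> \<Longrightarrow> \<exists>\<gamma><\<alpha>. \<beta> < \<gamma>) \<Longrightarrow>
    strict_mono_on M f \<Longrightarrow> (\<And>n. n \<in> M \<Longrightarrow> f n < \<alpha>) \<Longrightarrow>
    (\<And>\<beta>. \<beta> < \<alpha> \<Longrightarrow> \<exists>n\<in>M. \<beta> < f n) \<Longrightarrow>
    (\<And>n. n \<in> M \<Longrightarrow> uniform_on (f n) (M - {..n}) (section_at B n)) \<Longrightarrow>
    uniform_on \<alpha> M B"

definition uniform_barrier :: "nat set set \<Rightarrow> bool"
  where "uniform_barrier B \<longleftrightarrow>
    barrier B \<and> (\<exists>\<alpha>. (\<exists>\<beta>. \<beta> < \<alpha>) \<and> uniform_on \<alpha> UNIV B)"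


section \<open>Sequences\<close>

definition sigma :: "nat set \<Rightarrow> nat list"
  where "sigma a = map (\<lambda>i. sorted_list_of_set a ! i - i) [0..<card a]"

definition prec :: "nat list \<Rightarrow> nat list \<Rightarrow> bool" (infix "\<prec>" 50)
  where "s \<prec> t \<longleftrightarrow> t \<noteq> [] \<and>
    (s = [] \<or> Max (set s) < Max (set t) \<or>
     Max (set s) = Max (set t) \<and> (s, t) \<in> lexord {(x, y). x < y})"

definition prec_sets :: "nat list set \<Rightarrow> nat list set \<Rightarrow> bool" (infix "\<prec>\<prec>" 50)
  where "T \<prec>\<prec> T' \<longleftrightarrow> (\<forall>s\<in>T. \<forall>s'\<in>T'. s \<prec> s')"

definition seqs :: "nat set set \<Rightarrow> nat list set"
  where "seqs B = sigma ` B"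

text \<open>The order isomorphism is unique on \<open>seqs (hat B)\<close>; its values elsewhere are irrelevant.\<close>

definition nu :: "nat set set \<Rightarrow> nat list \<Rightarrow> nat"
  where "nu B = (SOME f. bij_betw f (seqs (hat B)) UNIV \<and>
    (\<forall>s\<in>seqs (hat B). \<forall>t\<in>seqs (hat B). s \<prec> t \<longleftrightarrow> f s < f t))"

definition psi :: "nat set set \<Rightarrow> nat list \<Rightarrow> nat set"
  where "psi B s = {nu B (take m s) | m. 1 \<le> m \<and> m \<le> length s}"

definition seq_hat :: "nat list set \<Rightarrow> nat list set"
  where "seq_hat F = {take m s | m s. s \<in> F \<and> 1 \<le> m \<and> m \<le> length s}"

text \<open>The \<open>k\<close> least elements of \<open>A\<close> with respect to a strict order, all of \<open>A\<close> if it has fewer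
  than \<open>k\<close> elements.\<close>

definition least_elems :: "('a \<Rightarrow> 'a \<Rightarrow> bool) \<Rightarrow> nat \<Rightarrow> 'a set \<Rightarrow> 'a set"
  where "least_elems lt k A =
    {x \<in> A. finite {y \<in> A. lt y x} \<and> card {y \<in> A. lt y x} < k}"


section \<open>Domain spaces\<close>

definition row :: "nat list set \<Rightarrow> nat \<Rightarrow> nat list set"
  where "row S n = {s \<in> S. s \<noteq> [] \<and> s ! 0 = n}"

definition row_index :: "nat list set \<Rightarrow> nat \<Rightarrow> nat"
  where "row_index S i = enumerate {n. row S n \<noteq> {}} i"

definition shifted_section :: "nat set set \<Rightarrow> nat \<Rightarrow> nat set set"
  where "shifted_section B n = (\<lambda>a. (\<lambda>c. c - (n + 1)) ` a) ` section_at B n"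

text \<open>\<open>sigma\<close> is injective on finite sets, so \<open>upsilon_sigma\<close> below determines \<open>upsilon n\<close> on \<open>\<sigma>\<close>-images.\<close>

definition upsilon :: "nat \<Rightarrow> nat list \<Rightarrow> nat list"
  where "upsilon n t = n # map (\<lambda>x. x + n) t"

lemma upsilon_sigma:
  assumes "finite c"
  shows "upsilon n (sigma c) = sigma (insert n ((\<lambda>x. x + n + 1) ` c))"
proof -
  let ?g = "\<lambda>x. x + n + 1"
  let ?l = "sorted_list_of_set c"
  have mono: "strict_mono ?g" by (auto simp: strict_mono_def)
  have "sorted_wrt (<) (n # map ?g ?l)"
    using strict_sorted_list_of_set[of c] by (auto simp: sorted_wrt_map)
  moreover have "set (n # map ?g ?l) = insert n (?g ` c)" using assms by simp
  ultimately have l: "sorted_list_of_set (insert n (?g ` c)) = n # map ?g ?l"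
    by (metis sorted_list_of_set.idem_if_sorted_distinct strict_sorted_iff)
  have inj: "inj_on ?g c" by (auto simp: inj_on_def)
  have "n \<notin> ?g ` c" by auto
  then have c: "card (insert n (?g ` c)) = Suc (card c)"
    using assms inj by (simp add: card_image)
  have le: "i \<le> ?l ! i" if "i < card c" for i
    using that
  proof (induction i)
    case (Suc i)
    then have "?l ! i < ?l ! Suc i"
      using sorted_wrt_nth_less[OF strict_sorted_list_of_set[of c], of i "Suc i"] by simp
    with Suc show ?case by auto
  qed simp
  show ?thesis
    unfolding sigma_def upsilon_def c l
  proof (rule nth_equalityI)
    fix i assume i: "i < length (n # map (\<lambda>x. x + n) (map (\<lambda>i. ?l ! i - i) [0..<card c]))"
    show "(n # map (\<lambda>x. x + n) (map (\<lambda>i. ?l ! i - i) [0..<card c])) ! i =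
      map (\<lambda>i. (n # map ?g ?l) ! i - i) [0..<Suc (card c)] ! i"
    proof (cases i)
      case (Suc j)
      with i have "j < card c" by simp
      with Suc le[of j] assms show ?thesis by (simp del: upt_Suc)
    qed (simp del: upt_Suc)
  qed simp
qed

definition row_pullback :: "nat set set \<Rightarrow> nat list set \<Rightarrow> nat \<Rightarrow> nat list set"
  where "row_pullback B S n = {t \<in> seqs (shifted_section B n). upsilon n t \<in> row S n}"

abbreviation singletons :: "nat set set"
  where "singletons \<equiv> range (\<lambda>n. {n})"

text \<open>\<open>approx_mem B k S s\<close> means that \<open>s\<close> is in the \<open>k\<close>-th approximation of \<open>S\<close>.  Among uniform
  families on \<open>UNIV\<close>, those of rank \<open>0\<close> and \<open>1\<close> are exactly \<open>{{}}\<close> and \<open>singletons\<close>, so that the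
  recursion on the rank is a recursion on \<open>B\<close> through its shifted sections.  It is well-founded on
  barriers; the equations are derived below.\<close>

inductive approx_mem :: "nat set set \<Rightarrow> nat \<Rightarrow> nat list set \<Rightarrow> nat list \<Rightarrow> bool"
where
  rank0: "1 \<le> k \<Longrightarrow> s \<in> S \<Longrightarrow> approx_mem {{}} k S s"
| rank1: "s \<in> least_elems (\<prec>) k S \<Longrightarrow> approx_mem singletons k S s"
| mono: "B \<noteq> {{}} \<Longrightarrow> B \<noteq> singletons \<Longrightarrow> approx_mem B k S s \<Longrightarrow> approx_mem B (Suc k) S s"
| row: "B \<noteq> {{}} \<Longrightarrow> B \<noteq> singletons \<Longrightarrow> i \<le> k \<Longrightarrow> n = row_index S i \<Longrightarrow>
    approx_mem (shifted_section B n) (k + 1 - i) (row_pullback B S n) t \<Longrightarrow>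
    approx_mem B (Suc k) S (upsilon n t)"

definition approx :: "nat set set \<Rightarrow> nat \<Rightarrow> nat list set \<Rightarrow> nat list set"
  where "approx B k S = {s. approx_mem B k S s}"

definition row_approx :: "nat set set \<Rightarrow> nat \<Rightarrow> nat list set \<Rightarrow> nat \<Rightarrow> nat list set"
  where "row_approx B k S n = upsilon n ` approx (shifted_section B n) k (row_pullback B S n)"

lemma singletons_neq: "singletons \<noteq> {{}}" by auto

lemma approx_rank0: "approx {{}} k {[]} = (if k = 0 then {} else {[]})"
proof -
  have "approx_mem {{}} k {[]} s \<longleftrightarrow> 1 \<le> k \<and> s = []" for s
    using singletons_neq by (subst approx_mem.simps) auto
  then show ?thesis by (auto simp: approx_def)
qed

lemma approx_rank1: "approx singletons k S = least_elems (\<prec>) k S"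
proof -
  have "approx_mem singletons k S s \<longleftrightarrow> s \<in> least_elems (\<prec>) k S" for s
    using singletons_neq by (subst approx_mem.simps) auto
  then show ?thesis by (auto simp: approx_def)
qed

lemma approx_0:
  assumes "B \<noteq> {{}}" "B \<noteq> singletons"
  shows "approx B 0 S = {}"
proof -
  have "\<not> approx_mem B 0 S s" for s
    using assms by (subst approx_mem.simps) auto
  then show ?thesis by (auto simp: approx_def)
qed

lemma approx_Suc:
  assumes "B \<noteq> {{}}" "B \<noteq> singletons"
  shows "approx B (Suc k) S =
    approx B k S \<union> (\<Union>i\<le>k. row_approx B (k + 1 - i) S (row_index S i))"
proof (intro equalityI subsetI)
  fix s assume "s \<in> approx B (Suc k) S"
  then have "approx_mem B (Suc k) S s" by (simp add: approx_def)
  then show "s \<in> approx B k S \<union> (\<Union>i\<le>k. row_approx B (k + 1 - i) S (row_index S i))"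
  proof cases
    case mono
    then show ?thesis by (simp add: approx_def)
  next
    case (row i n t)
    then have "s \<in> row_approx B (k + 1 - i) S (row_index S i)"
      by (simp add: row_approx_def approx_def)
    with row show ?thesis by blast
  qed (use assms in simp_all)
next
  fix s assume "s \<in> approx B k S \<union> (\<Union>i\<le>k. row_approx B (k + 1 - i) S (row_index S i))"
  then consider "approx_mem B k S s"
    | i t where "i \<le> k" "s = upsilon (row_index S i) t"
        "approx_mem (shifted_section B (row_index S i)) (k + 1 - i)
          (row_pullback B S (row_index S i)) t"
    unfolding approx_def row_approx_def by blast
  then show "s \<in> approx B (Suc k) S"
    by cases (use assms in \<open>simp_all add: approx_def approx_mem.mono approx_mem.row\<close>)
qed

text \<open>The last two premises of \<open>step\<close> say that the blocks which stage \<open>k + 1\<close> adds in the rows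
  \<open>0, 1, \<dots>, k\<close> come one after the other.  Stage \<open>k + 1\<close> takes row \<open>i\<close> up to its approximation
  \<open>k + 1 - i\<close>, hence row \<open>i - 1\<close> up to its approximation \<open>k + 2 - i\<close>; this is the index on the
  left of the last premise.  The index \<open>k - i\<close>, which also occurs in print, is off by two: it leaves
  the relative order of neighbouring rows open, so that already for \<open>B = [\<omega>]\<^sup>2\<close> every member of the
  space contains members whose two least elements lie in one row, and others where they do not;
  that two-class relation admits no irreducible map.\<close>

inductive domain_space :: "nat set set \<Rightarrow> nat list set \<Rightarrow> bool"
where
  rank0: "domain_space {{}} {[]}"
| rank1: "S \<subseteq> seqs singletons \<Longrightarrow> infinite S \<Longrightarrow> domain_space singletons S"
| step: "B \<noteq> {{}} \<Longrightarrow> B \<noteq> singletons \<Longrightarrow> S \<subseteq> seqs B \<Longrightarrow> infinite {n. row S n \<noteq> {}} \<Longrightarrow>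
    (\<And>n. row S n \<noteq> {} \<Longrightarrow> \<exists>T. domain_space (shifted_section B n) T \<and> row S n = upsilon n ` T) \<Longrightarrow>
    (\<And>k. 1 \<le> k \<Longrightarrow>
      approx B k S \<prec>\<prec> seq_hat (row_approx B (k + 1) S (row_index S 0)) - seq_hat (approx B k S)) \<Longrightarrow>
    (\<And>k i. 1 \<le> i \<Longrightarrow> i \<le> k \<Longrightarrow>
      row_approx B (k + 2 - i) S (row_index S (i - 1)) \<prec>\<prec>
        seq_hat (row_approx B (k + 1 - i) S (row_index S i)) -
        seq_hat (row_approx B (k - i) S (row_index S i))) \<Longrightarrow>
    domain_space B S"


section \<open>The spaces, fronts and irreducible maps\<close>

definition E_space :: "nat set set \<Rightarrow> nat set set set"
  where "E_space B = {psi B ` S | S. domain_space B S}"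

definition r_approx :: "nat \<Rightarrow> nat set set \<Rightarrow> nat set set"
  where "r_approx k X = least_elems (\<lambda>x y. Max x < Max y) k X"

definition AE :: "nat set set \<Rightarrow> nat set set set"
  where "AE B = {r_approx k X | k X. X \<in> E_space B}"

definition front :: "nat set set \<Rightarrow> nat set set \<Rightarrow> nat set set set \<Rightarrow> bool"
  where "front B X F \<longleftrightarrow> F \<subseteq> AE B \<and>
    (\<forall>Y\<in>E_space B. Y \<subseteq> X \<longrightarrow> (\<exists>u\<in>F. \<exists>n. u = r_approx n Y)) \<and>
    (\<forall>u\<in>F. \<forall>v\<in>F. u \<noteq> v \<longrightarrow> (\<forall>m. v \<noteq> r_approx m u))"

definition restrict_to :: "nat set set set \<Rightarrow> nat set set \<Rightarrow> nat set set set"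
  where "restrict_to F W = {u \<in> F. u \<subseteq> W}"

definition projection :: "nat set set \<Rightarrow> nat set set \<Rightarrow> bool"
  where "projection p u \<longleftrightarrow> p \<subseteq> hat u \<and> (\<forall>a\<in>p. \<forall>b\<in>p. a \<noteq> b \<longrightarrow> \<not> a \<unlhd> b)"

definition meet :: "nat set set \<Rightarrow> nat set set \<Rightarrow> nat set set"
  where "meet u v = {a \<in> hat u \<inter> hat v. \<forall>b \<in> hat u \<inter> hat v. a \<unlhd> b \<longrightarrow> a = b}"

definition irreducible_map ::
  "nat set set \<Rightarrow> nat set set \<Rightarrow> nat set set set \<Rightarrow> (nat set set \<Rightarrow> nat set set) \<Rightarrow> bool"
  where "irreducible_map B X F \<phi> \<longleftrightarrow> front B X F \<and>
    (\<forall>u\<in>F. projection (\<phi> u) u) \<and>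
    (\<exists>Y\<in>E_space B. Y \<subseteq> X \<and>
      (\<forall>u\<in>restrict_to F Y. \<exists>v\<in>F. \<phi> u = \<phi> v \<and> \<phi> v = meet u v))"

definition canonical_on ::
  "nat set set \<Rightarrow> nat set set \<Rightarrow> nat set set set \<Rightarrow> (nat set set \<times> nat set set) set \<Rightarrow> bool"
  where "canonical_on B W F R \<longleftrightarrow>
    (\<exists>\<phi>. irreducible_map B W F \<phi> \<and> (\<forall>u\<in>F. \<forall>v\<in>F. (u, v) \<in> R \<longleftrightarrow> \<phi> u = \<phi> v))"

end

theory Submission
  imports Defs "HOL-Library.Sublist" "HOL-Library.Nat_Bijection" "HOL-Library.Ramsey"
begin

text \<open>A member of the space is determined by its nodes, the nonempty initial segments of its sequences,
  and these are coded by natural numbers through \<open>\<nu>\<close>. Listed in the order \<open>\<prec>\<close>, they arise one at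
  a time: the nodes present so far determine whose child comes next, and every child that is larger
  than all of them may be taken. (Give a node the list of the positions of its ancestors among their
  siblings. A node of index \<open>i\<close> then enters at stage \<open>1 + \<Sum>i\<close>, and within a stage lexicographically.)

  So the pigeonhole principle is only needed for a single set of children, and a fusion argument gives
  the Nash-Williams theorem. Say that two finite stages \<open>P\<close>, \<open>Q\<close> are mixed if no subspace separates
  their extensions in the front; on a suitable subspace this is decided, it is an equivalence, and for
  each \<open>P\<close> the one-node extensions are either all mixed or pairwise separated. Call the next node of
  \<open>P\<close> known in the second case. Two members of the front are equivalent iff they have the same known
  nodes. To see that the known nodes form a subtree and are attained as a meet, walk through \<open>u\<close> and
  build \<open>v\<close> mixed with it at every step, taking over exactly the known nodes of \<open>u\<close> and filling in
  nodes that \<open>u\<close> avoids.\<close>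

text \<open>A new leaf may bring several new nodes at once, so adding whole leaves would call for a
  pigeonhole principle on finite sequences of nodes. Single nodes avoid this, at the price of stages
  that are not approximations. Members of the space are also awkward to thin out: removing one row
  moves the indices of all later rows. A subspace is therefore represented by a mere set of codes in
  which every parent that may be called for has infinitely many children (\<open>cond\<close>). Such
  a set can be cut down at one parent without harm to the others and, with the root added, contains
  all nodes of some member of the space.

  Two obstacles shape the final assembly. The witness \<open>v\<close> of irreducibility has to lie
  in the front restricted to \<open>W\<close>, so it is sought in a set whose stages cannot leave
  the branch that gives \<open>W\<close>. And the conditions of the domain space say too little
  about the order when the first row has rank 0; hence everything takes place among strict
  sequences, where this row does not occur.\<close>

no_notation lesspoll (infixl \<open>\<prec>\<close> 50)

section \<open>Schedules and fusion\<close>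

text \<open>For codes of nonempty approximations this entails that the smaller one is an
  \<open>r_approx\<close> of the larger (\<open>codes_initial\<close>).\<close>

definition initial :: "nat set \<Rightarrow> nat set \<Rightarrow> bool"
  where "initial P Q \<longleftrightarrow> P \<subseteq> Q \<and> (\<forall>x\<in>Q - P. \<forall>w\<in>P. w < x)"

lemma initial_refl [simp]: "initial P P"
  by (simp add: initial_def)

lemma initial_trans: "initial P Q \<Longrightarrow> initial Q S \<Longrightarrow> initial P S"
  unfolding initial_def by blast

lemma initial_antisym: "initial P Q \<Longrightarrow> initial Q P \<Longrightarrow> P = Q"
  unfolding initial_def by blast

lemma initial_insert: "(\<And>x. x \<in> P \<Longrightarrow> x < y) \<Longrightarrow> initial P (insert y P)"
  unfolding initial_def by blast

lemma initial_atMost: "initial (u \<inter> {..m}) u"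
  unfolding initial_def by force

lemma initial_lessThan: "initial (u \<inter> {..<m}) u"
  unfolding initial_def by force

lemma initial_linear:
  assumes "initial P u" "initial Q u"
  shows "initial P Q \<or> initial Q P"
proof (cases "P \<subseteq> Q")
  case True
  then show ?thesis using assms unfolding initial_def by blast
next
  case False
  then obtain x where x: "x \<in> P" "x \<notin> Q" by blast
  have "Q \<subseteq> P"
  proof
    fix y assume "y \<in> Q"
    then have "y < x" using x assms unfolding initial_def by blast
    then have "\<not> x < y" by simp
    then show "y \<in> P" using x \<open>y \<in> Q\<close> assms unfolding initial_def by blast
  qed
  then show ?thesis using assms unfolding initial_def by blast
qed

lemma initial_atMost_prefix:
  assumes "initial P u" "m \<in> P"
  shows "initial (u \<inter> {..m}) P"
proof -
  have *: "m < x" if "x \<in> u" "x \<notin> P" for x using assms that by (auto simp: initial_def)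
  have "x \<in> P" if "x \<in> u" "x \<le> m" for x using *[OF that(1)] that(2) by fastforce
  moreover have "P \<subseteq> u" using assms by (simp add: initial_def)
  ultimately show ?thesis by (auto simp: initial_def)
qed

text \<open>There are no axioms: fusion and thinning work for arbitrary functions. In the
  application numbers code nodes, \<open>pa\<close> gives the parent, and 0 is the root.\<close>

locale schedule =
  fixes pa :: "nat \<Rightarrow> nat" and nxt :: "nat set \<Rightarrow> nat"
begin

text \<open>\<open>nxt P\<close> is the node whose child has to follow the stage \<open>P\<close>.\<close>

inductive valid :: "nat set \<Rightarrow> bool"
where
  root: "valid {0}"
| node: "valid P \<Longrightarrow> pa y = nxt P \<Longrightarrow> (\<And>x. x \<in> P \<Longrightarrow> x < y) \<Longrightarrow> valid (insert y P)"

text \<open>The demands at different parents are independent of each other, so cutting off a finite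
  part or thinning the children of one parent to an infinite set preserves the notion.\<close>

definition cond :: "nat set \<Rightarrow> bool"
  where "cond A \<longleftrightarrow> (\<forall>P. valid P \<longrightarrow> infinite {y \<in> A. pa y = nxt P})"

text \<open>The infinite runs of the schedule; \<open>branch_domain_space\<close> turns each of
  them, for a barrier, into a member of the space.\<close>

definition branch :: "nat set \<Rightarrow> bool"
  where "branch N \<longleftrightarrow> infinite N \<and> 0 \<in> N \<and> (\<forall>m\<in>N. valid (N \<inter> {..m}))"

lemma valid_finite: "valid P \<Longrightarrow> finite P"
  by (induction rule: valid.induct) auto

lemma valid_0: "valid P \<Longrightarrow> 0 \<in> P"
  by (induction rule: valid.induct) auto

text \<open>Elements enter a stage in increasing order, so a stage that properly end-extends
  \<open>P\<close> was built by passing through \<open>P\<close>, and the node added at that moment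
  is the required one.\<close>

lemma valid_next:
  assumes "valid u" "valid P" "initial P u" "u \<noteq> P"
  shows "\<exists>y\<in>u - P. pa y = nxt P \<and> (\<forall>x\<in>P. x < y) \<and> valid (insert y P) \<and> initial (insert y P) u"
  using assms
proof (induction rule: valid.induct)
  case root
  then show ?case using valid_0[of P] by (auto simp: initial_def)
next
  case (node Q y)
  show ?case
  proof (cases "P = Q")
    case True
    then show ?thesis using node valid.node[of Q y] by auto
  next
    case False
    have "y \<notin> P"
    proof
      assume "y \<in> P"
      then have "\<And>x. x \<in> Q \<Longrightarrow> x \<in> P"
        using node.hyps(3) node.prems(2) unfolding initial_def by (meson DiffI insertI2 order_less_asym)
      then show False using \<open>y \<in> P\<close> node.prems(2,3) unfolding initial_def by blast
    qed
    then have *: "initial P Q" using node.prems(2) unfolding initial_def by blast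
    from node.IH[OF node.prems(1) this] False obtain z where
      z: "z \<in> Q - P" "pa z = nxt P" "\<forall>x\<in>P. x < z" "valid (insert z P)" "initial (insert z P) Q"
      by blast
    have "initial (insert z P) (insert y Q)"
      using initial_trans[OF z(5) initial_insert] node.hyps(3) by blast
    then show ?thesis using z by blast
  qed
qed

lemma valid_initial:
  assumes "valid u" "initial P u" "0 \<in> P"
  shows "valid P"
  using assms
proof (induction rule: valid.induct)
  case root
  then have "P = {0}" by (auto simp: initial_def)
  then show ?case by (simp add: valid.root)
next
  case (node Q y)
  show ?case
  proof (cases "y \<in> P")
    case True
    then have "\<And>x. x \<in> Q \<Longrightarrow> x \<in> P"
      using node.hyps(3) node.prems(1) unfolding initial_def by (meson DiffI insertI2 order_less_asym)
    then have "P = insert y Q" using True node.prems(1) unfolding initial_def by blast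
    then show ?thesis using node.hyps valid.node by blast
  next
    case False
    then have "initial P Q" using node.prems(1) unfolding initial_def by blast
    then show ?thesis using node by blast
  qed
qed

section \<open>Thinning and fusion\<close>

lemma cond_ex:
  assumes "cond A" "valid P" "finite G"
  obtains y where "y \<in> A" "pa y = nxt P" "\<And>x. x \<in> G \<Longrightarrow> x < y"
proof -
  have "infinite {y \<in> A. pa y = nxt P}" using assms by (simp add: cond_def)
  then obtain y where "y \<in> {y \<in> A. pa y = nxt P}" "Max (insert 0 G) < y"
    by (meson infinite_nat_iff_unbounded)
  moreover have "x < y" if "x \<in> G" for x
    using that assms(3) calculation(2) by (meson Max_ge finite.insertI insertI2 le_less_trans)
  ultimately show ?thesis using that by blast
qed

lemma cond_tail:
  assumes "cond A"
  shows "cond (A \<inter> {m<..})"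
  unfolding cond_def
proof (intro allI impI)
  fix P assume "valid P"
  then have "infinite {y \<in> A. pa y = nxt P}" using assms by (simp add: cond_def)
  moreover have "{y \<in> A. pa y = nxt P} \<subseteq> {y \<in> A \<inter> {m<..}. pa y = nxt P} \<union> {..m}" by auto
  ultimately show "infinite {y \<in> A \<inter> {m<..}. pa y = nxt P}"
    by (meson finite_UnI finite_atMost finite_subset)
qed

lemma cond_thin:
  assumes "cond A" "I \<subseteq> A" "infinite I" "\<And>y. y \<in> I \<Longrightarrow> pa y = p"
  shows "cond ({y \<in> A. pa y \<noteq> p} \<union> I)"
  unfolding cond_def
proof (intro allI impI)
  fix P assume "valid P"
  then have *: "infinite {y \<in> A. pa y = nxt P}" using assms by (simp add: cond_def)
  show "infinite {y \<in> {y \<in> A. pa y \<noteq> p} \<union> I. pa y = nxt P}"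
  proof (cases "nxt P = p")
    case True
    then have "{y \<in> {y \<in> A. pa y \<noteq> p} \<union> I. pa y = nxt P} = I" using assms by auto
    then show ?thesis using assms by simp
  next
    case False
    then have "{y \<in> A. pa y = nxt P} \<subseteq> {y \<in> {y \<in> A. pa y \<noteq> p} \<union> I. pa y = nxt P}" by auto
    then show ?thesis using * finite_subset by blast
  qed
qed

lemma chain_branch:
  assumes f: "\<And>n. valid (f n)" and step: "\<And>n. \<exists>y. (\<forall>x\<in>f n. x < y) \<and> f (Suc n) = insert y (f n)"
  shows "branch (\<Union>n. f n)" "initial (f n) (\<Union>n. f n)"
proof -
  obtain g where g: "\<And>n x. x \<in> f n \<Longrightarrow> x < g n" "\<And>n. f (Suc n) = insert (g n) (f n)"
    using step by metis
  have mono: "initial (f i) (f j)" if "i \<le> j" for i j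
    using that
  proof (induction j)
    case (Suc j)
    have "initial (f j) (f (Suc j))" using initial_insert[of "f j" "g j"] g by simp
    then show ?case using Suc initial_trans le_Suc_eq by (metis initial_refl)
  qed simp
  let ?N = "\<Union>n. f n"
  have initial: "initial (f n) ?N" for n
    unfolding initial_def
  proof (intro conjI ballI)
    fix x w assume x: "x \<in> ?N - f n" and w: "w \<in> f n"
    then obtain k where k: "x \<in> f k" by blast
    then have "n \<le> k" using mono[of k n] x unfolding initial_def by (meson DiffD2 nat_le_linear subsetD)
    then show "w < x" using mono[of n k] k x w unfolding initial_def by blast
  qed blast
  have "strict_mono g" unfolding strict_mono_Suc_iff by (use g in auto)
  moreover have "range g \<subseteq> ?N" using g by blast
  ultimately have "infinite ?N"
    by (meson finite_subset range_inj_infinite strict_mono_imp_inj_on)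
  moreover have "0 \<in> ?N" using f valid_0 by blast
  moreover have "valid (?N \<inter> {..m})" if m: "m \<in> ?N" for m
  proof -
    obtain n where n: "m \<in> f n" using m by blast
    have "initial (?N \<inter> {..m}) (f n)"
      using initial_atMost_prefix[OF initial n] .
    then show ?thesis using valid_initial[OF f] \<open>0 \<in> ?N\<close> by simp
  qed
  ultimately show "branch ?N" unfolding branch_def by blast
  show "initial (f n) ?N" by (rule initial)
qed

lemma cond_branch:
  assumes "cond A"
  shows "\<exists>N\<subseteq>insert 0 A. branch N"
proof -
  have "\<exists>f. \<forall>n. (valid (f n) \<and> f n \<subseteq> insert 0 A) \<and>
    (\<exists>y. (\<forall>x\<in>f n. x < y) \<and> f (Suc n) = insert y (f n))"
  proof (rule dependent_nat_choice)
    show "\<exists>P. valid P \<and> P \<subseteq> insert 0 A" using root by blast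
  next
    fix P n assume P: "valid P \<and> P \<subseteq> insert 0 A"
    then obtain y where y: "y \<in> A" "pa y = nxt P" "\<And>x. x \<in> P \<Longrightarrow> x < y"
      using cond_ex[OF assms, of P P] valid_finite by blast
    then have "valid (insert y P)" "insert y P \<subseteq> insert 0 A" "\<forall>x\<in>P. x < y"
      using P node by blast+
    then show "\<exists>Q. (valid Q \<and> Q \<subseteq> insert 0 A) \<and> (\<exists>y. (\<forall>x\<in>P. x < y) \<and> Q = insert y P)"
      by blast
  qed
  then obtain f where f: "\<And>n. valid (f n)" "\<And>n. f n \<subseteq> insert 0 A"
    and "\<And>n. \<exists>y. (\<forall>x\<in>f n. x < y) \<and> f (Suc n) = insert y (f n)" by metis
  then have "branch (\<Union>n. f n)" by (intro chain_branch)
  then show ?thesis using f(2) by (intro exI[of _ "\<Union>n. f n"]) blast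
qed

text \<open>The elements of \<open>A'\<close> are chosen one by one, each from a reservoir on which
  the condition for the previous element already holds. The first component of
  \<open>prod_decode n\<close> takes every value infinitely often; it names the parent that is
  served at step \<open>n\<close>, and this keeps \<open>cond\<close> alive in the limit.\<close>

lemma fusion:
  assumes A: "cond A"
    and her: "\<And>m X Y. \<Phi> m X \<Longrightarrow> Y \<subseteq> X \<Longrightarrow> \<Phi> m Y"
    and dense: "\<And>m X. cond X \<Longrightarrow> X \<subseteq> A \<Longrightarrow> \<exists>Y\<subseteq>X. cond Y \<and> \<Phi> m Y"
  shows "\<exists>A'\<subseteq>A. cond A' \<and> (\<forall>m\<in>insert 0 A'. \<Phi> m (A' \<inter> {m<..}))"
proof -
  obtain A0 where A0: "A0 \<subseteq> A" "cond A0" "\<Phi> 0 A0" using dense[OF A] by blast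
  \<comment> \<open>A state consists of the element \<open>a\<close> chosen last and the reservoir
    \<open>X\<close> for all later choices; the root 0 serves as the first \<open>a\<close>.\<close>
  let ?I = "\<lambda>(a, X). cond X \<and> X \<subseteq> A0 \<and> \<Phi> a X \<and> X \<subseteq> {a<..}"
  let ?S = "\<lambda>n (a, X) (a', X'). a' \<in> X \<and> X' \<subseteq> X \<and>
    ((\<exists>y\<in>X. pa y = fst (prod_decode n)) \<longrightarrow> pa a' = fst (prod_decode n))"
  have "\<exists>f. \<forall>n. ?I (f n) \<and> ?S n (f n) (f (Suc n))"
  proof (rule dependent_nat_choice)
    have "?I (0, A0 \<inter> {0<..})" using A0 cond_tail her[of 0 A0 "A0 \<inter> {0<..}"] by auto
    then show "\<exists>s. ?I s" by blast
  next
    fix s n assume "?I s"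
    then obtain a X where s: "s = (a, X)" and X: "cond X" "X \<subseteq> A0" "X \<subseteq> {a<..}" by auto
    \<comment> \<open>If nothing in the reservoir has the prescribed parent, any element will do;
      there is one because the stage \<open>{0}\<close> calls for a child.\<close>
    have "\<exists>b\<in>X. (\<exists>y\<in>X. pa y = fst (prod_decode n)) \<longrightarrow> pa b = fst (prod_decode n)"
      using cond_ex[OF X(1) root, of "{}"] by blast
    then obtain b where b: "b \<in> X" "(\<exists>y\<in>X. pa y = fst (prod_decode n)) \<longrightarrow> pa b = fst (prod_decode n)"
      by blast
    obtain Y where Y: "Y \<subseteq> X \<inter> {b<..}" "cond Y" "\<Phi> b Y"
      using dense[OF cond_tail[OF X(1)], of b b] X(2) A0(1) by blast
    then have "?I (b, Y)" "?S n s (b, Y)" using s b X by auto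
    then show "\<exists>s'. ?I s' \<and> ?S n s s'" by blast
  qed
  then obtain f where "\<forall>n. ?I (f n) \<and> ?S n (f n) (f (Suc n))" ..
  then have f: "\<And>n. ?I (f n)" "\<And>n. ?S n (f n) (f (Suc n))" by simp_all
  define a where "a n = fst (f n)" for n
  define X where "X n = snd (f n)" for n
  have I: "cond (X n)" "X n \<subseteq> A0" "\<Phi> (a n) (X n)" "X n \<subseteq> {a n<..}" for n
    using f(1)[of n] by (simp_all add: a_def X_def case_prod_unfold)
  have S: "a (Suc n) \<in> X n" "X (Suc n) \<subseteq> X n"
    "(\<exists>y\<in>X n. pa y = fst (prod_decode n)) \<longrightarrow> pa (a (Suc n)) = fst (prod_decode n)" for n
    using f(2)[of n] by (simp_all add: a_def X_def case_prod_unfold)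
  have mono: "strict_mono a"
    unfolding strict_mono_Suc_iff by (use S(1) I(4) in blast)
  have anti: "X j \<subseteq> X i" if "i \<le> j" for i j
    using lift_Suc_antimono_le[of X, OF S(2) that] .
  have mem: "a (Suc j) \<in> X i" if "i \<le> j" for i j
    using anti[OF that] S(1) by blast
  let ?A = "range (\<lambda>n. a (Suc n))"
  have sub: "?A \<inter> {a n<..} \<subseteq> X n" for n
  proof
    fix x assume "x \<in> ?A \<inter> {a n<..}"
    then obtain k where k: "x = a (Suc k)" "a n < a (Suc k)" by auto
    then have "n < Suc k" using mono by (simp add: strict_mono_less)
    then show "x \<in> X n" using mem k by simp
  qed
  have "?A \<subseteq> A0" using S(1) I(2) by blast
  moreover have "cond ?A"
    unfolding cond_def
  proof (intro allI impI)
    fix P assume P: "valid P"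
    let ?g = "\<lambda>j. a (Suc (prod_encode (nxt P, j)))"
    have "?g j \<in> {y \<in> ?A. pa y = nxt P}" for j
    proof -
      have "\<exists>y\<in>X (prod_encode (nxt P, j)). pa y = nxt P"
        using cond_ex[OF I(1) P, of "{}"] by blast
      then show ?thesis using S(3)[of "prod_encode (nxt P, j)"] by simp
    qed
    moreover have "inj ?g"
      by (rule injI) (use mono in \<open>simp add: strict_mono_eq\<close>)
    ultimately show "infinite {y \<in> ?A. pa y = nxt P}"
      by (meson finite_subset image_subsetI range_inj_infinite)
  qed
  moreover have "\<Phi> m (?A \<inter> {m<..})" if m: "m \<in> insert 0 ?A" for m
  proof (cases "m = 0")
    case True
    show ?thesis unfolding True by (rule her[OF A0(3)]) (use \<open>?A \<subseteq> A0\<close> in blast)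
  next
    case False
    then obtain n where n: "m = a (Suc n)" using m by blast
    show ?thesis unfolding n by (rule her[OF I(3) sub])
  qed
  ultimately show ?thesis using A0(1) by (meson order_trans)
qed

lemma finite_dense:
  assumes "finite E" "cond X" "X \<subseteq> A"
    and her: "\<And>e X Y. \<psi> e X \<Longrightarrow> Y \<subseteq> X \<Longrightarrow> \<psi> e Y"
    and dense: "\<And>e X. e \<in> E \<Longrightarrow> cond X \<Longrightarrow> X \<subseteq> A \<Longrightarrow> \<exists>Y\<subseteq>X. cond Y \<and> \<psi> e Y"
  shows "\<exists>Y\<subseteq>X. cond Y \<and> (\<forall>e\<in>E. \<psi> e Y)"
  using assms(1,5)
proof (induction E)
  case empty
  then show ?case using assms(2) by blast
next
  case (insert e E)
  have "\<exists>Y\<subseteq>X. cond Y \<and> (\<forall>e\<in>E. \<psi> e Y)" by (rule insert.IH) (rule insert.prems; simp)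
  then obtain Y where Y: "Y \<subseteq> X" "cond Y" "\<And>e. e \<in> E \<Longrightarrow> \<psi> e Y" by meson
  obtain Z where Z: "Z \<subseteq> Y" "cond Z" "\<psi> e Z"
    using insert.prems[of e Y] Y assms(3) by (meson insertI1 order_trans)
  have "\<psi> d Z" if "d \<in> E" for d by (rule her[OF Y(3)[OF that] Z(1)])
  then show ?case using Y(1) Z by (intro exI[of _ Z]) simp
qed

text \<open>The form in which fusion is applied to conditions on stages: below an element
  \<open>m\<close> there are only finitely many pairs of subsets, and \<open>finite_dense\<close>
  meets all their conditions at once. The subsets range over \<open>A\<close>, since
  \<open>A'\<close> is not yet known when \<open>m\<close> is chosen.\<close>

lemma fusion_pairs:
  assumes A: "cond A"
    and her: "\<And>P Q X Y. \<phi> P Q X \<Longrightarrow> Y \<subseteq> X \<Longrightarrow> \<phi> P Q Y"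
    and dense: "\<And>P Q X. P \<subseteq> insert 0 A \<Longrightarrow> Q \<subseteq> insert 0 A \<Longrightarrow> finite P \<Longrightarrow> finite Q \<Longrightarrow>
      cond X \<Longrightarrow> X \<subseteq> A \<Longrightarrow> \<exists>Y\<subseteq>X. cond Y \<and> \<phi> P Q Y"
  shows "\<exists>A'\<subseteq>A. cond A' \<and> (\<forall>m\<in>insert 0 A'. \<forall>P Q. P \<subseteq> insert 0 A \<inter> {..m} \<longrightarrow>
    Q \<subseteq> insert 0 A \<inter> {..m} \<longrightarrow> \<phi> P Q (A' \<inter> {m<..}))"
proof -
  let ?E = "\<lambda>m. Pow (insert 0 A \<inter> {..m}) \<times> Pow (insert 0 A \<inter> {..m})"
  let ?\<psi> = "\<lambda>e X. \<phi> (fst e) (snd e) X"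
  have "\<exists>A'\<subseteq>A. cond A' \<and> (\<forall>m\<in>insert 0 A'. \<forall>e\<in>?E m. ?\<psi> e (A' \<inter> {m<..}))"
  proof (rule fusion[OF A, of "\<lambda>m X. \<forall>e\<in>?E m. ?\<psi> e X"])
    fix m X Y assume *: "\<forall>e\<in>?E m. ?\<psi> e X" "Y \<subseteq> X"
    show "\<forall>e\<in>?E m. ?\<psi> e Y"
    proof
      fix e assume "e \<in> ?E m"
      with *(1) have "?\<psi> e X" ..
      then show "?\<psi> e Y" using *(2) by (rule her)
    qed
  next
    fix m X assume X: "cond X" "X \<subseteq> A"
    show "\<exists>Y\<subseteq>X. cond Y \<and> (\<forall>e\<in>?E m. ?\<psi> e Y)"
    proof (rule finite_dense[where A = A, OF _ X])
      show "finite (?E m)" by simp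
      show "?\<psi> e Y" if "?\<psi> e X" "Y \<subseteq> X" for e X Y using that by (rule her)
      show "\<exists>Y\<subseteq>X. cond Y \<and> ?\<psi> e Y" if "e \<in> ?E m" "cond X" "X \<subseteq> A" for e X
      proof (rule dense[OF _ _ _ _ that(2,3)])
        show "fst e \<subseteq> insert 0 A" "snd e \<subseteq> insert 0 A" using that(1) by auto
        have "fst e \<subseteq> {..m}" "snd e \<subseteq> {..m}" using that(1) by auto
        then show "finite (fst e)" "finite (snd e)" using finite_subset by blast+
      qed
    qed
  qed
  then obtain A' where A': "A' \<subseteq> A" "cond A'" and
    *: "\<And>m e. m \<in> insert 0 A' \<Longrightarrow> e \<in> ?E m \<Longrightarrow> ?\<psi> e (A' \<inter> {m<..})" by meson
  have "\<phi> P Q (A' \<inter> {m<..})"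
    if "m \<in> insert 0 A'" "P \<subseteq> insert 0 A \<inter> {..m}" "Q \<subseteq> insert 0 A \<inter> {..m}" for m P Q
    using *[OF that(1), of "(P, Q)"] that(2,3) by simp
  then show ?thesis using A' by (intro exI[of _ A']) simp
qed

section \<open>One-node extensions\<close>

definition next_in :: "nat set \<Rightarrow> nat set \<Rightarrow> nat set"
  where "next_in X P = {y \<in> X. pa y = nxt P \<and> (\<forall>x\<in>P. x < y)}"

lemma infinite_next_in:
  assumes "cond X" "valid P"
  shows "infinite (next_in X P)"
proof -
  have "{y \<in> X. pa y = nxt P} \<subseteq> next_in X P \<union> (\<Union>x\<in>P. {..x})"
    unfolding next_in_def by (auto simp: not_less)
  moreover have "finite (\<Union>x\<in>P. {..x})" using valid_finite[OF assms(2)] by simp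
  ultimately show ?thesis using assms unfolding cond_def by (meson finite_UnI finite_subset)
qed

text \<open>Any infinite set of next nodes of a stage may be prescribed, as all other parents keep
  their children. Each use of a pigeonhole argument ends here.\<close>

lemma cond_thin_next:
  assumes "cond X" "I \<subseteq> next_in X P" "infinite I"
  shows "\<exists>Y\<subseteq>X. cond Y \<and> next_in Y P \<subseteq> I"
proof -
  have *: "I \<subseteq> X" "\<And>y. y \<in> I \<Longrightarrow> pa y = nxt P" using assms(2) by (auto simp: next_in_def)
  show ?thesis
    using cond_thin[OF assms(1) *(1) assms(3) *(2)] *(1)
    by (intro exI[of _ "{y \<in> X. pa y \<noteq> nxt P} \<union> I"]) (auto simp: next_in_def)
qed

lemma next_in_mono: "X \<subseteq> Y \<Longrightarrow> next_in X P \<subseteq> next_in Y P"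
  by (auto simp: next_in_def)

lemma valid_insert: "valid P \<Longrightarrow> y \<in> next_in X P \<Longrightarrow> valid (insert y P)"
  by (auto simp: next_in_def intro: node)

lemma initial_first:
  assumes "initial (insert y P) u" "\<And>x. x \<in> P \<Longrightarrow> x < y"
  shows "u \<inter> {..<y} = P" "u \<inter> {..<Suc y} = insert y P"
proof -
  have *: "y < z" if "z \<in> u" "z \<notin> insert y P" for z using assms(1) that by (auto simp: initial_def)
  have sub: "insert y P \<subseteq> u" using assms(1) by (simp add: initial_def)
  have "z \<in> P" if "z \<in> u" "z < y" for z using *[OF that(1)] that(2) by fastforce
  then show "u \<inter> {..<y} = P" using sub assms(2) by auto
  have "z \<in> insert y P" if "z \<in> u" "z < Suc y" for z using *[OF that(1)] that(2) by fastforce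
  then show "u \<inter> {..<Suc y} = insert y P" using sub assms(2) less_Suc_eq by auto
qed

lemma valid_pa:
  assumes "valid u" "x \<in> u" "0 < x"
  shows "x \<in> next_in u (u \<inter> {..<x})" "initial (u \<inter> {..<x}) u" "0 \<in> u \<inter> {..<x}" "valid (u \<inter> {..<x})"
proof -
  let ?P = "u \<inter> {..<x}"
  show P: "initial ?P u" "0 \<in> ?P" using initial_lessThan valid_0[OF assms(1)] assms(3) by auto
  then show v: "valid ?P" using valid_initial assms(1) by blast
  have "u \<noteq> ?P" using assms(2) by auto
  then obtain y where y: "y \<in> u - ?P" "pa y = nxt ?P" "initial (insert y ?P) u"
    using valid_next[OF assms(1) v P(1)] by blast
  have "y = x"
  proof (rule ccontr)
    assume "y \<noteq> x"
    then have "x \<in> u - insert y ?P" using assms(2) by simp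
    then have "y < x" using y(3) by (auto simp: initial_def)
    then show False using y(1) by simp
  qed
  then show "x \<in> next_in u ?P" using y by (auto simp: next_in_def)
qed

end

section \<open>Equivalence relations on fronts of a schedule\<close>

text \<open>The front is given by its sets of codes. It bars branches inside \<open>A0\<close> only,
  as the original front does only below \<open>V\<close>. From \<open>nxt_in\<close> it will follow
  that kernels are closed under parents.\<close>

locale front_relation = schedule +
  fixes F :: "nat set set" and A0 :: "nat set" and R :: "(nat set \<times> nat set) set"
  assumes nxt_in: "valid P \<Longrightarrow> nxt P \<in> P"
    and cond_A0: "cond A0" and zero_A0: "0 \<in> A0"
    and F_valid: "u \<in> F \<Longrightarrow> valid u" and F_sub: "u \<in> F \<Longrightarrow> u \<subseteq> A0"
    and F_ini: "u \<in> F \<Longrightarrow> v \<in> F \<Longrightarrow> initial u v \<Longrightarrow> u = v"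
    and F_branch: "branch N \<Longrightarrow> N \<subseteq> A0 \<Longrightarrow> \<exists>m. N \<inter> {..m} \<in> F"
    and R_equiv: "equiv F R"
begin

lemma R_sym: "(u, v) \<in> R \<Longrightarrow> (v, u) \<in> R"
  using R_equiv by (meson equivE symD)

lemma R_trans: "(u, v) \<in> R \<Longrightarrow> (v, w) \<in> R \<Longrightarrow> (u, w) \<in> R"
  using R_equiv by (meson equivE transD)

lemma R_refl: "u \<in> F \<Longrightarrow> (u, u) \<in> R"
  using R_equiv by (meson equivE refl_onD)

text \<open>The stages that have not run past the front; \<open>extension_exists\<close> extends
  each of them to a member of \<open>F\<close> inside any given subspace.\<close>

definition live :: "nat set \<Rightarrow> bool"
  where "live P \<longleftrightarrow> valid P \<and> P \<subseteq> A0 \<and> (\<forall>u\<in>F. initial u P \<longrightarrow> u = P)"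

lemma live_root: "live {0}"
  unfolding live_def using root zero_A0 F_valid valid_0
  by (auto simp: initial_def) 

lemma live_prefix:
  assumes "u \<in> F" "initial P u" "0 \<in> P"
  shows "live P"
  unfolding live_def
proof (intro conjI ballI impI)
  show "valid P" using valid_initial F_valid assms by blast
  show "P \<subseteq> A0" using F_sub assms by (auto simp: initial_def)
  fix w assume "w \<in> F" "initial w P"
  then have "w = u" using F_ini initial_trans assms by blast
  then show "w = P" using \<open>initial w P\<close> assms(2) initial_antisym by blast
qed

lemma live_insert:
  assumes "live P" "P \<notin> F" "y \<in> next_in A0 P"
  shows "live (insert y P)"
  unfolding live_def
proof (intro conjI ballI impI)
  show "valid (insert y P)" using valid_insert assms by (auto simp: live_def)
  show "insert y P \<subseteq> A0" using assms by (auto simp: live_def next_in_def)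
  fix w assume w: "w \<in> F" "initial w (insert y P)"
  have "initial P (insert y P)" using assms by (intro initial_insert) (auto simp: next_in_def)
  then consider "initial w P" | "initial P w" using w initial_linear by blast
  then show "w = insert y P"
  proof cases
    case 1
    then show ?thesis using assms w by (auto simp: live_def)
  next
    case 2
    then have "w = P \<or> w = insert y P" using w(2) by (auto simp: initial_def)
    then show ?thesis using w assms by auto
  qed
qed

text \<open>Bar induction: infinitely many successive one-node extensions outside \<open>F\<close>
  would have a branch in \<open>A0\<close> as their union, and the initial segment of it in
  \<open>F\<close> would be a proper part of one of these live stages.\<close>

lemma live_induct [consumes 1, case_names step]:
  assumes "live P"
    and step: "\<And>P. live P \<Longrightarrow> (\<And>y. P \<notin> F \<Longrightarrow> y \<in> next_in A0 P \<Longrightarrow> H (insert y P)) \<Longrightarrow> H P"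
  shows "H P"
proof -
  let ?r = "{(insert y P, P) | y P. live P \<and> P \<notin> F \<and> y \<in> next_in A0 P}"
  have "wf ?r"
    unfolding wf_iff_no_infinite_down_chain
  proof
    assume "\<exists>f. \<forall>i. (f (Suc i), f i) \<in> ?r"
    then obtain f where f: "\<And>i. (f (Suc i), f i) \<in> ?r" by blast
    then have q: "live (f i)" "f i \<notin> F" and s: "\<exists>y\<in>next_in A0 (f i). f (Suc i) = insert y (f i)" for i
      by blast+
    have "\<exists>y. (\<forall>x\<in>f i. x < y) \<and> f (Suc i) = insert y (f i)" for i
      using s[of i] by (auto simp: next_in_def)
    moreover have "valid (f i)" for i using q by (simp add: live_def)
    ultimately have N: "branch (\<Union>n. f n)" and initial: "\<And>n. initial (f n) (\<Union>n. f n)"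
      using chain_branch[of f] by auto
    have "(\<Union>n. f n) \<subseteq> A0" using q(1) by (auto simp: live_def)
    then obtain m where m: "(\<Union>n. f n) \<inter> {..m} \<in> F" using F_branch[OF N] by blast
    obtain z where "m < z" "z \<in> (\<Union>n. f n)" using N by (meson branch_def infinite_nat_iff_unbounded)
    then obtain n where n: "m < z" "z \<in> f n" by blast
    have "initial ((\<Union>n. f n) \<inter> {..m}) (f n)"
      using initial_linear[OF initial_atMost initial, of m n] n by (auto simp: initial_def)
    then have "(\<Union>n. f n) \<inter> {..m} = f n" using q(1)[of n] m by (simp add: live_def)
    then show False using q(2)[of n] m by simp
  qed
  then show ?thesis using assms(1)
  proof (induction P rule: wf_induct_rule)
    case (less P)
    show ?case
    proof (rule step[OF less.prems])
      fix y assume "P \<notin> F" "y \<in> next_in A0 P"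
      then show "H (insert y P)" using less live_insert by blast
    qed
  qed
qed

section \<open>The Nash-Williams theorem\<close>

lemma extension_exists:
  assumes "live P" "cond A" "A \<subseteq> A0"
  shows "\<exists>u\<in>F. initial P u \<and> u - P \<subseteq> A"
  using assms(1)
proof (induction rule: live_induct)
  case (step P)
  show ?case
  proof (cases "P \<in> F")
    case True
    then show ?thesis by (intro bexI[of _ P]) auto
  next
    case False
    have "infinite (next_in A P)" using infinite_next_in assms(2) step(1) by (simp add: live_def)
    then have "next_in A P \<noteq> {}" by auto
    then obtain y where y: "y \<in> next_in A P" by blast
    then have "y \<in> next_in A0 P" using next_in_mono assms(3) by blast
    then obtain u where u: "u \<in> F" "initial (insert y P) u" "u - insert y P \<subseteq> A"
      using step.IH[OF False] by blast
    have "initial P u" using initial_trans[OF initial_insert u(2)] y by (auto simp: next_in_def)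
    then show ?thesis using u y by (auto simp: next_in_def)
  qed
qed

text \<open>The Nash-Williams theorem for the partition of \<open>F\<close> into \<open>C\<close>
  and its complement, by bar induction on \<open>P\<close>. The induction hypothesis and fusion give
  every one-node extension \<open>insert y P\<close> an answer \<open>b\<close>, and infinitely many
  \<open>y\<close> have the same one.\<close>

lemma homogeneous:
  assumes "live P" "cond A" "A \<subseteq> A0"
  shows "\<exists>A'\<subseteq>A. cond A' \<and> (\<exists>b. \<forall>u\<in>F. initial P u \<longrightarrow> u - P \<subseteq> A' \<longrightarrow> (u \<in> C \<longleftrightarrow> b))"
  using assms
proof (induction arbitrary: A rule: live_induct)
  case (step P)
  show ?case
  proof (cases "P \<in> F")
    case True
    then show ?thesis
      by (intro exI[of _ A] conjI exI[of _ "P \<in> C"]) (use F_ini step in auto)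
  next
    case False
    define hom where "hom y X b \<longleftrightarrow>
      (\<forall>u\<in>F. initial (insert y P) u \<longrightarrow> u - insert y P \<subseteq> X \<longrightarrow> (u \<in> C \<longleftrightarrow> b))" for y X b
    have hom_mono: "hom y Y b" if "hom y X b" "Y \<subseteq> X" for y X Y b
      using that unfolding hom_def by (meson order_trans)
    \<comment> \<open>The answer for \<open>y\<close> may only refer to elements after
      \<open>y\<close>, because fusion grants the condition on such a tail.\<close>
    define \<Phi> where "\<Phi> y X \<longleftrightarrow> (y \<in> next_in A0 P \<longrightarrow> (\<exists>b. hom y X b))" for y X
    have "\<exists>A'\<subseteq>A. cond A' \<and> (\<forall>m\<in>insert 0 A'. \<Phi> m (A' \<inter> {m<..}))"
    proof (rule fusion[OF step.prems(1)])
      fix m X Y assume "\<Phi> m X" "Y \<subseteq> X"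
      then show "\<Phi> m Y" unfolding \<Phi>_def using hom_mono by blast
    next
      fix m X assume X: "cond X" "X \<subseteq> A"
      show "\<exists>Y\<subseteq>X. cond Y \<and> \<Phi> m Y"
      proof (cases "m \<in> next_in A0 P")
        case True
        have "X \<subseteq> A0" using X(2) step.prems(2) by blast
        then show ?thesis
          using step.IH[OF False True X(1)] unfolding \<Phi>_def hom_def by blast
      next
        case False
        then show ?thesis using X unfolding \<Phi>_def by blast
      qed
    qed
    then obtain A1 where A1: "A1 \<subseteq> A" "cond A1" "\<And>y. y \<in> A1 \<Longrightarrow> \<Phi> y (A1 \<inter> {y<..})"
      by (meson insertI2)
    have "\<exists>b. hom y (A1 \<inter> {y<..}) b" if y: "y \<in> next_in A1 P" for y
    proof -
      have "y \<in> A1" "y \<in> next_in A0 P" using y A1(1) step.prems(2) by (auto simp: next_in_def)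
      then show ?thesis using A1(3) unfolding \<Phi>_def by blast
    qed
    then obtain c where c: "\<And>y. y \<in> next_in A1 P \<Longrightarrow> hom y (A1 \<inter> {y<..}) (c y)" by metis
    have "infinite (next_in A1 P)" using infinite_next_in A1(2) step(1) by (simp add: live_def)
    moreover have "next_in A1 P = {y \<in> next_in A1 P. c y} \<union> {y \<in> next_in A1 P. \<not> c y}" by auto
    ultimately have "infinite {y \<in> next_in A1 P. c y} \<or> infinite {y \<in> next_in A1 P. \<not> c y}"
      by (metis (no_types, lifting) finite_UnI)
    then obtain I b where I: "I \<subseteq> next_in A1 P" "infinite I" "\<And>y. y \<in> I \<Longrightarrow> c y = b"
      using that[of "{y \<in> next_in A1 P. c y}" True] that[of "{y \<in> next_in A1 P. \<not> c y}" False]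
      by blast
    obtain A2 where A2: "A2 \<subseteq> A1" "cond A2" "next_in A2 P \<subseteq> I"
      using cond_thin_next[OF A1(2) I(1,2)] by blast
    have "u \<in> C \<longleftrightarrow> b" if u: "u \<in> F" "initial P u" "u - P \<subseteq> A2" for u
    proof -
      have "u \<noteq> P" using u(1) False by auto
      then obtain y where y: "y \<in> u - P" "pa y = nxt P" "\<forall>x\<in>P. x < y" "initial (insert y P) u"
        using valid_next[OF F_valid[OF u(1)] _ u(2)] step(1) by (auto simp: live_def)
      then have "y \<in> next_in A2 P" using u(3) by (auto simp: next_in_def)
      then have "y \<in> I" using A2(3) by blast
      then have *: "hom y (A1 \<inter> {y<..}) b" using c[of y] I(1,3) by blast
      have "u - insert y P \<subseteq> A1 \<inter> {y<..}"
        using u(3) A2(1) y(4) by (auto simp: initial_def)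
      then show ?thesis using * u(1) y(4) unfolding hom_def by blast
    qed
    then have "\<forall>u\<in>F. initial P u \<longrightarrow> u - P \<subseteq> A2 \<longrightarrow> (u \<in> C \<longleftrightarrow> b)" by blast
    moreover have "A2 \<subseteq> A" using A1(1) A2(1) by blast
    ultimately show ?thesis using A2(2) by (intro exI[of _ A2] conjI exI[of _ b])
  qed
qed

section \<open>Separation and mixing\<close>

definition above :: "nat set \<Rightarrow> nat set"
  where "above E = {z. \<forall>w\<in>E. w < z}"

text \<open>Only new elements above both \<open>P\<close> and \<open>Q\<close> count, so that the condition depends on a tail of \<open>X\<close>
  and can be decided by fusion.\<close>

definition sep :: "nat set \<Rightarrow> nat set \<Rightarrow> nat set \<Rightarrow> bool"
  where "sep X P Q \<longleftrightarrow> (\<forall>u\<in>F. \<forall>v\<in>F. initial P u \<longrightarrow> initial Q v \<longrightarrow>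
    u - P \<subseteq> X \<inter> above (P \<union> Q) \<longrightarrow> v - Q \<subseteq> X \<inter> above (P \<union> Q) \<longrightarrow> (u, v) \<notin> R)"

lemma sep_mono:
  assumes "sep X P Q" "Y \<inter> above (P \<union> Q) \<subseteq> X"
  shows "sep Y P Q"
  unfolding sep_def
proof (intro ballI impI)
  fix u v assume "u \<in> F" "v \<in> F" "initial P u" "initial Q v"
    "u - P \<subseteq> Y \<inter> above (P \<union> Q)" "v - Q \<subseteq> Y \<inter> above (P \<union> Q)"
  then show "(u, v) \<notin> R" using assms unfolding sep_def by (meson le_inf_iff order_trans)
qed

text \<open>For a single pair the condition is met trivially: either some subspace separates
  \<open>P\<close> and \<open>Q\<close> and is taken, or none does and nothing has to be changed.
  Fusion then treats all pairs.\<close>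

lemma ex_decided:
  "\<exists>A1\<subseteq>A0. cond A1 \<and> (\<forall>P Q Y. valid P \<longrightarrow> valid Q \<longrightarrow> P \<subseteq> insert 0 A1 \<longrightarrow> Q \<subseteq> insert 0 A1 \<longrightarrow>
    \<not> sep A1 P Q \<longrightarrow> Y \<subseteq> A1 \<longrightarrow> cond Y \<longrightarrow> \<not> sep Y P Q)"
proof -
  let ?\<phi> = "\<lambda>P Q X. sep X P Q \<or> (\<forall>Y\<subseteq>X. cond Y \<longrightarrow> \<not> sep Y P Q)"
  have "\<exists>A1\<subseteq>A0. cond A1 \<and> (\<forall>m\<in>insert 0 A1. \<forall>P Q. P \<subseteq> insert 0 A0 \<inter> {..m} \<longrightarrow>
    Q \<subseteq> insert 0 A0 \<inter> {..m} \<longrightarrow> ?\<phi> P Q (A1 \<inter> {m<..}))"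
  proof (rule fusion_pairs[OF cond_A0])
    fix P Q X Y assume *: "?\<phi> P Q X" "Y \<subseteq> X"
    from *(1) show "?\<phi> P Q Y"
    proof
      assume "sep X P Q"
      then have "sep Y P Q" by (rule sep_mono) (use *(2) in auto)
      then show ?thesis ..
    qed (use *(2) in auto)
  next
    fix P Q X assume X: "cond X"
    show "\<exists>Y\<subseteq>X. cond Y \<and> ?\<phi> P Q Y"
    proof (cases "\<exists>Y\<subseteq>X. cond Y \<and> sep Y P Q")
      case True
      then show ?thesis by blast
    next
      case False
      then show ?thesis using X by blast
    qed
  qed
  then obtain A1 where A1: "A1 \<subseteq> A0" "cond A1" and
    *: "\<And>m P Q. m \<in> insert 0 A1 \<Longrightarrow> P \<subseteq> insert 0 A0 \<inter> {..m} \<Longrightarrow> Q \<subseteq> insert 0 A0 \<inter> {..m} \<Longrightarrow>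
      ?\<phi> P Q (A1 \<inter> {m<..})" by meson
  have "\<not> sep Y P Q" if h: "valid P" "valid Q" "P \<subseteq> insert 0 A1" "Q \<subseteq> insert 0 A1" "\<not> sep A1 P Q"
    "Y \<subseteq> A1" "cond Y" for P Q Y
  proof
    assume Y: "sep Y P Q"
    \<comment> \<open>Fusion speaks about the tail beyond \<open>m\<close>. Passing to it changes
      nothing, since \<open>sep\<close> looks only at elements above \<open>P\<close> and
      \<open>Q\<close>, hence beyond \<open>m\<close>.\<close>
    define m where "m = Max (P \<union> Q)"
    have fin: "finite (P \<union> Q)" "0 \<in> P \<union> Q" using h valid_finite valid_0 by auto
    then have m: "m \<in> P \<union> Q" unfolding m_def by (intro Max_in) auto
    have sub: "P \<union> Q \<subseteq> {..m}" unfolding m_def using fin by auto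
    have ab: "above (P \<union> Q) \<subseteq> {m<..}" using m by (auto simp: above_def)
    have "?\<phi> P Q (A1 \<inter> {m<..})"
      by (rule *) (use m sub h A1 in auto)
    moreover have "\<not> sep (A1 \<inter> {m<..}) P Q" using h(5) sep_mono[of _ P Q A1] ab by blast
    moreover have "sep (Y \<inter> {m<..}) P Q" by (rule sep_mono[OF Y]) auto
    moreover have "cond (Y \<inter> {m<..})" using cond_tail h(7) by blast
    ultimately show False using h(6) by blast
  qed
  then show ?thesis using A1 by (intro exI[of _ A1]) simp
qed

end

locale decided = front_relation +
  fixes A1 :: "nat set"
  assumes A1_sub: "A1 \<subseteq> A0" and cond_A1: "cond A1"
    and decided: "valid P \<Longrightarrow> valid Q \<Longrightarrow> P \<subseteq> insert 0 A1 \<Longrightarrow> Q \<subseteq> insert 0 A1 \<Longrightarrow>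
      \<not> sep A1 P Q \<Longrightarrow> Y \<subseteq> A1 \<Longrightarrow> cond Y \<Longrightarrow> \<not> sep Y P Q"
begin

definition good :: "nat set \<Rightarrow> bool"
  where "good P \<longleftrightarrow> live P \<and> P \<subseteq> insert 0 A1"

definition mix :: "nat set \<Rightarrow> nat set \<Rightarrow> bool"
  where "mix P Q \<longleftrightarrow> \<not> sep A1 P Q"

lemma good_valid: "good P \<Longrightarrow> valid P"
  by (simp add: good_def live_def)

lemma good_finite: "good P \<Longrightarrow> finite P"
  using good_valid valid_finite by blast

lemma good_0: "good P \<Longrightarrow> 0 \<in> P"
  using good_valid valid_0 by blast

lemma good_prefix: "u \<in> F \<Longrightarrow> u \<subseteq> insert 0 A1 \<Longrightarrow> initial P u \<Longrightarrow> 0 \<in> P \<Longrightarrow> good P"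
  using live_prefix unfolding good_def initial_def by blast

lemma good_insert: "good P \<Longrightarrow> P \<notin> F \<Longrightarrow> y \<in> next_in A1 P \<Longrightarrow> good (insert y P)"
  using live_insert next_in_mono[OF A1_sub] unfolding good_def next_in_def by blast

text \<open>Since mixing is decided, a pair not separated in \<open>A1\<close> is not separated in
  any subspace, so equivalent extensions can be found inside an arbitrary \<open>Y\<close>. The
  later thinning arguments rest on this freedom.\<close>

lemma mixE:
  assumes "good P" "good Q" "mix P Q" "cond Y" "Y \<subseteq> A1"
  obtains u v where "u \<in> F" "v \<in> F" "initial P u" "initial Q v" "(u, v) \<in> R"
    "u - P \<subseteq> Y" "v - Q \<subseteq> Y" "u - P \<subseteq> above (P \<union> Q)" "v - Q \<subseteq> above (P \<union> Q)"
    "u \<subseteq> insert 0 A1" "v \<subseteq> insert 0 A1"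
proof -
  have "\<not> sep Y P Q"
    using decided[of P Q Y] assms unfolding good_def live_def mix_def by blast
  then obtain u v where *: "u \<in> F" "v \<in> F" "initial P u" "initial Q v" "(u, v) \<in> R"
    "u - P \<subseteq> Y" "v - Q \<subseteq> Y" "u - P \<subseteq> above (P \<union> Q)" "v - Q \<subseteq> above (P \<union> Q)"
    unfolding sep_def by auto
  moreover have "u \<subseteq> insert 0 A1" "v \<subseteq> insert 0 A1"
    using assms(1,2,5) *(6,7) unfolding good_def by blast+
  ultimately show ?thesis by (rule that)
qed

lemma mixI:
  assumes "u \<in> F" "v \<in> F" "initial P u" "initial Q v" "(u, v) \<in> R"
    "u - P \<subseteq> A1 \<inter> above (P \<union> Q)" "v - Q \<subseteq> A1 \<inter> above (P \<union> Q)"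
  shows "mix P Q"
  using assms unfolding mix_def sep_def by blast

lemma mix_sym: "mix P Q \<Longrightarrow> mix Q P"
  unfolding mix_def sep_def by (metis R_sym Un_commute)

lemma above_Max: "finite E \<Longrightarrow> {Max E<..} \<subseteq> above E"
  by (auto simp: above_def intro: le_less_trans[OF Max_ge])

lemma above_mono: "E \<subseteq> E' \<Longrightarrow> above E' \<subseteq> above E"
  by (auto simp: above_def)

lemma mix_refl:
  assumes "good P"
  shows "mix P P"
proof -
  have "cond (A1 \<inter> {Max P<..})" "A1 \<inter> {Max P<..} \<subseteq> A0" using cond_tail cond_A1 A1_sub by auto
  then obtain u where u: "u \<in> F" "initial P u" "u - P \<subseteq> A1 \<inter> {Max P<..}"
    using extension_exists assms unfolding good_def by blast
  have "{Max P<..} \<subseteq> above P" using good_finite[OF assms] by (rule above_Max)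
  then show ?thesis using u R_refl by (intro mixI[of u u]) auto
qed

text \<open>On a homogeneous subspace every extension of \<open>Q\<close> has equivalents above \<open>P\<close> and above \<open>S\<close>.\<close>

lemma mix_trans:
  assumes "good P" "good Q" "good S" "mix P Q" "mix Q S"
  shows "mix P S"
proof -
  define D where "D = A1 \<inter> {Max (P \<union> Q \<union> S)<..}"
  have D: "cond D" "D \<subseteq> A1" unfolding D_def using cond_tail cond_A1 by auto
  have "D \<subseteq> above (P \<union> Q \<union> S)"
    unfolding D_def using above_Max[of "P \<union> Q \<union> S"] good_finite assms by blast
  then have DPS: "D \<subseteq> A1 \<inter> above (P \<union> S)" using D(2) by (auto simp: above_def)
  define C1 where "C1 = {v. \<exists>u\<in>F. initial P u \<and> u - P \<subseteq> D \<and> (u, v) \<in> R}"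
  define C2 where "C2 = {v. \<exists>w\<in>F. initial S w \<and> w - S \<subseteq> D \<and> (v, w) \<in> R}"
  have q: "live Q" using assms by (simp add: good_def)
  have "D \<subseteq> A0" using D(2) A1_sub by blast
  then obtain D1 b1 where D1: "D1 \<subseteq> D" "cond D1"
    "\<And>v. v \<in> F \<Longrightarrow> initial Q v \<Longrightarrow> v - Q \<subseteq> D1 \<Longrightarrow> (v \<in> C1 \<longleftrightarrow> b1)"
    using homogeneous[OF q D(1), of C1] by meson
  have "D1 \<subseteq> A0" using D1(1) \<open>D \<subseteq> A0\<close> by blast
  then obtain D2 b2 where D2: "D2 \<subseteq> D1" "cond D2"
    "\<And>v. v \<in> F \<Longrightarrow> initial Q v \<Longrightarrow> v - Q \<subseteq> D2 \<Longrightarrow> (v \<in> C2 \<longleftrightarrow> b2)"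
    using homogeneous[OF q D1(2), of C2] by meson
  \<comment> \<open>Mixing puts some extension of \<open>Q\<close> inside \<open>D1\<close> into
    \<open>C1\<close>, so by homogeneity all of them are there. The same holds for \<open>b2\<close>
    and \<open>C2\<close>, and then a common extension links \<open>P\<close> with
    \<open>S\<close>.\<close>
  have b1
  proof -
    obtain u v where uv: "u \<in> F" "v \<in> F" "initial P u" "initial Q v" "(u, v) \<in> R" "u - P \<subseteq> D1" "v - Q \<subseteq> D1"
      "u - P \<subseteq> above (P \<union> Q)" "v - Q \<subseteq> above (P \<union> Q)" "u \<subseteq> insert 0 A1" "v \<subseteq> insert 0 A1"
      by (rule mixE[OF assms(1,2,4) D1(2) order_trans[OF D1(1) D(2)]])
    then have "v \<in> C1" unfolding C1_def using D1(1) by blast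
    then show ?thesis using D1(3) uv by blast
  qed
  have b2
  proof -
    obtain v w where vw: "v \<in> F" "w \<in> F" "initial Q v" "initial S w" "(v, w) \<in> R" "v - Q \<subseteq> D2" "w - S \<subseteq> D2"
      "v - Q \<subseteq> above (Q \<union> S)" "w - S \<subseteq> above (Q \<union> S)" "v \<subseteq> insert 0 A1" "w \<subseteq> insert 0 A1"
      by (rule mixE[OF assms(2,3,5) D2(2) order_trans[OF D2(1) order_trans[OF D1(1) D(2)]]])
    then have "v \<in> C2" unfolding C2_def using D1(1) D2(1) by blast
    then show ?thesis using D2(3) vw by blast
  qed
  have "D2 \<subseteq> A0" using D2(1) \<open>D1 \<subseteq> A0\<close> by blast
  then obtain v where v: "v \<in> F" "initial Q v" "v - Q \<subseteq> D2" using extension_exists[OF q D2(2)] by blast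
  have "v \<in> C1" "v \<in> C2" using D1(3)[of v] D2(1,3) v \<open>b1\<close> \<open>b2\<close> by auto
  then obtain u w where "u \<in> F" "initial P u" "u - P \<subseteq> D" "(u, v) \<in> R"
    "w \<in> F" "initial S w" "w - S \<subseteq> D" "(v, w) \<in> R" unfolding C1_def C2_def by blast
  then show ?thesis using DPS R_trans by (intro mixI[of u w]) auto
qed

text \<open>Cutting both sets at the same number leaves remainders that lie above both initial
  parts. A positive \<open>m\<close> keeps the root out of the remainders.\<close>

lemma mix_prefix:
  assumes "u \<in> F" "v \<in> F" "u \<subseteq> insert 0 A1" "v \<subseteq> insert 0 A1" "(u, v) \<in> R" "0 < m"
  shows "mix (u \<inter> {..<m}) (v \<inter> {..<m})"
proof (rule mixI[OF assms(1,2) initial_lessThan initial_lessThan assms(5)])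
  show "u - u \<inter> {..<m} \<subseteq> A1 \<inter> above (u \<inter> {..<m} \<union> v \<inter> {..<m})"
    "v - v \<inter> {..<m} \<subseteq> A1 \<inter> above (u \<inter> {..<m} \<union> v \<inter> {..<m})"
    using assms(3,4,6) by (force simp: above_def)+
qed

section \<open>Known and unknown next nodes\<close>

definition known_in :: "nat set \<Rightarrow> nat set \<Rightarrow> bool"
  where "known_in X P \<longleftrightarrow>
    (\<forall>y\<in>next_in X P. \<forall>y'\<in>next_in X P. y \<noteq> y' \<longrightarrow> \<not> mix (insert y P) (insert y' P))"

definition unknown_in :: "nat set \<Rightarrow> nat set \<Rightarrow> bool"
  where "unknown_in X P \<longleftrightarrow>
    (\<forall>y\<in>next_in X P. \<forall>y'\<in>next_in X P. y \<noteq> y' \<longrightarrow> mix (insert y P) (insert y' P))"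

lemma next_in_tail:
  assumes "finite P" "0 \<in> P" "P \<subseteq> insert 0 X"
  obtains m where "m \<in> insert 0 X" "P \<subseteq> {..m}" "m \<in> P" "next_in (X \<inter> {m<..}) P = next_in X P"
proof (rule that[of "Max P"])
  show m: "Max P \<in> P" using assms by (intro Max_in) auto
  then show "Max P \<in> insert 0 X" using assms by blast
  show "P \<subseteq> {..Max P}" using assms by auto
  show "next_in (X \<inter> {Max P<..}) P = next_in X P" using m by (auto simp: next_in_def)
qed

text \<open>Ramsey's theorem for pairs among the next nodes of a single stage, followed by fusion.
  The property depends only on the next nodes, all of which lie beyond the stage, so a tail
  determines it.\<close>

lemma ex_classified:
  "\<exists>A2\<subseteq>A1. cond A2 \<and> (\<forall>P. good P \<longrightarrow> P \<subseteq> insert 0 A2 \<longrightarrow> known_in A2 P \<or> unknown_in A2 P)"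
proof -
  let ?\<phi> = "\<lambda>P Q :: nat set. \<lambda>X. good P \<longrightarrow> known_in X P \<or> unknown_in X P"
  have "\<exists>A2\<subseteq>A1. cond A2 \<and> (\<forall>m\<in>insert 0 A2. \<forall>P Q. P \<subseteq> insert 0 A1 \<inter> {..m} \<longrightarrow>
    Q \<subseteq> insert 0 A1 \<inter> {..m} \<longrightarrow> ?\<phi> P Q (A2 \<inter> {m<..}))"
  proof (rule fusion_pairs[OF cond_A1])
    fix P Q X Y assume "?\<phi> P Q X" "Y \<subseteq> X"
    then show "?\<phi> P Q Y"
      using next_in_mono[of Y X P] unfolding known_in_def unknown_in_def by blast
  next
    fix P Q X assume X: "cond X" "X \<subseteq> A1"
    show "\<exists>Y\<subseteq>X. cond Y \<and> ?\<phi> P Q Y"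
    proof (cases "good P")
      case True
      \<comment> \<open>Colour 0 stands for mixed pairs. As mixing is symmetric, the colour does not
        depend on the order in which the pair is written.\<close>
      define f :: "nat set \<Rightarrow> nat" where
        "f e = (if \<exists>y y'. e = {y, y'} \<and> mix (insert y P) (insert y' P) then 0 else 1)" for e
      have f2: "\<forall>x\<in>next_in X P. \<forall>y\<in>next_in X P. x \<noteq> y \<longrightarrow> f {x, y} < 2" by (simp add: f_def)
      obtain I t where I: "I \<subseteq> next_in X P" "infinite I" "\<forall>x\<in>I. \<forall>y\<in>I. x \<noteq> y \<longrightarrow> f {x, y} = t"
        using Ramsey2[OF infinite_next_in[OF X(1) good_valid[OF True]] f2] by blast
      obtain Y where Y: "Y \<subseteq> X" "cond Y" "next_in Y P \<subseteq> I" using cond_thin_next[OF X(1) I(1,2)] by blast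
      have f: "f {x, y} = 0 \<longleftrightarrow> mix (insert x P) (insert y P)" for x y
        using mix_sym by (auto simp: f_def doubleton_eq_iff)
      have "known_in Y P \<or> unknown_in Y P"
      proof (cases "t = 0")
        case True
        then have "unknown_in Y P" unfolding unknown_in_def using I(3) f Y(3) by (metis subsetD)
        then show ?thesis ..
      next
        case False
        then have "known_in Y P" unfolding known_in_def using I(3) f Y(3) by (metis subsetD)
        then show ?thesis ..
      qed
      then show ?thesis using Y by blast
    qed (use X in blast)
  qed
  then obtain A2 where A2: "A2 \<subseteq> A1" "cond A2" and
    *: "\<And>m P Q. m \<in> insert 0 A2 \<Longrightarrow> P \<subseteq> insert 0 A1 \<inter> {..m} \<Longrightarrow> Q \<subseteq> insert 0 A1 \<inter> {..m} \<Longrightarrow>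
      ?\<phi> P Q (A2 \<inter> {m<..})" by meson
  have "known_in A2 P \<or> unknown_in A2 P" if P: "good P" "P \<subseteq> insert 0 A2" for P
  proof -
    obtain m where m: "m \<in> insert 0 A2" "P \<subseteq> {..m}" "m \<in> P" "next_in (A2 \<inter> {m<..}) P = next_in A2 P"
      by (rule next_in_tail[OF good_finite[OF P(1)] good_0[OF P(1)] P(2)])
    have "P \<subseteq> insert 0 A1 \<inter> {..m}" using m(2) P(2) A2(1) by blast
    then show ?thesis
      using *[OF m(1), of P P] P(1) m(4) unfolding known_in_def unknown_in_def by simp
  qed
  then show ?thesis using A2 by (intro exI[of _ A2]) simp
qed

end

locale classified = decided +
  fixes A2 :: "nat set"
  assumes A2_sub: "A2 \<subseteq> A1" and cond_A2: "cond A2"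
    and classified: "good P \<Longrightarrow> P \<subseteq> insert 0 A2 \<Longrightarrow> known_in A2 P \<or> unknown_in A2 P"
begin

text \<open>A member of the front is not continued within the front, so it has no next node to be
  known.\<close>

definition known :: "nat set \<Rightarrow> bool"
  where "known P \<longleftrightarrow> P \<notin> F \<and> known_in A2 P"

text \<open>Otherwise \<open>insert x P\<close> is separated from \<open>Q\<close>, hence from every \<open>Q'\<close> that extends \<open>Q\<close> far out, and so
  is every \<open>insert y P\<close>, because it is mixed with \<open>insert x P\<close>; then \<open>P\<close> and \<open>Q\<close> are separated.\<close>

lemma mix_unknown:
  assumes P: "good P" "P \<subseteq> insert 0 A2" "P \<notin> F" "\<not> known P" and x: "x \<in> next_in A2 P"
    and Q: "good Q" "mix P Q"
  shows "mix (insert x P) Q"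
proof (rule ccontr)
  assume "\<not> mix (insert x P) Q"
  then have sep: "sep A1 (insert x P) Q" by (simp add: mix_def)
  have unk: "unknown_in A2 P" using P classified known_def by blast
  have gx: "good (insert x P)" using good_insert P x next_in_mono[OF A2_sub] by blast
  define m where "m = Max (insert x P \<union> Q)"
  have fin: "finite (insert x P \<union> Q)" using good_finite[OF gx] good_finite[OF Q(1)] by simp
  then have m: "x \<le> m" "\<And>w. w \<in> P \<Longrightarrow> w \<le> m" "\<And>w. w \<in> Q \<Longrightarrow> w \<le> m" unfolding m_def by auto
  have D: "cond (A2 \<inter> {m<..})" "A2 \<inter> {m<..} \<subseteq> A1" using cond_tail cond_A2 A2_sub by auto
  obtain u v where uv: "u \<in> F" "v \<in> F" "initial P u" "initial Q v" "(u, v) \<in> R"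
    "u - P \<subseteq> A2 \<inter> {m<..}" "v - Q \<subseteq> A2 \<inter> {m<..}"
    "u - P \<subseteq> above (P \<union> Q)" "v - Q \<subseteq> above (P \<union> Q)" "u \<subseteq> insert 0 A1" "v \<subseteq> insert 0 A1"
    by (rule mixE[OF P(1) Q(1,2) D])
  note u = uv(1,3,6) and v = uv(2,4,7,11) and R = uv(5)
  have "u \<noteq> P" using u P by auto
  then obtain y where y: "y \<in> u - P" "pa y = nxt P" "\<forall>x\<in>P. x < y" "initial (insert y P) u"
    using valid_next[OF F_valid[OF u(1)] good_valid[OF P(1)] u(2)] by blast
  then have y2: "y \<in> next_in A2 P" "m < y" using u(3) by (auto simp: next_in_def)
  then have gy: "good (insert y P)" using good_insert P next_in_mono[OF A2_sub] by blast
  \<comment> \<open>The part of \<open>v\<close> up to \<open>y\<close> goes into \<open>Q'\<close>,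
    so that what is left of \<open>u\<close> and of \<open>v\<close> lies above both
    \<open>insert y P\<close> and \<open>Q'\<close>, as \<open>mixI\<close> requires.\<close>
  define Q' where "Q' = v \<inter> {..y}"
  have sub: "Q \<subseteq> Q'" unfolding Q'_def using v(2) m(3) y2(2) by (fastforce simp: initial_def)
  have iQ': "initial Q' v" unfolding Q'_def by (rule initial_atMost)
  have gQ': "good Q'" using good_prefix[OF v(1,4) iQ'] sub good_0[OF Q(1)] by blast
  have Q'D: "Q' - Q \<subseteq> A2 \<inter> {m<..}" using v(3) unfolding Q'_def by blast
  have "mix (insert y P) Q'"
  proof (rule mixI[OF u(1) v(1) y(4) iQ' R])
    have "z \<in> A1 \<and> z > y" if "z \<in> u - insert y P" for z
      using that y(4) u(3) A2_sub by (auto simp: initial_def)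
    then show "u - insert y P \<subseteq> A1 \<inter> above (insert y P \<union> Q')"
      using m y2(2) by (fastforce simp: above_def Q'_def)
    have "z \<in> A1 \<and> z > y" if "z \<in> v - Q'" for z
    proof
      show "y < z" using that by (auto simp: Q'_def)
      show "z \<in> A1" using that sub v(3) A2_sub by blast
    qed
    then show "v - Q' \<subseteq> A1 \<inter> above (insert y P \<union> Q')"
      using m y2(2) by (fastforce simp: above_def Q'_def)
  qed
  \<comment> \<open>As \<open>x \<le> m < y\<close>, these are two different next nodes of an
    unknown stage.\<close>
  moreover have "mix (insert x P) (insert y P)"
    using unk x y2 m(1) unfolding unknown_in_def by (metis not_less)
  ultimately have "mix (insert x P) Q'" using mix_trans gx gy gQ' by blast
  then obtain u' v' where uv': "u' \<in> F" "v' \<in> F" "initial (insert x P) u'" "initial Q' v'" "(u', v') \<in> R"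
    "u' - insert x P \<subseteq> A1" "v' - Q' \<subseteq> A1"
    "u' - insert x P \<subseteq> above (insert x P \<union> Q')" "v' - Q' \<subseteq> above (insert x P \<union> Q')"
    "u' \<subseteq> insert 0 A1" "v' \<subseteq> insert 0 A1"
    by (rule mixE[OF gx gQ' _ cond_A1 order_refl])
  have u': "u' \<in> F" "initial (insert x P) u'" "u' - insert x P \<subseteq> A1 \<inter> above (insert x P \<union> Q')"
    and v': "v' \<in> F" "initial Q' v'" "v' - Q' \<subseteq> A1 \<inter> above (insert x P \<union> Q')" and R': "(u', v') \<in> R"
    using uv' by auto
  have ab: "above (insert x P \<union> Q') \<subseteq> above (insert x P \<union> Q)" by (rule above_mono) (use sub in blast)
  have mab: "{m<..} \<subseteq> above (insert x P \<union> Q)" using m by (fastforce simp: above_def)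
  have "initial Q Q'" using v(2) sub unfolding initial_def Q'_def by blast
  then have "initial Q v'" using v'(2) by (rule initial_trans)
  \<comment> \<open>The elements of \<open>Q'\<close> outside \<open>Q\<close> lie beyond
    \<open>m\<close>, the maximum of \<open>insert x P\<close> and \<open>Q\<close>. So
    \<open>u'\<close>, \<open>v'\<close> are extensions of the kind that the separation of
    \<open>insert x P\<close> from \<open>Q\<close> forbids to be equivalent.\<close>
  moreover have "v' - Q \<subseteq> A1 \<inter> above (insert x P \<union> Q)"
  proof
    fix z assume z: "z \<in> v' - Q"
    show "z \<in> A1 \<inter> above (insert x P \<union> Q)"
    proof (cases "z \<in> Q'")
      case True
      then have "z \<in> A2 \<inter> {m<..}" using Q'D z by blast
      then show ?thesis using mab A2_sub by blast
    next
      case False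
      then have "z \<in> A1 \<inter> above (insert x P \<union> Q')" using v'(3) z by blast
      then show ?thesis using ab by blast
    qed
  qed
  moreover have "u' - insert x P \<subseteq> A1 \<inter> above (insert x P \<union> Q)" using u'(3) ab by blast
  ultimately show False using sep u'(1,2) v'(1) R' unfolding sep_def by blast
qed

text \<open>By transitivity at most one \<open>y\<close> has to be removed for each pair \<open>P\<close>, \<open>Q\<close>.\<close>

lemma ex_stable:
  "\<exists>A3\<subseteq>A2. cond A3 \<and> (\<forall>P Q y. good P \<longrightarrow> good Q \<longrightarrow> P \<subseteq> insert 0 A3 \<longrightarrow> Q \<subseteq> insert 0 A3 \<longrightarrow>
    known P \<longrightarrow> y \<in> next_in A3 P \<longrightarrow> y \<in> above Q \<longrightarrow> \<not> mix (insert y P) Q)"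
proof -
  let ?\<phi> = "\<lambda>P Q X. good P \<longrightarrow> good Q \<longrightarrow> known P \<longrightarrow>
    (\<forall>y\<in>next_in X P. y \<in> above Q \<longrightarrow> \<not> mix (insert y P) Q)"
  have "\<exists>A3\<subseteq>A2. cond A3 \<and> (\<forall>m\<in>insert 0 A3. \<forall>P Q. P \<subseteq> insert 0 A2 \<inter> {..m} \<longrightarrow>
    Q \<subseteq> insert 0 A2 \<inter> {..m} \<longrightarrow> ?\<phi> P Q (A3 \<inter> {m<..}))"
  proof (rule fusion_pairs[OF cond_A2])
    fix P Q X Y assume "?\<phi> P Q X" "Y \<subseteq> X"
    then show "?\<phi> P Q Y" using next_in_mono[of Y X P] by blast
  next
    fix P Q X assume X: "cond X" "X \<subseteq> A2"
    show "\<exists>Y\<subseteq>X. cond Y \<and> ?\<phi> P Q Y"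
    proof (cases "good P \<and> good Q \<and> known P")
      case True
      define G where "G = {y \<in> next_in X P. y \<in> above Q \<and> mix (insert y P) Q}"
      have "y = y'" if "y \<in> G" "y' \<in> G" for y y'
      proof (rule ccontr)
        assume ne: "y \<noteq> y'"
        have n: "y \<in> next_in A2 P" "y' \<in> next_in A2 P"
          using that next_in_mono[OF X(2)] by (auto simp: G_def)
        then have "good (insert y P)" "good (insert y' P)"
          using good_insert[of P] True next_in_mono[OF A2_sub] unfolding known_def by blast+
        then have "mix (insert y P) (insert y' P)"
          using that True mix_trans[of "insert y P" Q "insert y' P"] mix_sym by (auto simp: G_def)
        then show False using True n ne by (auto simp: known_def known_in_def)
      qed
      then have "finite G" by (metis finite.simps finite_subset insertI1 subsetI)
      then have "infinite (next_in X P - G)"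
        using infinite_next_in[OF X(1) good_valid] True by (metis Diff_infinite_finite)
      then obtain Y where "Y \<subseteq> X" "cond Y" "next_in Y P \<subseteq> next_in X P - G"
        using cond_thin_next[OF X(1), of "next_in X P - G" P] by blast
      then show ?thesis unfolding G_def by (intro exI[of _ Y]) blast
    qed (use X in blast)
  qed
  then obtain A3 where A3: "A3 \<subseteq> A2" "cond A3" and
    *: "\<And>m P Q. m \<in> insert 0 A3 \<Longrightarrow> P \<subseteq> insert 0 A2 \<inter> {..m} \<Longrightarrow> Q \<subseteq> insert 0 A2 \<inter> {..m} \<Longrightarrow>
      ?\<phi> P Q (A3 \<inter> {m<..})" by meson
  have "\<not> mix (insert y P) Q" if h: "good P" "good Q" "P \<subseteq> insert 0 A3" "Q \<subseteq> insert 0 A3"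
    "known P" "y \<in> next_in A3 P" "y \<in> above Q" for P Q y
  proof -
    have fin: "finite (P \<union> Q)" "0 \<in> P \<union> Q" "P \<union> Q \<subseteq> insert 0 A3"
      using h good_finite good_0 by auto
    obtain m where m: "m \<in> insert 0 A3" "P \<union> Q \<subseteq> {..m}" "m \<in> P \<union> Q" by (rule next_in_tail[OF fin])
    have "y \<in> next_in (A3 \<inter> {m<..}) P" using h(6,7) m(3) by (auto simp: next_in_def above_def)
    moreover have "P \<subseteq> insert 0 A2 \<inter> {..m}" "Q \<subseteq> insert 0 A2 \<inter> {..m}" using m(2) h(3,4) A3(1) by blast+
    ultimately show ?thesis using *[OF m(1)] h by blast
  qed
  then show ?thesis using A3 by (intro exI[of _ A3]) simp
qed

end

section \<open>The kernel of a member of the front\<close>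

lemma initial_insert_least:
  assumes "initial (insert y Q) v" "x \<in> v - Q"
  shows "y \<le> x"
proof (cases "x = y")
  case False
  then have "x \<in> v - insert y Q" using assms(2) by simp
  then have "\<forall>w\<in>insert y Q. w < x" using assms(1) unfolding initial_def by blast
  then show ?thesis by simp
qed simp

locale stable = classified +
  fixes A3 :: "nat set"
  assumes A3_sub: "A3 \<subseteq> A2" and cond_A3: "cond A3"
    and stable: "good P \<Longrightarrow> good Q \<Longrightarrow> P \<subseteq> insert 0 A3 \<Longrightarrow> Q \<subseteq> insert 0 A3 \<Longrightarrow>
      known P \<Longrightarrow> y \<in> next_in A3 P \<Longrightarrow> y \<in> above Q \<Longrightarrow> \<not> mix (insert y P) Q"
begin

text \<open>The nodes of \<open>u\<close> that were known at the moment they entered; the root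
  belongs to every stage and is counted in.\<close>

definition kernel :: "nat set \<Rightarrow> nat set"
  where "kernel u = insert 0 {y \<in> u. 0 < y \<and> known (u \<inter> {..<y})}"

lemma A3_A1: "A3 \<subseteq> A1"
  using A3_sub A2_sub by blast

text \<open>Cut both members at a known \<open>x\<close> of \<open>u\<close>, into \<open>P\<close>
  and \<open>Q\<close>. Stability separates \<open>insert x P\<close> from \<open>Q\<close>, whereas
  cuts just after \<open>x\<close> are mixed, so \<open>x\<close> must occur in \<open>v\<close>. If
  \<open>Q\<close> were unknown there, \<open>mix_unknown\<close> would mix
  \<open>insert x Q\<close> with \<open>P\<close>; by transitivity \<open>insert x P\<close> would
  be mixed with \<open>P\<close>, again against stability.\<close>

lemma R_imp_kernel_subset:
  assumes u: "u \<in> F" "u \<subseteq> insert 0 A3" and v: "v \<in> F" "v \<subseteq> insert 0 A3" and R: "(u, v) \<in> R"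
  shows "kernel u \<subseteq> kernel v"
proof
  fix x assume x: "x \<in> kernel u"
  show "x \<in> kernel v"
  proof (cases "x = 0")
    case True
    then show ?thesis by (simp add: kernel_def)
  next
    case False
    define P where "P = u \<inter> {..<x}"
    define Q where "Q = v \<inter> {..<x}"
    have xu: "x \<in> u" "0 < x" "known P" using x False by (auto simp: kernel_def P_def)
    have u1: "u \<subseteq> insert 0 A1" and v1: "v \<subseteq> insert 0 A1" using u v A3_A1 by blast+
    note vp = valid_pa[OF F_valid[OF u(1)] xu(1,2), folded P_def]
    have gP: "good P" by (rule good_prefix[OF u(1) u1 vp(2,3)])
    have Q0: "0 \<in> Q" using valid_0[OF F_valid[OF v(1)]] xu(2) by (simp add: Q_def)
    have iQ: "initial Q v" unfolding Q_def by (rule initial_lessThan)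
    have gQ: "good Q" by (rule good_prefix[OF v(1) v1 iQ Q0])
    have sub: "P \<subseteq> insert 0 A3" "Q \<subseteq> insert 0 A3" using u v by (auto simp: P_def Q_def)
    have x3: "x \<in> next_in A3 P" using vp(1) u(2) xu(2) by (auto simp: next_in_def)
    have xQ: "x \<in> above Q" "x \<in> above P" by (auto simp: above_def Q_def P_def)
    have mPQ: "mix P Q" unfolding P_def Q_def by (rule mix_prefix[OF u(1) v(1) u1 v1 R xu(2)])
    have uP: "u \<inter> {..<Suc x} = insert x P" using xu(1) by (auto simp: P_def less_Suc_eq)
    have m2: "mix (insert x P) (v \<inter> {..<Suc x})"
      using mix_prefix[OF u(1) v(1) u1 v1 R, of "Suc x"] uP by simp
    have nm: "\<not> mix (insert x P) Q" by (rule stable[OF gP gQ sub xu(3) x3 xQ(1)])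
    have xv: "x \<in> v"
    proof (rule ccontr)
      assume "x \<notin> v"
      then have "v \<inter> {..<Suc x} = Q" by (auto simp: Q_def less_Suc_eq)
      then show False using m2 nm by simp
    qed
    then have vQ: "v \<inter> {..<Suc x} = insert x Q" by (auto simp: Q_def less_Suc_eq)
    have "known Q"
    proof (rule ccontr)
      assume unk: "\<not> known Q"
      have "Q \<noteq> v" using xv by (auto simp: Q_def)
      then have QF: "Q \<notin> F" using F_ini v(1) iQ by blast
      have xQ3: "x \<in> next_in A3 Q"
        using valid_pa(1)[OF F_valid[OF v(1)] xv xu(2), folded Q_def] v(2) xu(2)
        by (auto simp: next_in_def)
      then have xQ2: "x \<in> next_in A2 Q" using next_in_mono[OF A3_sub] by blast
      have "Q \<subseteq> insert 0 A2" using sub A3_sub by blast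
      then have "mix (insert x Q) P"
        using mix_unknown[OF gQ _ QF unk xQ2 gP] mix_sym[OF mPQ] by blast
      moreover have "mix (insert x P) (insert x Q)" using m2 vQ by simp
      moreover have "good (insert x P)" "good (insert x Q)"
        using good_insert[OF gP _ next_in_mono[OF A3_A1, THEN subsetD, OF x3]] xu(3)
          good_insert[OF gQ QF next_in_mono[OF A3_A1, THEN subsetD, OF xQ3]] by (auto simp: known_def)
      ultimately have "mix (insert x P) P" using mix_trans[of "insert x P" "insert x Q" P] gP by blast
      then show False using stable[OF gP gP sub(1) sub(1) xu(3) x3 xQ(2)] by simp
    qed
    then show ?thesis using xv xu(2) by (simp add: kernel_def Q_def)
  qed
qed

lemma R_imp_kernel_eq:
  assumes "u \<in> F" "u \<subseteq> insert 0 A3" "v \<in> F" "v \<subseteq> insert 0 A3" "(u, v) \<in> R"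
  shows "kernel u = kernel v"
  using R_imp_kernel_subset[OF assms] R_imp_kernel_subset[OF assms(3,4,1,2) R_sym[OF assms(5)]] by blast

lemma next_kernel_iff:
  assumes "initial (insert x P) u" "\<And>w. w \<in> P \<Longrightarrow> w < x" "0 \<in> P"
  shows "x \<in> kernel u \<longleftrightarrow> known P"
proof -
  have "x \<in> u" "0 < x" using assms by (auto simp: initial_def)
  then show ?thesis using initial_first[OF assms(1,2)] by (auto simp: kernel_def)
qed

text \<open>The least new elements are both in the common kernel, hence equal.\<close>

lemma first_common:
  assumes u: "u \<in> F" "u \<subseteq> insert 0 A3" and v: "v \<in> F" "v \<subseteq> insert 0 A3" and R: "(u, v) \<in> R"
    and P: "good P" "known P" "initial P u" and Q: "good Q" "known Q" "initial Q v"
    and ab: "u - P \<subseteq> above (P \<union> Q)" "v - Q \<subseteq> above (P \<union> Q)"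
  obtains x where "x \<in> u - P" "x \<in> v - Q" "pa x = nxt P" "pa x = nxt Q" "x \<in> above (P \<union> Q)"
    "initial (insert x P) u" "initial (insert x Q) v" "mix (insert x P) (insert x Q)"
proof -
  have "u \<noteq> P" "v \<noteq> Q" using P(2) Q(2) u v by (auto simp: known_def)
  then obtain x y where
    x: "x \<in> u - P" "pa x = nxt P" "\<forall>w\<in>P. w < x" "initial (insert x P) u" and
    y: "y \<in> v - Q" "pa y = nxt Q" "\<forall>w\<in>Q. w < y" "initial (insert y Q) v"
    using valid_next[OF F_valid[OF u(1)] good_valid[OF P(1)] P(3)]
      valid_next[OF F_valid[OF v(1)] good_valid[OF Q(1)] Q(3)] by blast
  have K: "kernel u = kernel v" by (rule R_imp_kernel_eq[OF u v R])
  have K0: "kernel u \<subseteq> u" "kernel v \<subseteq> v"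
    using valid_0[OF F_valid[OF u(1)]] valid_0[OF F_valid[OF v(1)]] by (auto simp: kernel_def)
  have xK: "x \<in> kernel u" using next_kernel_iff[OF x(4)] x(3) good_0[OF P(1)] P(2) by blast
  have yK: "y \<in> kernel v" using next_kernel_iff[OF y(4)] y(3) good_0[OF Q(1)] Q(2) by blast
  have "x \<in> above (P \<union> Q)" "y \<in> above (P \<union> Q)" using x(1) y(1) ab by blast+
  then have "x \<notin> Q" "y \<notin> P" by (auto simp: above_def)
  then have "x \<in> v - Q" "y \<in> u - P" using xK yK K K0 by auto
  have xy: "x = y"
    using initial_insert_least[OF x(4) \<open>y \<in> u - P\<close>] initial_insert_least[OF y(4) \<open>x \<in> v - Q\<close>] by simp
  have eq: "u \<inter> {..<Suc x} = insert x P" "v \<inter> {..<Suc x} = insert x Q"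
    using initial_first(2)[OF x(4)] initial_first(2)[OF y(4)] x(3) y(3) xy by auto
  have "u \<subseteq> insert 0 A1" "v \<subseteq> insert 0 A1" using u v A3_A1 by blast+
  then have "mix (u \<inter> {..<Suc x}) (v \<inter> {..<Suc x})" using mix_prefix[OF u(1) v(1) _ _ R] by simp
  then have "mix (insert x P) (insert x Q)" using eq by simp
  then show ?thesis using that[OF x(1)] x y \<open>x \<in> above (P \<union> Q)\<close> xy by blast
qed

text \<open>For mixed known stages, infinitely many common next nodes \<open>x\<close> keep the
  extensions mixed: were there only finitely many, they could be removed from the subspace, and
  \<open>first_common\<close>, applied to equivalent extensions in what remains, would produce
  another one. The next nodes of \<open>P\<close> are then thinned to these.\<close>

lemma ex_synchronized:
  "\<exists>A4\<subseteq>A3. cond A4 \<and> (\<forall>P Q x. good P \<longrightarrow> good Q \<longrightarrow> P \<subseteq> insert 0 A4 \<longrightarrow> Q \<subseteq> insert 0 A4 \<longrightarrow>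
    known P \<longrightarrow> known Q \<longrightarrow> mix P Q \<longrightarrow> x \<in> next_in A4 P \<longrightarrow> x \<in> next_in A4 Q \<longrightarrow>
    mix (insert x P) (insert x Q))"
proof -
  define \<phi> where "\<phi> P Q X \<longleftrightarrow> (good P \<longrightarrow> good Q \<longrightarrow> known P \<longrightarrow> known Q \<longrightarrow> mix P Q \<longrightarrow>
    (\<forall>x\<in>next_in X P. x \<in> next_in X Q \<longrightarrow> mix (insert x P) (insert x Q)))" for P Q X
  have "\<exists>A4\<subseteq>A3. cond A4 \<and> (\<forall>m\<in>insert 0 A4. \<forall>P Q. P \<subseteq> insert 0 A3 \<inter> {..m} \<longrightarrow>
    Q \<subseteq> insert 0 A3 \<inter> {..m} \<longrightarrow> \<phi> P Q (A4 \<inter> {m<..}))"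
  proof (rule fusion_pairs[OF cond_A3])
    fix P Q X Y assume "\<phi> P Q X" "Y \<subseteq> X"
    then show "\<phi> P Q Y" using next_in_mono[of Y X P] next_in_mono[of Y X Q] unfolding \<phi>_def by blast
  next
    fix P Q X assume PQ: "P \<subseteq> insert 0 A3" "Q \<subseteq> insert 0 A3" and X: "cond X" "X \<subseteq> A3"
    show "\<exists>Y\<subseteq>X. cond Y \<and> \<phi> P Q Y"
    proof (cases "good P \<and> good Q \<and> known P \<and> known Q \<and> mix P Q")
      case True
      then have h: "good P" "good Q" "known P" "known Q" "mix P Q" by auto
      define G where "G = {x \<in> next_in X P. x \<in> above (P \<union> Q) \<and> mix (insert x P) (insert x Q)}"
      have "infinite G"
      proof
        assume fin: "finite G"
        then have "infinite (next_in X P - G)"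
          using infinite_next_in[OF X(1) good_valid[OF h(1)]] by simp
        then obtain Y where Y: "Y \<subseteq> X" "cond Y" "next_in Y P \<subseteq> next_in X P - G"
          using cond_thin_next[OF X(1), of "next_in X P - G" P] by blast
        have "Y \<subseteq> A1" using Y(1) X(2) A3_A1 by blast
        then obtain u v where uv: "u \<in> F" "v \<in> F" "initial P u" "initial Q v" "(u, v) \<in> R"
          "u - P \<subseteq> Y" "v - Q \<subseteq> Y" "u - P \<subseteq> above (P \<union> Q)" "v - Q \<subseteq> above (P \<union> Q)"
          "u \<subseteq> insert 0 A1" "v \<subseteq> insert 0 A1"
          by (rule mixE[OF h(1,2,5) Y(2)])
        have sub: "u \<subseteq> insert 0 A3" "v \<subseteq> insert 0 A3" using PQ uv(6,7) Y(1) X(2) by blast+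
        obtain x where x: "x \<in> u - P" "x \<in> v - Q" "pa x = nxt P" "pa x = nxt Q" "x \<in> above (P \<union> Q)"
          "initial (insert x P) u" "initial (insert x Q) v" "mix (insert x P) (insert x Q)"
          by (rule first_common[OF uv(1) sub(1) uv(2) sub(2) uv(5) h(1,3) uv(3) h(2,4) uv(4,8,9)])
        have "x \<in> next_in Y P" using x uv(6) by (auto simp: next_in_def above_def)
        moreover have "x \<in> G" using x uv(6) Y(1) by (auto simp: G_def next_in_def above_def)
        ultimately show False using Y(3) by blast
      qed
      then obtain Y where "Y \<subseteq> X" "cond Y" "next_in Y P \<subseteq> G"
        using cond_thin_next[OF X(1), of G P] by (auto simp: G_def)
      then show ?thesis unfolding G_def \<phi>_def by (intro exI[of _ Y]) blast
    next
      case False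
      then show ?thesis using X unfolding \<phi>_def by blast
    qed
  qed
  then obtain A4 where A4: "A4 \<subseteq> A3" "cond A4" and
    *: "\<And>m P Q. m \<in> insert 0 A4 \<Longrightarrow> P \<subseteq> insert 0 A3 \<inter> {..m} \<Longrightarrow> Q \<subseteq> insert 0 A3 \<inter> {..m} \<Longrightarrow>
      \<phi> P Q (A4 \<inter> {m<..})" by meson
  have "mix (insert x P) (insert x Q)" if h: "good P" "good Q" "P \<subseteq> insert 0 A4" "Q \<subseteq> insert 0 A4"
    "known P" "known Q" "mix P Q" "x \<in> next_in A4 P" "x \<in> next_in A4 Q" for P Q x
  proof -
    have fin: "finite (P \<union> Q)" "0 \<in> P \<union> Q" "P \<union> Q \<subseteq> insert 0 A4"
      using h good_finite good_0 by auto
    obtain m where m: "m \<in> insert 0 A4" "P \<union> Q \<subseteq> {..m}" "m \<in> P \<union> Q" by (rule next_in_tail[OF fin])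
    have "x \<in> next_in (A4 \<inter> {m<..}) P" "x \<in> next_in (A4 \<inter> {m<..}) Q"
      using h(8,9) m(3) by (auto simp: next_in_def)
    moreover have "P \<subseteq> insert 0 A3 \<inter> {..m}" "Q \<subseteq> insert 0 A3 \<inter> {..m}" using m(2) h(3,4) A4(1) by blast+
    ultimately show ?thesis using *[OF m(1)] h unfolding \<phi>_def by blast
  qed
  then show ?thesis using A4 by (intro exI[of _ A4]) simp
qed

end

locale synchronized = stable +
  fixes A4 :: "nat set"
  assumes A4_sub: "A4 \<subseteq> A3" and cond_A4: "cond A4"
    and synchronized: "good P \<Longrightarrow> good Q \<Longrightarrow> P \<subseteq> insert 0 A4 \<Longrightarrow> Q \<subseteq> insert 0 A4 \<Longrightarrow>
      known P \<Longrightarrow> known Q \<Longrightarrow> mix P Q \<Longrightarrow> x \<in> next_in A4 P \<Longrightarrow> x \<in> next_in A4 Q \<Longrightarrow>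
      mix (insert x P) (insert x Q)"
begin

lemma A4_A1: "A4 \<subseteq> A1" and A4_A2: "A4 \<subseteq> A2"
  using A4_sub A3_sub A2_sub by blast+

lemma first_new:
  assumes "u \<in> F" "u \<subseteq> insert 0 A4" "good P" "initial P u" "u \<noteq> P"
  obtains x where "x \<in> u - P" "x \<in> next_in A4 P" "initial (insert x P) u" "good (insert x P)" "P \<notin> F"
    "x \<in> kernel u \<longleftrightarrow> known P" "card (u - insert x P) < card (u - P)"
proof -
  obtain x where x: "x \<in> u - P" "pa x = nxt P" "\<forall>w\<in>P. w < x" "initial (insert x P) u"
    using valid_next[OF F_valid[OF assms(1)] good_valid[OF assms(3)] assms(4,5)] by blast
  have P0: "0 \<in> P" by (rule good_0[OF assms(3)])
  have "x \<in> A4" using x(1,3) assms(2) P0 by auto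
  then have n: "x \<in> next_in A4 P" using x by (simp add: next_in_def)
  have "u \<subseteq> insert 0 A1" using assms(2) A4_A1 by blast
  then have "good (insert x P)" using good_prefix[OF assms(1) _ x(4)] P0 by blast
  moreover have "P \<notin> F" using F_ini assms by blast
  moreover have "x \<in> kernel u \<longleftrightarrow> known P" using next_kernel_iff[OF x(4)] x(3) P0 by blast
  moreover have "card (u - insert x P) < card (u - P)"
    using x(1) valid_finite[OF F_valid[OF assms(1)]] by (intro psubset_card_mono) auto
  ultimately show ?thesis using that x(1,4) n by blast
qed

lemma kernel_sub: "u \<in> F \<Longrightarrow> kernel u \<subseteq> u"
  using valid_0 F_valid by (auto simp: kernel_def)

text \<open>Walk through \<open>u\<close> and \<open>v\<close> from the root, keeping the stages
  mixed and their parts of the kernels equal. Unknown nodes on either side are passed by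
  \<open>mix_unknown\<close> and leave the kernels alone. When both sides wait for a known node, it
  is the same one, as the kernels agree, and \<open>synchronized\<close> passes it on both sides at
  once.\<close>

lemma kernel_eq_imp_R:
  assumes u: "u \<in> F" "u \<subseteq> insert 0 A4" and v: "v \<in> F" "v \<subseteq> insert 0 A4" and K: "kernel u = kernel v"
  shows "(u, v) \<in> R"
proof -
  have step: "mix u v" if "good P" "good Q" "initial P u" "initial Q v" "mix P Q" "kernel u \<inter> P = kernel v \<inter> Q" for P Q
    using that
  proof (induction "card (u - P) + card (v - Q)" arbitrary: P Q rule: less_induct)
    case less
    have sub: "P \<subseteq> insert 0 A4" "Q \<subseteq> insert 0 A4" using u v less.prems(3,4) by (auto simp: initial_def)
    have sub2: "P \<subseteq> insert 0 A2" "Q \<subseteq> insert 0 A2" using sub A4_A2 by blast+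
    consider "u \<noteq> P" "\<not> known P" | "v \<noteq> Q" "\<not> known Q"
      | "u = P \<or> known P" "v = Q \<or> known Q" by blast
    then show ?case
    proof cases
      case 1
      obtain x where x: "x \<in> u - P" "x \<in> next_in A4 P" "initial (insert x P) u" "good (insert x P)" "P \<notin> F"
        "x \<in> kernel u \<longleftrightarrow> known P" "card (u - insert x P) < card (u - P)"
        by (rule first_new[OF u less.prems(1,3) 1(1)])
      have x2: "x \<in> next_in A2 P" using next_in_mono[OF A4_A2] x(2) by blast
      have "mix (insert x P) Q" by (rule mix_unknown[OF less.prems(1) sub2(1) x(5) 1(2) x2 less.prems(2,5)])
      moreover have "kernel u \<inter> insert x P = kernel v \<inter> Q" using x(6) 1(2) less.prems(6) by auto
      ultimately show ?thesis using less.hyps[OF _ x(4) less.prems(2) x(3) less.prems(4)] x(7) by simp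
    next
      case 2
      obtain x where x: "x \<in> v - Q" "x \<in> next_in A4 Q" "initial (insert x Q) v" "good (insert x Q)" "Q \<notin> F"
        "x \<in> kernel v \<longleftrightarrow> known Q" "card (v - insert x Q) < card (v - Q)"
        by (rule first_new[OF v less.prems(2,4) 2(1)])
      have x2: "x \<in> next_in A2 Q" using next_in_mono[OF A4_A2] x(2) by blast
      have "mix (insert x Q) P"
        by (rule mix_unknown[OF less.prems(2) sub2(2) x(5) 2(2) x2 less.prems(1) mix_sym[OF less.prems(5)]])
      then have "mix P (insert x Q)" by (rule mix_sym)
      moreover have "kernel u \<inter> P = kernel v \<inter> insert x Q" using x(6) 2(2) less.prems(6) by auto
      ultimately show ?thesis using less.hyps[OF _ less.prems(1) x(4) less.prems(3) x(3)] x(7) by simp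
    next
      case 3
      have K0: "kernel u \<subseteq> u" "kernel v \<subseteq> v" using kernel_sub u(1) v(1) by auto
      show ?thesis
      proof (cases "u = P")
        case True
        have "v = Q"
        proof (rule ccontr)
          assume ne: "v \<noteq> Q"
          obtain x where x: "x \<in> v - Q" "x \<in> next_in A4 Q" "initial (insert x Q) v" "good (insert x Q)" "Q \<notin> F"
            "x \<in> kernel v \<longleftrightarrow> known Q" "card (v - insert x Q) < card (v - Q)"
            by (rule first_new[OF v less.prems(2,4) ne])
          then have "x \<in> kernel u" using 3 ne K by blast
          then have "x \<in> kernel u \<inter> P" using K0 True by blast
          then show False using less.prems(6) x(1) by blast
        qed
        then show ?thesis using True less.prems(5) by simp
      next
        case False
        then have kP: "known P" using 3 by blast
        obtain x where x: "x \<in> u - P" "x \<in> next_in A4 P" "initial (insert x P) u" "good (insert x P)" "P \<notin> F"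
          "x \<in> kernel u \<longleftrightarrow> known P" "card (u - insert x P) < card (u - P)"
          by (rule first_new[OF u less.prems(1,3) False])
        have xK: "x \<in> kernel u" "x \<in> kernel v" using x(6) kP K by auto
        then have xv: "x \<in> v - Q" using less.prems(6) x(1) K0 by blast
        then have ne: "v \<noteq> Q" by blast
        then have kQ: "known Q" using 3 by blast
        obtain y where y: "y \<in> v - Q" "y \<in> next_in A4 Q" "initial (insert y Q) v" "good (insert y Q)" "Q \<notin> F"
          "y \<in> kernel v \<longleftrightarrow> known Q" "card (v - insert y Q) < card (v - Q)"
          by (rule first_new[OF v less.prems(2,4) ne])
        have yK: "y \<in> kernel u" "y \<in> kernel v" using y(6) kQ K by auto
        then have yu: "y \<in> u - P" using less.prems(6) y(1) K0 by blast
        \<comment> \<open>\<open>x\<close> is the least new element of \<open>u\<close> and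
          \<open>y\<close> that of \<open>v\<close>, but both occur among the new elements of either
          side.\<close>
        have xy: "y = x" using initial_insert_least[OF x(3) yu] initial_insert_least[OF y(3) xv] by simp
        note y = y[unfolded xy]
        have "mix (insert x P) (insert x Q)"
          by (rule synchronized[OF less.prems(1,2) sub kP kQ less.prems(5) x(2) y(2)])
        moreover have "kernel u \<inter> insert x P = kernel v \<inter> insert x Q" using xK less.prems(6) by blast
        ultimately show ?thesis using less.hyps[OF _ x(4) y(4) x(3) y(3)] x(7) y(7) by simp
      qed
    qed
  qed
  have g: "good u" "good v" using good_prefix u v A4_A1 valid_0 F_valid by (metis initial_refl insert_mono order_trans)+
  have r: "initial {0} u" "initial {0} v" using valid_0 F_valid u v by (auto simp: initial_def)
  have g0: "good {0}" using live_root by (simp add: good_def)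
  have "mix u v" by (rule step[OF g0 g0 r mix_refl[OF g0]]) (auto simp: kernel_def)
  then obtain u' v' where uv': "u' \<in> F" "v' \<in> F" "initial u u'" "initial v v'" "(u', v') \<in> R"
    "u' - u \<subseteq> A1" "v' - v \<subseteq> A1" "u' - u \<subseteq> above (u \<union> v)" "v' - v \<subseteq> above (u \<union> v)"
    "u' \<subseteq> insert 0 A1" "v' \<subseteq> insert 0 A1"
    by (rule mixE[OF g _ cond_A1 order_refl])
  \<comment> \<open>No member of the front properly extends another, so the equivalent pair found by
    mixing is \<open>u\<close>, \<open>v\<close> itself.\<close>
  then have "u' = u" "v' = v" using F_ini u v by metis+
  then show ?thesis using uv' by simp
qed

text \<open>\<open>Y\<close> leaves gaps below each of its elements, wide enough for an extension \<open>Q'\<close> of \<open>Q\<close> in \<open>X\<close> by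
  unknown nodes after which the next node has the same parent as that of \<open>P\<close>.\<close>

lemma ex_sparse:
  assumes X: "X \<subseteq> A4" "cond X"
  shows "\<exists>Y\<subseteq>X. cond Y \<and> (\<forall>u\<in>F. u \<subseteq> insert 0 Y \<longrightarrow>
    (\<exists>v\<in>F. v \<subseteq> insert 0 X \<and> kernel v = kernel u \<and> u \<inter> v = kernel u) \<and>
    (\<forall>y\<in>kernel u. y \<noteq> 0 \<longrightarrow> pa y \<in> kernel u))"
proof -
  have X3: "X \<subseteq> A3" and X2: "X \<subseteq> A2" and X1: "X \<subseteq> A1" using X(1) A4_sub A4_A2 A4_A1 by auto
  define \<phi> where "\<phi> P Q Z \<longleftrightarrow> (good P \<longrightarrow> good Q \<longrightarrow> known P \<longrightarrow> mix P Q \<longrightarrow>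
    (\<exists>Q'. good Q' \<and> known Q' \<and> Q \<subseteq> Q' \<and> Q' - Q \<subseteq> X \<inter> above P \<and> nxt Q' = nxt P \<and>
      mix P Q' \<and> Z \<subseteq> above Q'))" for P Q Z
  have "\<exists>Y\<subseteq>X. cond Y \<and> (\<forall>m\<in>insert 0 Y. \<forall>P Q. P \<subseteq> insert 0 X \<inter> {..m} \<longrightarrow>
    Q \<subseteq> insert 0 X \<inter> {..m} \<longrightarrow> \<phi> P Q (Y \<inter> {m<..}))"
  proof (rule fusion_pairs[OF X(2)])
    fix P Q Z Z' assume *: "\<phi> P Q Z" "Z' \<subseteq> Z"
    show "\<phi> P Q Z'"
      unfolding \<phi>_def
    proof (intro impI)
      assume "good P" "good Q" "known P" "mix P Q"
      then obtain Q' where "good Q'" "known Q'" "Q \<subseteq> Q'" "Q' - Q \<subseteq> X \<inter> above P" "nxt Q' = nxt P"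
        "mix P Q'" "Z \<subseteq> above Q'" using *(1) unfolding \<phi>_def by blast
      then show "\<exists>Q'. good Q' \<and> known Q' \<and> Q \<subseteq> Q' \<and> Q' - Q \<subseteq> X \<inter> above P \<and> nxt Q' = nxt P \<and>
        mix P Q' \<and> Z' \<subseteq> above Q'" using *(2) by (intro exI[of _ Q']) simp
    qed
  next
    fix P Q Z assume PQ: "P \<subseteq> insert 0 X" "Q \<subseteq> insert 0 X" and Z: "cond Z" "Z \<subseteq> X"
    show "\<exists>Y\<subseteq>Z. cond Y \<and> \<phi> P Q Y"
    proof (cases "good P \<and> good Q \<and> known P \<and> mix P Q")
      case True
      then have h: "good P" "good Q" "known P" "mix P Q" by auto
      obtain u v where uv: "u \<in> F" "v \<in> F" "initial P u" "initial Q v" "(u, v) \<in> R"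
        "u - P \<subseteq> X" "v - Q \<subseteq> X" "u - P \<subseteq> above (P \<union> Q)" "v - Q \<subseteq> above (P \<union> Q)"
        "u \<subseteq> insert 0 A1" "v \<subseteq> insert 0 A1"
        by (rule mixE[OF h(1,2,4) X(2) X1])
      have sub: "u \<subseteq> insert 0 A3" "v \<subseteq> insert 0 A3" using PQ uv(6,7) X3 by blast+
      have K: "kernel u = kernel v" by (rule R_imp_kernel_eq[OF uv(1) sub(1) uv(2) sub(2) uv(5)])
      have "u \<noteq> P" using uv(1) h(3) by (auto simp: known_def)
      then obtain z where z: "z \<in> u - P" "pa z = nxt P" "\<forall>x\<in>P. x < z" "initial (insert z P) u"
        using valid_next[OF F_valid[OF uv(1)] good_valid[OF h(1)] uv(3)] by blast
      have z0: "0 < z" using z(3) good_0[OF h(1)] by blast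
      have "z \<in> kernel u" using next_kernel_iff[OF z(4)] z(3) good_0[OF h(1)] h(3) by blast
      then have "z \<in> kernel v" using K by simp
      then have zv: "z \<in> v" "known (v \<inter> {..<z})" using z0 by (simp_all add: kernel_def)
      \<comment> \<open>\<open>z\<close> is the known next node of \<open>u\<close> after
        \<open>P\<close>. The common kernel puts it into \<open>v\<close>, and its parent is
        \<open>nxt P\<close> there as well; hence the stage of \<open>v\<close> just before
        \<open>z\<close> waits for a child of that same parent.\<close>
      define Q' where "Q' = v \<inter> {..<z}"
      note vp = valid_pa[OF F_valid[OF uv(2)] zv(1) z0, folded Q'_def]
      have "good Q'" by (rule good_prefix[OF uv(2,11) vp(2,3)])
      moreover have "known Q'" using zv by (simp add: Q'_def)
      moreover have "Q \<subseteq> Q'"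
        using uv(4,8) z(1) by (auto simp: Q'_def initial_def above_def)
      moreover have "Q' - Q \<subseteq> X \<inter> above P" using uv(7,9) by (auto simp: Q'_def above_def)
      moreover have "nxt Q' = nxt P" using vp(1) z(2) by (simp add: next_in_def)
      moreover have "mix P Q'"
      proof -
        have "u \<inter> {..<z} = P" by (rule initial_first(1)[OF z(4)]) (use z(3) in blast)
        then show ?thesis using mix_prefix[OF uv(1,2,10,11,5) z0] by (simp add: Q'_def)
      qed
      moreover have "Z \<inter> {Max Q'<..} \<subseteq> above Q'"
        using above_Max[OF good_finite[OF \<open>good Q'\<close>]] by blast
      ultimately have "\<phi> P Q (Z \<inter> {Max Q'<..})" unfolding \<phi>_def by (intro impI exI[of _ Q']) simp
      then show ?thesis using cond_tail[OF Z(1)] by (intro exI[of _ "Z \<inter> {Max Q'<..}"]) simp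
    next
      case False
      then show ?thesis using Z unfolding \<phi>_def by blast
    qed
  qed
  then obtain Y where Y: "Y \<subseteq> X" "cond Y" and
    *: "\<And>m P Q. m \<in> insert 0 Y \<Longrightarrow> P \<subseteq> insert 0 X \<inter> {..m} \<Longrightarrow> Q \<subseteq> insert 0 X \<inter> {..m} \<Longrightarrow>
      \<phi> P Q (Y \<inter> {m<..})" by meson
  have main: "(\<exists>v\<in>F. v \<subseteq> insert 0 X \<and> kernel v = kernel u \<and> u \<inter> v = kernel u) \<and>
    (\<forall>y\<in>kernel u. y \<noteq> 0 \<longrightarrow> pa y \<in> kernel u)" if u: "u \<in> F" "u \<subseteq> insert 0 Y" for u
  proof -
    have u0: "0 \<in> u" using valid_0 F_valid u(1) by blast
    have uX: "u \<subseteq> insert 0 X" using u(2) Y(1) by blast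
    have uA: "u \<subseteq> insert 0 A1" using uX X1 by blast
    have fin: "finite u" using F_valid[OF u(1)] valid_finite by blast
    have Ku: "kernel u \<subseteq> u" by (rule kernel_sub[OF u(1)])
    have gP: "good (u \<inter> {..m})" for m using good_prefix[OF u(1) uA initial_atMost] u0 by simp
    \<comment> \<open>The partner is built along \<open>u\<close>: up to each \<open>m\<close> there
      is a stage \<open>Q\<close> that is mixed with the part of \<open>u\<close> and shares with it
      exactly the known nodes. Every element of \<open>Q\<close> is bounded by one of that part, so
      \<open>Q\<close> lies below its maximum \<open>k\<close>, where the sparseness of
      \<open>Y\<close> is available.\<close>
    have ex: "\<exists>Q. good Q \<and> Q \<subseteq> insert 0 X \<and> (\<forall>q\<in>Q. \<exists>p\<in>u \<inter> {..m}. q \<le> p) \<and> mix (u \<inter> {..m}) Q \<and>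
      u \<inter> {..m} \<inter> Q = kernel u \<inter> {..m} \<and> (\<forall>y\<in>kernel u \<inter> {..m}. y \<noteq> 0 \<longrightarrow> pa y \<in> kernel u)" for m
    proof (induction m)
      case 0
      have "u \<inter> {..0} = {0}" "kernel u \<inter> {..0} = {0}" using u0 by (auto simp: kernel_def)
      moreover have "good {0}" using gP[of 0] calculation(1) by simp
      ultimately show ?case using mix_refl[of "{0}"] by (intro exI[of _ "{0}"]) simp
    next
      case (Suc m)
      define P where "P = u \<inter> {..m}"
      from Suc obtain Q where Q: "good Q" "Q \<subseteq> insert 0 X" "\<forall>q\<in>Q. \<exists>p\<in>P. q \<le> p" "mix P Q"
        "P \<inter> Q = kernel u \<inter> {..m}" "\<forall>y\<in>kernel u \<inter> {..m}. y \<noteq> 0 \<longrightarrow> pa y \<in> kernel u"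
        unfolding P_def by blast
      show ?case
      proof (cases "Suc m \<in> u")
        case False
        then have "u \<inter> {..Suc m} = P" by (auto simp: P_def le_Suc_eq)
        moreover have "kernel u \<inter> {..Suc m} = kernel u \<inter> {..m}" using False Ku by (auto simp: le_Suc_eq)
        ultimately show ?thesis using Q by (intro exI[of _ Q]) simp
      next
        case True
        define x where "x = Suc m"
        have Px: "u \<inter> {..<x} = P" by (auto simp: P_def x_def less_Suc_eq_le)
        have xu: "x \<in> u" "0 < x" using True by (auto simp: x_def)
        note vp = valid_pa[OF F_valid[OF u(1)] xu, unfolded Px]
        have uP: "u \<inter> {..Suc m} = insert x P" using True by (auto simp: P_def x_def le_Suc_eq)
        have gPP: "good P" unfolding P_def by (rule gP)
        have xY: "x \<in> Y" using xu u(2) by auto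
        have nY: "x \<in> next_in Y P" using vp(1) xY by (auto simp: next_in_def)
        have PF: "P \<notin> F" using F_ini[OF _ u(1) vp(2)] xu Px by blast
        have PX: "P \<subseteq> insert 0 X" "P \<subseteq> insert 0 Y" using uX u(2) by (auto simp: P_def)
        have Qx: "\<forall>q\<in>Q. q < x" using Q(3) by (fastforce simp: P_def x_def)
        have xK: "x \<in> kernel u \<longleftrightarrow> known P" using xu Px by (simp add: kernel_def)
        show ?thesis
        proof (cases "known P")
          case False
          have "x \<in> next_in A2 P" using nY next_in_mono[of Y A2 P] Y(1) X2 by blast
          moreover have "P \<subseteq> insert 0 A2" using PX X2 by blast
          ultimately have "mix (insert x P) Q" using mix_unknown[OF gPP _ PF False _ Q(1,4)] by blast
          moreover have "insert x P \<inter> Q = kernel u \<inter> {..Suc m}"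
            using Q(5) Qx xK False by (auto simp: x_def le_Suc_eq)
          moreover have "kernel u \<inter> {..Suc m} = kernel u \<inter> {..m}"
            using xK False by (auto simp: x_def le_Suc_eq)
          moreover have "\<forall>q\<in>Q. \<exists>p\<in>insert x P. q \<le> p" using Q(3) by blast
          ultimately show ?thesis using Q(1,2,6) unfolding uP by (intro exI[of _ Q]) simp
        next
          case True
          define k where "k = Max P"
          have finP: "finite P" "0 \<in> P" using good_finite good_0 gPP by auto
          then have k: "k \<in> P" "\<And>p. p \<in> P \<Longrightarrow> p \<le> k" unfolding k_def by (auto intro: Max_in)
          have kx: "k < x" using k(1) by (auto simp: P_def x_def)
          have "k \<in> insert 0 Y" using k(1) PX(2) by blast
          moreover have "P \<subseteq> insert 0 X \<inter> {..k}" using PX(1) k(2) by auto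
          moreover have "Q \<subseteq> insert 0 X \<inter> {..k}"
          proof
            fix q assume q: "q \<in> Q"
            then obtain p where "p \<in> P" "q \<le> p" using Q(3) by blast
            then have "q \<le> k" using k(2) order_trans by blast
            then show "q \<in> insert 0 X \<inter> {..k}" using q Q(2) by auto
          qed
          ultimately have "\<phi> P Q (Y \<inter> {k<..})" by (rule *)
          then obtain Q' where Q': "good Q'" "known Q'" "Q \<subseteq> Q'" "Q' - Q \<subseteq> X \<inter> above P" "nxt Q' = nxt P"
            "mix P Q'" "Y \<inter> {k<..} \<subseteq> above Q'" using gPP Q(1,4) True unfolding \<phi>_def by blast
          have xQ': "\<forall>q\<in>Q'. q < x" using Q'(7) xY kx by (auto simp: above_def)
          have Q'X: "Q' \<subseteq> insert 0 X" using Q'(4) Q(2) by blast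
          have x4: "x \<in> next_in A4 P" using nY next_in_mono[of Y A4 P] Y(1) X(1) by blast
          then have x4': "x \<in> next_in A4 Q'" using Q'(5) xQ' by (simp add: next_in_def)
          have "P \<subseteq> insert 0 A4" "Q' \<subseteq> insert 0 A4" using PX Q'X X(1) by blast+
          then have "mix (insert x P) (insert x Q')"
            by (rule synchronized[OF gPP Q'(1) _ _ True Q'(2,6) x4 x4'])
          moreover have "x \<in> next_in A1 Q'" using x4' next_in_mono[OF A4_A1] by blast
          then have "good (insert x Q')" using good_insert[OF Q'(1)] Q'(2) by (auto simp: known_def)
          moreover have "insert x Q' \<subseteq> insert 0 X" using Q'X xY Y(1) by blast
          moreover have "\<forall>q\<in>insert x Q'. \<exists>p\<in>insert x P. q \<le> p" using xQ' by auto
          moreover have PQ': "P \<inter> Q' = kernel u \<inter> {..m}" using Q(5) Q'(3,4) by (auto simp: above_def)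
          then have "insert x P \<inter> insert x Q' = kernel u \<inter> {..Suc m}"
            using xK True xQ' by (auto simp: x_def le_Suc_eq P_def)
          \<comment> \<open>The parent lies in \<open>P\<close> and, being also
            \<open>nxt Q'\<close>, in \<open>Q'\<close>; the two stages share nothing but known
            nodes. This makes the kernel a subtree.\<close>
          moreover have "nxt P \<in> kernel u"
          proof -
            have "nxt P \<in> P" "nxt P \<in> Q'"
              using nxt_in[OF good_valid[OF gPP]] nxt_in[OF good_valid[OF Q'(1)]] Q'(5) by auto
            then show ?thesis using PQ' by blast
          qed
          then have "\<forall>y\<in>kernel u \<inter> {..Suc m}. y \<noteq> 0 \<longrightarrow> pa y \<in> kernel u"
            using Q(6) nY by (auto simp: x_def le_Suc_eq next_in_def)
          ultimately show ?thesis unfolding uP by (intro exI[of _ "insert x Q'"]) simp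
        qed
      qed
    qed
    have "u \<inter> {..Max u} = u" "kernel u \<inter> {..Max u} = kernel u" using fin Ku by auto
    then obtain Q where Q: "good Q" "Q \<subseteq> insert 0 X" "\<forall>q\<in>Q. \<exists>p\<in>u. q \<le> p" "mix u Q"
      "u \<inter> Q = kernel u" "\<forall>y\<in>kernel u. y \<noteq> 0 \<longrightarrow> pa y \<in> kernel u"
      using ex[of "Max u"] by auto
    have gu: "good u" using good_prefix[OF u(1) uA initial_refl u0] .
    obtain u' v where uv: "u' \<in> F" "v \<in> F" "initial u u'" "initial Q v" "(u', v) \<in> R"
        "u' - u \<subseteq> X" "v - Q \<subseteq> X" "u' - u \<subseteq> above (u \<union> Q)" "v - Q \<subseteq> above (u \<union> Q)"
        "u' \<subseteq> insert 0 A1" "v \<subseteq> insert 0 A1"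
      by (rule mixE[OF gu Q(1,4) X(2) X1])
    \<comment> \<open>\<open>u\<close> is already in the front, so only \<open>Q\<close> gets
      extended. The elements that \<open>v\<close> adds lie above \<open>u\<close>, whence the
      intersection with \<open>u\<close> does not grow.\<close>
    have "u' = u" using F_ini[OF u(1) uv(1,3)] by simp
    then have R: "(u, v) \<in> R" using uv(5) by simp
    have vX: "v \<subseteq> insert 0 X" using Q(2) uv(7) by blast
    have "kernel u = kernel v"
      by (rule R_imp_kernel_eq[OF u(1) _ uv(2) _ R]) (use uX vX X3 in blast)+
    moreover have "u \<inter> v = u \<inter> Q" using uv(4,9) by (auto simp: initial_def above_def)
    ultimately have "v \<in> F \<and> v \<subseteq> insert 0 X \<and> kernel v = kernel u \<and> u \<inter> v = kernel u"
      using vX uv(2) Q(5) by simp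
    then show ?thesis using Q(6) by blast
  qed
  show ?thesis by (rule exI[of _ Y]) (intro conjI[OF Y(1)] conjI[OF Y(2)] ballI impI main)
qed

end

context front_relation
begin

text \<open>\<open>K\<close> is the kernel. The last clause is stated for arbitrary \<open>X\<close>
  because it is applied to two different sets later: the partner \<open>v\<close> lives in
  \<open>X\<close> while \<open>u\<close> lives in the sparser \<open>Y\<close>, and
  \<open>X\<close> must be prepared according to where the partner is wanted.\<close>

theorem canonical_kernel:
  "\<exists>A\<subseteq>A0. \<exists>K. cond A \<and> (\<forall>u\<in>F. 0 \<in> K u \<and> K u \<subseteq> u) \<and>
    (\<forall>u\<in>F. \<forall>v\<in>F. u \<subseteq> insert 0 A \<longrightarrow> v \<subseteq> insert 0 A \<longrightarrow> ((u, v) \<in> R \<longleftrightarrow> K u = K v)) \<and>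
    (\<forall>X\<subseteq>A. cond X \<longrightarrow> (\<exists>Y\<subseteq>X. cond Y \<and> (\<forall>u\<in>F. u \<subseteq> insert 0 Y \<longrightarrow>
      (\<exists>v\<in>F. v \<subseteq> insert 0 X \<and> K v = K u \<and> u \<inter> v = K u) \<and>
      (\<forall>y\<in>K u. y \<noteq> 0 \<longrightarrow> pa y \<in> K u))))"
proof -
  have "\<exists>A1. decided pa nxt F A0 R A1"
    using ex_decided front_relation_axioms unfolding decided_def decided_axioms_def by auto
  then obtain A1 where "decided pa nxt F A0 R A1" ..
  then interpret decided pa nxt F A0 R A1 .
  have "\<exists>A2. classified pa nxt F A0 R A1 A2"
    using ex_classified decided_axioms unfolding classified_def classified_axioms_def by auto
  then obtain A2 where "classified pa nxt F A0 R A1 A2" ..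
  then interpret classified pa nxt F A0 R A1 A2 .
  have "\<exists>A3. stable pa nxt F A0 R A1 A2 A3"
    using ex_stable classified_axioms unfolding stable_def stable_axioms_def by auto
  then obtain A3 where "stable pa nxt F A0 R A1 A2 A3" ..
  then interpret stable pa nxt F A0 R A1 A2 A3 .
  have "\<exists>A4. synchronized pa nxt F A0 R A1 A2 A3 A4"
    using ex_synchronized stable_axioms unfolding synchronized_def synchronized_axioms_def by auto
  then obtain A4 where "synchronized pa nxt F A0 R A1 A2 A3 A4" ..
  then interpret synchronized pa nxt F A0 R A1 A2 A3 A4 .
  have "0 \<in> kernel u" for u by (simp add: kernel_def)
  moreover have "(u, v) \<in> R \<longleftrightarrow> kernel u = kernel v"
    if u: "u \<in> F" "u \<subseteq> insert 0 A4" and v: "v \<in> F" "v \<subseteq> insert 0 A4" for u v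
  proof
    assume R: "(u, v) \<in> R"
    show "kernel u = kernel v"
      by (rule R_imp_kernel_eq[OF u(1) _ v(1) _ R]) (use u v A4_sub in blast)+
  qed (rule kernel_eq_imp_R[OF u v])
  moreover have "A4 \<subseteq> A0" using A4_A1 A1_sub by blast
  ultimately show ?thesis
    using cond_A4 kernel_sub ex_sparse by (intro exI[of _ A4] conjI exI[of _ kernel]) simp_all
qed

end

section \<open>The tree of a uniform barrier\<close>

lemma set_takeWhile_sorted:
  "sorted l \<Longrightarrow> set (takeWhile (\<lambda>x. x < m) l) = {x \<in> set l. x < (m :: nat)}"
  by (induction l) auto

lemma init_seg_finite_iff:
  assumes "finite b"
  shows "a \<unlhd> b \<longleftrightarrow> (\<exists>m. a = b \<inter> {..<m})"
proof
  assume "a \<unlhd> b"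
  then consider "a = b" | "a = {x \<in> b. x < Inf (b - a)}" by (auto simp: init_seg_def)
  then show "\<exists>m. a = b \<inter> {..<m}"
  proof cases
    case 1
    have "b \<subseteq> {..<Suc (Max b)}" using assms by (auto simp: less_Suc_eq_le)
    then show ?thesis using 1 by blast
  next
    case 2
    then show ?thesis by (intro exI[of _ "Inf (b - a)"]) auto
  qed
next
  assume "\<exists>m. a = b \<inter> {..<m}"
  then obtain m where a: "a = b \<inter> {..<m}" by blast
  show "a \<unlhd> b"
  proof (cases "a = b")
    case False
    then have ne: "b - a \<noteq> {}" using a by blast
    then have I: "Inf (b - a) \<in> b - a" by (rule Inf_nat_def1)
    have "a = {x \<in> b. x < Inf (b - a)}"
    proof (intro equalityI subsetI)
      fix x assume x: "x \<in> a"
      then show "x \<in> {x \<in> b. x < Inf (b - a)}" using a I by auto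
    next
      fix x assume x: "x \<in> {x \<in> b. x < Inf (b - a)}"
      show "x \<in> a"
      proof (rule ccontr)
        assume "x \<notin> a"
        then have "Inf (b - a) \<le> x" using x by (intro cInf_lower) auto
        then show False using x by simp
      qed
    qed
    then show ?thesis by (simp add: init_seg_def)
  qed (simp add: init_seg_def)
qed

lemma init_seg_take:
  assumes "finite b"
  shows "{a. a \<unlhd> b} = {set (take k (sorted_list_of_set b)) | k. True}"
proof -
  define l where "l = sorted_list_of_set b"
  have l: "sorted_wrt (<) l" "set l = b" "sorted l" using assms by (auto simp: l_def)
  have 1: "\<exists>k. b \<inter> {..<m} = set (take k l)" for m
  proof
    show "b \<inter> {..<m} = set (take (length (takeWhile (\<lambda>x. x < m) l)) l)"
      using set_takeWhile_sorted[OF l(3), of m] l(2) takeWhile_eq_take[of "\<lambda>x. x < m" l] by auto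
  qed
  have 2: "\<exists>m. set (take k l) = b \<inter> {..<m}" for k
  proof (cases "k < length l")
    case True
    have eq: "l = take k l @ l ! k # drop (Suc k) l" by (rule id_take_nth_drop[OF True])
    then have s: "sorted_wrt (<) (take k l @ l ! k # drop (Suc k) l)" using l(1) by simp
    have "b = set (take k l @ l ! k # drop (Suc k) l)" using eq l(2) by simp
    then have "set (take k l) = b \<inter> {..<l ! k}" using s by (auto simp: sorted_wrt_append)
    then show ?thesis by blast
  next
    case False
    have "b \<subseteq> {..<Suc (Max b)}" using assms by (auto simp: less_Suc_eq_le)
    then show ?thesis using False l(2) by auto
  qed
  show ?thesis
    unfolding init_seg_finite_iff[OF assms] l_def[symmetric] using 1 2 by auto
qed

text \<open>Entry \<open>i\<close> of \<open>sigma b\<close> depends only on the \<open>i\<close>-th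
  element of \<open>b\<close>, so initial segments of sets become prefixes of sequences.\<close>

lemma sigma_set_take:
  assumes "finite b"
  shows "sigma (set (take k (sorted_list_of_set b))) = take k (sigma b)"
proof -
  define l where "l = sorted_list_of_set b"
  have l: "sorted_wrt (<) l" "length l = card b" using assms by (auto simp: l_def)
  have "sorted_wrt (<) (take k l)" using l(1) by (rule sorted_wrt_take)
  then have *: "sorted_list_of_set (set (take k l)) = take k l"
    by (metis sorted_list_of_set.idem_if_sorted_distinct strict_sorted_iff)
  then have "card (set (take k l)) = length (take k l)" by (metis length_sorted_list_of_set)
  then show ?thesis
    unfolding sigma_def l_def[symmetric] * using l(2)
    by (intro nth_equalityI) auto
qed

text \<open>Unlike \<open>seq_hat\<close>, it contains the root \<open>[]\<close> of the tree
  spanned by a nonempty \<open>S\<close>.\<close>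

definition pre :: "nat list set \<Rightarrow> nat list set"
  where "pre S = {x. \<exists>s\<in>S. prefix x s}"

lemma pre_mono: "S \<subseteq> S' \<Longrightarrow> pre S \<subseteq> pre S'"
  by (auto simp: pre_def)

lemma sub_pre: "S \<subseteq> pre S"
  by (auto simp: pre_def)

lemma pre_prefix: "x \<in> pre S \<Longrightarrow> prefix y x \<Longrightarrow> y \<in> pre S"
  unfolding pre_def using prefix_order.trans by blast

lemma prefix_iff_take: "prefix x s \<longleftrightarrow> (\<exists>k. x = take k s)"
proof
  assume "prefix x s"
  then have "x = take (length x) s" by (auto simp: prefix_def)
  then show "\<exists>k. x = take k s" ..
qed (auto simp: take_is_prefix)

lemma pre_iff_take: "x \<in> pre S \<longleftrightarrow> (\<exists>s\<in>S. \<exists>k. x = take k s)"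
  by (simp add: pre_def prefix_iff_take)

lemma seq_hat_pre: "seq_hat S = pre S - {[]}"
proof -
  have "x \<in> seq_hat S \<longleftrightarrow> x \<in> pre S \<and> x \<noteq> []" for x
  proof
    assume "x \<in> seq_hat S"
    then show "x \<in> pre S \<and> x \<noteq> []" unfolding seq_hat_def pre_iff_take by auto
  next
    assume x: "x \<in> pre S \<and> x \<noteq> []"
    then obtain s where s: "s \<in> S" "prefix x s" by (auto simp: pre_def)
    then have "x = take (length x) s" "1 \<le> length x" "length x \<le> length s"
      using x by (auto simp: prefix_def Suc_le_eq)
    then show "x \<in> seq_hat S" using s(1) unfolding seq_hat_def by blast
  qed
  then show ?thesis by blast
qed

lemma seqs_hat:
  assumes "\<And>b. b \<in> B \<Longrightarrow> finite b"
  shows "seqs (hat B) = pre (seqs B)"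
proof -
  have "seqs (hat B) = (\<Union>b\<in>B. sigma ` {a. a \<unlhd> b})" by (auto simp: seqs_def hat_def)
  also have "\<dots> = (\<Union>b\<in>B. {take k (sigma b) | k. True})"
  proof (rule SUP_cong[OF refl])
    fix b assume "b \<in> B"
    then have b: "finite b" by (rule assms)
    show "sigma ` {a. a \<unlhd> b} = {take k (sigma b) | k. True}"
      unfolding init_seg_take[OF b] using sigma_set_take[OF b] by (force simp: image_iff)
  qed
  also have "\<dots> = pre (seqs B)" unfolding pre_iff_take[abs_def] seqs_def set_eq_iff pre_iff_take by blast
  finally show ?thesis .
qed

section \<open>Barriers as well-founded trees of sequences\<close>

lemma inj_upsilon: "inj (upsilon n)"
  by (rule injI) (simp add: upsilon_def inj_map_eq_map)

lemma upsilon_eq_iff [simp]: "upsilon n t = upsilon m t' \<longleftrightarrow> n = m \<and> t = t'"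
  by (auto simp: upsilon_def inj_map_eq_map)

lemma upsilon_neq_Nil [simp]: "upsilon n t \<noteq> []" "[] \<noteq> upsilon n t"
  by (simp_all add: upsilon_def)

lemma upsilon_Nil: "upsilon n [] = [n]"
  by (simp add: upsilon_def)

lemma upsilon_snoc: "upsilon n (t @ [m]) = upsilon n t @ [m + n]"
  by (simp add: upsilon_def)

lemma prefix_upsilon: "prefix x (upsilon n t) \<longleftrightarrow> x = [] \<or> (\<exists>y. x = upsilon n y \<and> prefix y t)"
proof
  assume x: "prefix x (upsilon n t)"
  show "x = [] \<or> (\<exists>y. x = upsilon n y \<and> prefix y t)"
  proof (cases x)
    case (Cons a y)
    then have "a = n" "prefix y (map (\<lambda>x. x + n) t)" using x by (auto simp: upsilon_def)
    then have "y = map (\<lambda>x. x + n) (take (length y) t)"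
      by (metis (no_types) append_eq_conv_conj prefixE take_map)
    then show ?thesis using Cons \<open>a = n\<close> by (auto simp: upsilon_def take_is_prefix)
  qed simp
qed (auto simp: upsilon_def map_mono_prefix)

text \<open>What the proof takes from uniformity, with the ordinals eliminated. The last premise is
  the trace of the ranks of the sections: at a limit they increase strictly, so only the first
  section can have rank 0, and at a successor they are all equal, so one section of rank 0 means
  rank 1.\<close>

inductive ubar :: "nat set set \<Rightarrow> bool"
where
  zero: "ubar {{}}"
| step: "{} \<notin> B \<Longrightarrow> (\<And>b. b \<in> B \<Longrightarrow> finite b) \<Longrightarrow> (\<And>n. ubar (shifted_section B n)) \<Longrightarrow>
    (\<And>n. shifted_section B n = {{}} \<Longrightarrow> n = 0 \<or> B = singletons) \<Longrightarrow> ubar B"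

lemma ubar_finite: "ubar B \<Longrightarrow> b \<in> B \<Longrightarrow> finite b"
  by (induction rule: ubar.induct) auto

lemma sigma_empty [simp]: "sigma {} = []"
  by (simp add: sigma_def)

lemma sigma_eq_Nil: "finite b \<Longrightarrow> sigma b = [] \<longleftrightarrow> b = {}"
  by (simp add: sigma_def)

lemma seqs_zero: "seqs {{}} = {[]}"
  by (simp add: seqs_def)

lemma Nil_in_seqs:
  assumes "ubar B"
  shows "[] \<in> seqs B \<longleftrightarrow> {} \<in> B"
proof
  assume "[] \<in> seqs B"
  then obtain b where b: "b \<in> B" "sigma b = []" by (auto simp: seqs_def)
  then have "b = {}" using sigma_eq_Nil[OF ubar_finite[OF assms b(1)]] by simp
  then show "{} \<in> B" using b(1) by simp
next
  assume "{} \<in> B"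
  then have "sigma {} \<in> seqs B" unfolding seqs_def by (rule imageI)
  then show "[] \<in> seqs B" by simp
qed

lemma seqs_step:
  assumes "{} \<notin> B" "\<And>b. b \<in> B \<Longrightarrow> finite b"
  shows "seqs B = (\<Union>n. upsilon n ` seqs (shifted_section B n))"
proof (intro equalityI subsetI)
  fix s assume "s \<in> seqs B"
  then obtain b where b: "b \<in> B" "s = sigma b" by (auto simp: seqs_def)
  define n where "n = Min b"
  have fin: "finite b" "b \<noteq> {}" using b assms by auto
  then have n: "n \<in> b" "\<And>x. x \<in> b \<Longrightarrow> n \<le> x" by (auto simp: n_def)
  define a where "a = b - {n}"
  have ins: "insert n a = b" using n(1) by (auto simp: a_def)
  have gt: "\<forall>x\<in>a. n < x" using n(2) by (force simp: a_def)
  define c where "c = (\<lambda>c. c - (n + 1)) ` a"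
  have "a \<in> section_at B n" using ins b(1) gt by (auto simp: section_at_def)
  then have c: "c \<in> shifted_section B n" by (auto simp: shifted_section_def c_def)
  have "(\<lambda>x. x + n + 1) ` c = a" using gt by (force simp: c_def image_image)
  moreover have "finite c" using fin by (simp add: c_def a_def)
  ultimately have "upsilon n (sigma c) = s" using upsilon_sigma[of c n] ins b(2) by simp
  then show "s \<in> (\<Union>n. upsilon n ` seqs (shifted_section B n))" using c by (auto simp: seqs_def)
next
  fix s assume "s \<in> (\<Union>n. upsilon n ` seqs (shifted_section B n))"
  then obtain n c where c: "c \<in> shifted_section B n" "s = upsilon n (sigma c)" by (auto simp: seqs_def)
  then obtain a where a: "\<forall>x\<in>a. n < x" "insert n a \<in> B" "c = (\<lambda>c. c - (n + 1)) ` a"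
    by (auto simp: shifted_section_def section_at_def)
  have "(\<lambda>x. x + n + 1) ` c = a" using a(1) by (force simp: a(3) image_image)
  moreover have "finite c" using assms(2)[OF a(2)] by (simp add: a(3))
  ultimately have "s = sigma (insert n a)" using upsilon_sigma[of c n] c(2) by simp
  then show "s \<in> seqs B" using a(2) by (auto simp: seqs_def)
qed

definition subtree :: "nat list set \<Rightarrow> nat \<Rightarrow> nat list set"
  where "subtree N n = {t. upsilon n t \<in> N}"

lemma subtree_iff [simp]: "t \<in> subtree N n \<longleftrightarrow> upsilon n t \<in> N"
  by (simp add: subtree_def)

lemma sub_seqs:
  assumes "{} \<notin> B" "\<And>b. b \<in> B \<Longrightarrow> finite b"
  shows "subtree (seqs B) n = seqs (shifted_section B n)"
proof -
  have "upsilon n t \<in> seqs B \<longleftrightarrow> t \<in> seqs (shifted_section B n)" for t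
    by (subst seqs_step) (use assms in auto)
  then show ?thesis by (simp add: subtree_def)
qed

lemma seqs_nonempty: "ubar B \<Longrightarrow> seqs B \<noteq> {}"
proof (induction rule: ubar.induct)
  case (step B)
  then show ?case using seqs_step[OF step.hyps(1,2)] by auto
qed (simp add: seqs_def)

lemma seqs_cases:
  assumes "ubar B" "{} \<notin> B" "s \<in> seqs B"
  obtains n t where "s = upsilon n t" "t \<in> seqs (shifted_section B n)"
  using assms(3) seqs_step[OF assms(2) ubar_finite[OF assms(1)]] by auto

lemma pre_upsilon:
  assumes "ubar B" "{} \<notin> B" "S \<subseteq> seqs B"
  shows "upsilon n t \<in> pre S \<longleftrightarrow> t \<in> pre (subtree S n)"
proof
  assume "upsilon n t \<in> pre S"
  then obtain s where s: "s \<in> S" "prefix (upsilon n t) s" by (auto simp: pre_def)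
  then have "s \<in> seqs B" using assms(3) by blast
  then obtain m t' where t': "s = upsilon m t'" by (rule seqs_cases[OF assms(1,2)])
  then have "m = n" using s(2) by (auto simp: upsilon_def)
  then show "t \<in> pre (subtree S n)" using s t' prefix_upsilon[of "upsilon n t" n t'] by (auto simp: pre_def)
next
  assume "t \<in> pre (subtree S n)"
  then obtain t' where "upsilon n t' \<in> S" "prefix t t'" by (auto simp: pre_def)
  then show "upsilon n t \<in> pre S" using prefix_upsilon[of "upsilon n t" n t'] by (auto simp: pre_def)
qed

lemma pre_cases:
  assumes "ubar B" "{} \<notin> B" "S \<subseteq> seqs B" "x \<in> pre S"
  obtains "x = []" | n t where "x = upsilon n t" "t \<in> pre (subtree S n)"
proof -
  obtain s where s: "s \<in> S" "prefix x s" using assms by (auto simp: pre_def)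
  then have "s \<in> seqs B" using assms(3) by blast
  then obtain n t where t: "s = upsilon n t" by (rule seqs_cases[OF assms(1,2)])
  then consider "x = []" | y where "x = upsilon n y" using s(2) prefix_upsilon[of x n t] by blast
  then show ?thesis
  proof cases
    case 2
    then show ?thesis using that(2) assms(4) pre_upsilon[OF assms(1-3)] by blast
  qed (rule that(1))
qed

lemma sub_sub_seqs:
  assumes "ubar B" "{} \<notin> B" "S \<subseteq> seqs B"
  shows "subtree S n \<subseteq> seqs (shifted_section B n)"
proof -
  have "subtree S n \<subseteq> subtree (seqs B) n" using assms(3) by auto
  then show ?thesis using sub_seqs[OF assms(2) ubar_finite[OF assms(1)]] by simp
qed

lemma sub_pre_seqs:
  assumes "ubar B" "{} \<notin> B"
  shows "upsilon n t \<in> pre (seqs B) \<longleftrightarrow> t \<in> pre (seqs (shifted_section B n))"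
  using pre_upsilon[OF assms order_refl] sub_seqs[OF assms(2) ubar_finite[OF assms(1)]] by simp

lemma upsilon_in_seqs:
  assumes "ubar B" "{} \<notin> B"
  shows "upsilon n t \<in> seqs B \<longleftrightarrow> t \<in> seqs (shifted_section B n)"
  using sub_seqs[OF assms(2) ubar_finite[OF assms(1)], of n] by (auto simp: subtree_def)

lemma sorted_upsilon: "sorted (upsilon n t) \<longleftrightarrow> sorted t"
  by (auto simp: upsilon_def sorted_map)

lemma sorted_pre: "ubar B \<Longrightarrow> x \<in> pre (seqs B) \<Longrightarrow> sorted x"
proof (induction arbitrary: x rule: ubar.induct)
  case zero
  then show ?case by (auto simp: pre_def seqs_zero)
next
  case (step B)
  have u: "ubar B" by (rule ubar.step[OF step.hyps])
  show ?case
  proof (rule pre_cases[OF u step.hyps(1) order_refl step.prems])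
    fix n t assume "x = upsilon n t" "t \<in> pre (subtree (seqs B) n)"
    then show ?thesis
      using step.IH[of t n] sub_seqs[OF step.hyps(1,2), of n] by (simp add: sorted_upsilon)
  qed simp
qed

lemma seqs_antichain: "ubar B \<Longrightarrow> s \<in> seqs B \<Longrightarrow> t \<in> seqs B \<Longrightarrow> prefix s t \<Longrightarrow> s = t"
proof (induction arbitrary: s t rule: ubar.induct)
  case zero
  then show ?case by (auto simp: seqs_zero)
next
  case (step B)
  have u: "ubar B" by (rule ubar.step[OF step.hyps])
  obtain n s' where s: "s = upsilon n s'" "s' \<in> seqs (shifted_section B n)"
    by (rule seqs_cases[OF u step.hyps(1) step.prems(1)])
  obtain m t' where t: "t = upsilon m t'" "t' \<in> seqs (shifted_section B m)"
    by (rule seqs_cases[OF u step.hyps(1) step.prems(2)])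
  have "n = m \<and> prefix s' t'" using step.prems(3) unfolding s t prefix_upsilon by auto
  then show ?case using step.IH[of s' n t'] s t by simp
qed

lemma pre_not_leaf:
  assumes "ubar B" "s \<in> seqs B"
  shows "s @ [m] \<notin> pre (seqs B)"
proof
  assume "s @ [m] \<in> pre (seqs B)"
  then obtain t where t: "t \<in> seqs B" "prefix (s @ [m]) t" by (auto simp: pre_def)
  then have "prefix s t" by (simp add: append_prefixD)
  then have "s = t" by (rule seqs_antichain[OF assms t(1)])
  then show False using prefix_length_le[OF t(2)] by simp
qed

text \<open>Sections are again families of this kind, hence nonempty, so the root has every
  \<open>[m]\<close> as a child. Below row \<open>n\<close>, \<open>upsilon\<close> adds
  \<open>n\<close> to all entries, which turns the bound in the section into the bound in the row.
  In particular every inner node branches infinitely.\<close>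

lemma pre_children:
  "ubar B \<Longrightarrow> x \<in> pre (seqs B) - seqs B \<Longrightarrow> x @ [m] \<in> pre (seqs B) \<longleftrightarrow> (\<forall>e\<in>set x. e \<le> m)"
proof (induction arbitrary: x m rule: ubar.induct)
  case zero
  then show ?case by (auto simp: pre_def seqs_zero)
next
  case (step B)
  have u: "ubar B" by (rule ubar.step[OF step.hyps])
  have "x \<in> pre (seqs B)" using step.prems by simp
  then show ?case
  proof (rule pre_cases[OF u step.hyps(1) order_refl])
    assume x: "x = []"
    have "[] \<in> pre (seqs (shifted_section B m))" using seqs_nonempty[OF step.hyps(3)] by (auto simp: pre_def)
    then have "upsilon m [] \<in> pre (seqs B)" unfolding sub_pre_seqs[OF u step.hyps(1)] .
    then show ?thesis using x by (simp add: upsilon_Nil)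
  next
    fix n t assume x: "x = upsilon n t" and "t \<in> pre (subtree (seqs B) n)"
    then have t: "t \<in> pre (seqs (shifted_section B n)) - seqs (shifted_section B n)"
      using step.prems sub_seqs[OF step.hyps(1,2), of n] upsilon_in_seqs[OF u step.hyps(1)] by simp
    show ?thesis
    proof (cases "n \<le> m")
      case True
      then have "x @ [m] = upsilon n (t @ [m - n])" by (simp add: x upsilon_snoc)
      then have "x @ [m] \<in> pre (seqs B) \<longleftrightarrow> (\<forall>e\<in>set t. e \<le> m - n)"
        using sub_pre_seqs[OF u step.hyps(1)] step.IH[OF t] by simp
      moreover have "e \<le> m - n \<longleftrightarrow> e + n \<le> m" for e using True by arith
      then have "(\<forall>e\<in>set x. e \<le> m) \<longleftrightarrow> (\<forall>e\<in>set t. e \<le> m - n)"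
        using True by (simp add: x upsilon_def)
      ultimately show ?thesis by simp
    next
      case False
      have "sorted (x @ [m]) \<Longrightarrow> n \<le> m" by (simp add: x upsilon_def)
      then show ?thesis using False sorted_pre[OF u, of "x @ [m]"] by (auto simp: x upsilon_def)
    qed
  qed
qed

text \<open>Koenig's lemma for a tree without infinite paths, by induction on the family: there are
  finitely many rows, each finite by the induction hypothesis.\<close>

lemma finite_branching_finite:
  "ubar B \<Longrightarrow> P \<subseteq> pre (seqs B) \<Longrightarrow> (\<And>x y. x \<in> P \<Longrightarrow> prefix y x \<Longrightarrow> y \<in> P) \<Longrightarrow>
    (\<And>x. x \<in> P \<Longrightarrow> finite {m. x @ [m] \<in> P}) \<Longrightarrow> finite P"
proof (induction arbitrary: P rule: ubar.induct)
  case zero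
  then have "P \<subseteq> {[]}" by (auto simp: pre_def seqs_zero)
  then show ?case using finite_subset by blast
next
  case (step B)
  have u: "ubar B" by (rule ubar.step[OF step.hyps])
  show ?case
  proof (cases "[] \<in> P")
    case False
    then have "P = {}" using step.prems(2) by (metis Nil_prefix all_not_in_conv)
    then show ?thesis by simp
  next
    case True
    have fin: "finite (subtree P n)" for n
    proof (rule step.IH)
      show "subtree P n \<subseteq> pre (seqs (shifted_section B n))"
        using step.prems(1) sub_pre_seqs[OF u step.hyps(1)] by auto
      show "y \<in> subtree P n" if "x \<in> subtree P n" "prefix y x" for x y
        using that step.prems(2)[of "upsilon n x" "upsilon n y"] by (simp add: prefix_upsilon)
      show "finite {m. x @ [m] \<in> subtree P n}" if "x \<in> subtree P n" for x
      proof -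
        have "finite {m. upsilon n x @ [m] \<in> P}" using that step.prems(3) by simp
        then have "finite ((\<lambda>m. m + n) -` {m. upsilon n x @ [m] \<in> P})"
          by (intro finite_vimageI) auto
        then show ?thesis by (simp add: upsilon_snoc)
      qed
    qed
    have "P \<subseteq> insert [] (\<Union>n\<in>{m. [] @ [m] \<in> P}. upsilon n ` subtree P n)"
    proof
      fix x assume x: "x \<in> P"
      then have "x \<in> pre (seqs B)" using step.prems(1) by blast
      then show "x \<in> insert [] (\<Union>n\<in>{m. [] @ [m] \<in> P}. upsilon n ` subtree P n)"
      proof (rule pre_cases[OF u step.hyps(1) order_refl])
        fix n t assume t: "x = upsilon n t"
        have "upsilon n [] \<in> P" using step.prems(2)[OF x] by (simp add: t prefix_upsilon)
        then show ?thesis using x t by (auto simp: upsilon_Nil)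
      qed simp
    qed
    moreover have "finite (insert [] (\<Union>n\<in>{m. [] @ [m] \<in> P}. upsilon n ` subtree P n))"
      using fin step.prems(3)[OF True] by blast
    ultimately show ?thesis using finite_subset by blast
  qed
qed

section \<open>From ordinal uniformity to trees\<close>

definition unshift :: "nat \<Rightarrow> nat set set \<Rightarrow> nat set set"
  where "unshift N B = (\<lambda>b. (\<lambda>x. x - N) ` b) ` B"

lemma unshift_eq_zero: "unshift N C = {{}} \<longleftrightarrow> C = {{}}"
proof
  assume u: "unshift N C = {{}}"
  have "b = {}" if "b \<in> C" for b
  proof -
    have "(\<lambda>x. x - N) ` b \<in> unshift N C" unfolding unshift_def using that by (rule imageI)
    then show ?thesis using u by simp
  qed
  moreover have "C \<noteq> {}" using u by (auto simp: unshift_def)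
  ultimately show "C = {{}}" by blast
qed (simp add: unshift_def)

lemma shifted_section_unshift:
  assumes "\<And>b x. b \<in> B \<Longrightarrow> x \<in> b \<Longrightarrow> N \<le> x"
  shows "shifted_section (unshift N B) n = unshift (Suc (N + n)) (section_at B (N + n))"
proof -
  have eq: "(\<lambda>x. x + N) ` (\<lambda>x. x - N) ` b = b" if "b \<in> B" for b
    using assms[OF that] by (force simp: image_image)
  have "section_at (unshift N B) n = unshift N (section_at B (N + n))"
  proof (intro equalityI subsetI)
    fix a assume a: "a \<in> section_at (unshift N B) n"
    then obtain b where b: "b \<in> B" "insert n a = (\<lambda>x. x - N) ` b"
      by (auto simp: section_at_def unshift_def)
    have "b = (\<lambda>x. x + N) ` insert n a" using eq[OF b(1)] b(2) by simp
    then have "insert (N + n) ((\<lambda>x. x + N) ` a) \<in> B" using b(1) by (simp add: add.commute)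
    moreover have "\<forall>x\<in>(\<lambda>x. x + N) ` a. N + n < x" using a by (auto simp: section_at_def)
    ultimately have "(\<lambda>x. x + N) ` a \<in> section_at B (N + n)" by (simp add: section_at_def)
    moreover have "a = (\<lambda>x. x - N) ` (\<lambda>x. x + N) ` a" by (simp add: image_image)
    ultimately show "a \<in> unshift N (section_at B (N + n))" unfolding unshift_def by blast
  next
    fix a assume "a \<in> unshift N (section_at B (N + n))"
    then obtain c where c: "\<forall>x\<in>c. N + n < x" "insert (N + n) c \<in> B" "a = (\<lambda>x. x - N) ` c"
      by (auto simp: section_at_def unshift_def)
    have "(\<lambda>x. x - N) ` insert (N + n) c \<in> unshift N B" unfolding unshift_def using c(2) by (rule imageI)
    then have "insert n a \<in> unshift N B" by (simp add: c(3))
    moreover have "\<forall>x\<in>a. n < x" using c(1) by (force simp: c(3))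
    ultimately show "a \<in> section_at (unshift N B) n" by (simp add: section_at_def)
  qed
  then show ?thesis
    by (simp add: shifted_section_def unshift_def image_image diff_diff_add algebra_simps)
qed

lemma uniform_on_nonempty: "uniform_on \<alpha> M B \<Longrightarrow> B \<noteq> {}"
proof (induction rule: uniform_on.induct)
  case (succ M \<beta> \<alpha> B)
  obtain n where "n \<in> M" using infinite_imp_nonempty[OF succ.hyps(1)] by blast
  then show ?case using succ.IH by (auto simp: section_at_def)
next
  case (limit M \<beta>\<^sub>0 \<alpha> f B)
  obtain n where "n \<in> M" using infinite_imp_nonempty[OF limit.hyps(1)] by blast
  then show ?case using limit.IH by (auto simp: section_at_def)
qed simp

lemma uniform_on_least: "uniform_on \<alpha> M B \<Longrightarrow> (\<And>\<beta>. \<alpha> \<le> \<beta>) \<Longrightarrow> B = {{}}"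
proof (induction rule: uniform_on.cases)
  case (succ M \<beta> \<alpha> B)
  then have "\<alpha> \<le> \<beta>" by blast
  with succ show ?case by (meson leD)
next
  case (limit M \<beta>\<^sub>0 \<alpha> f B)
  then have "\<alpha> \<le> \<beta>\<^sub>0" by blast
  with limit show ?case by (meson leD)
qed

lemma uniform_on_zero:
  assumes "uniform_on \<alpha> M {{}}"
  shows "\<alpha> \<le> \<beta>"
  using assms
proof cases
  case (limit \<beta>\<^sub>0 f)
  then obtain n where n: "n \<in> M" using infinite_imp_nonempty[of M] by blast
  have "section_at {{}} n = {}" by (auto simp: section_at_def)
  then show ?thesis using limit n uniform_on_nonempty by metis
qed auto

lemma singletons_if_sections:
  assumes "{} \<notin> B" "\<And>b. b \<in> B \<Longrightarrow> finite b" "\<And>n. shifted_section B n = {{}}"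
  shows "B = singletons"
proof -
  have *: "section_at B n = {{}}" for n
  proof -
    have "a \<in> section_at B n \<longleftrightarrow> a = {}" for a
    proof
      assume "a \<in> section_at B n"
      then have "(\<lambda>c. c - (n + 1)) ` a \<in> shifted_section B n" unfolding shifted_section_def by (rule imageI)
      then show "a = {}" using assms(3) by simp
    next
      have "{} \<in> shifted_section B n" using assms(3) by simp
      then show "a = {} \<Longrightarrow> a \<in> section_at B n" unfolding shifted_section_def by auto
    qed
    then show ?thesis by blast
  qed
  have "{n} \<in> B" for n using *[of n] by (auto simp: section_at_def)
  moreover have "\<exists>n. b = {n}" if b: "b \<in> B" for b
  proof -
    have ne: "b \<noteq> {}" "finite b" using b assms by auto
    then have m: "Min b \<in> b" "\<forall>x\<in>b - {Min b}. Min b < x" by (auto simp: order_less_le)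
    then have "b - {Min b} \<in> section_at B (Min b)" using b by (simp add: section_at_def insert_absorb)
    then have "b - {Min b} = {}" using * by simp
    then show ?thesis using m(1) by blast
  qed
  ultimately show ?thesis by blast
qed

lemma section_antichain:
  assumes "\<And>a b. a \<in> B \<Longrightarrow> b \<in> B \<Longrightarrow> a \<noteq> b \<Longrightarrow> \<not> a \<subseteq> b"
    and a: "a \<in> section_at B n" and b: "b \<in> section_at B n" and ne: "a \<noteq> b"
  shows "\<not> a \<subseteq> b"
proof -
  have n: "n \<notin> a" "n \<notin> b" "insert n a \<in> B" "insert n b \<in> B" using a b by (auto simp: section_at_def)
  then have "insert n a \<noteq> insert n b" using ne insert_ident by metis
  then have "\<not> insert n a \<subseteq> insert n b" using assms(1) n by blast
  then show ?thesis by blast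
qed

text \<open>The induction runs over tails \<open>{N..}\<close>, which \<open>unshift\<close>
  renumbers so that sections become shifted sections. A section of rank 0 carries the least ordinal:
  in the successor case so do all the others, and in the limit case it must be the first section. At
  a limit, \<open>{} \<notin> B\<close> comes from the antichain property.\<close>

lemma uniform_on_ubar:
  "uniform_on \<alpha> M B \<Longrightarrow> M = {N..} \<Longrightarrow> (\<And>b. b \<in> B \<Longrightarrow> finite b) \<Longrightarrow>
    (\<And>a b. a \<in> B \<Longrightarrow> b \<in> B \<Longrightarrow> a \<noteq> b \<Longrightarrow> \<not> a \<subseteq> b) \<Longrightarrow>
    (\<And>b x. b \<in> B \<Longrightarrow> x \<in> b \<Longrightarrow> N \<le> x) \<Longrightarrow> ubar (unshift N B)"
proof (induction arbitrary: N rule: uniform_on.induct)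
  case (zero M \<alpha>)
  then show ?case by (simp add: unshift_def ubar.zero)
next
  case (succ M \<beta> \<alpha> B)
  have sec: "shifted_section (unshift N B) n = unshift (Suc (N + n)) (section_at B (N + n))" for n
    by (rule shifted_section_unshift) (rule succ.prems)
  have M: "N + n \<in> M" "M - {..N + n} = {Suc (N + n)..}" for n using succ.prems(1) by auto
  have fin: "finite b" if "b \<in> unshift N B" for b using that succ.prems(2) by (auto simp: unshift_def)
  have ne: "{} \<notin> unshift N B" using succ.hyps(4) by (auto simp: unshift_def)
  show ?case
  proof (rule ubar.step[OF ne fin])
    fix n
    show "ubar (shifted_section (unshift N B) n)"
      unfolding sec
    proof (rule succ.IH[OF M])
      show "finite b" if "b \<in> section_at B (N + n)" for b
        using that succ.prems(2)[of "insert (N + n) b"] by (auto simp: section_at_def)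
      show "\<not> a \<subseteq> b" if "a \<in> section_at B (N + n)" "b \<in> section_at B (N + n)" "a \<noteq> b" for a b
        by (rule section_antichain[OF succ.prems(3) that])
      show "Suc (N + n) \<le> x" if "b \<in> section_at B (N + n)" "x \<in> b" for b x
        using that by (auto simp: section_at_def)
    qed
    assume z: "shifted_section (unshift N B) n = {{}}"
    then have z: "section_at B (N + n) = {{}}" unfolding sec unshift_eq_zero .
    then have "\<And>\<gamma>. \<beta> \<le> \<gamma>" using succ.hyps(5)[OF M(1)[of n]] uniform_on_zero by simp
    then have "section_at B (N + k) = {{}}" for k using succ.hyps(5)[OF M(1)] uniform_on_least by blast
    then have "shifted_section (unshift N B) k = {{}}" for k unfolding sec unshift_eq_zero .
    then show "n = 0 \<or> unshift N B = singletons" using singletons_if_sections[OF ne fin] by blast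
  qed
next
  case (limit M \<beta>\<^sub>0 \<alpha> f B)
  have sec: "shifted_section (unshift N B) n = unshift (Suc (N + n)) (section_at B (N + n))" for n
    by (rule shifted_section_unshift) (rule limit.prems)
  have M: "N + n \<in> M" "M - {..N + n} = {Suc (N + n)..}" for n using limit.prems(1) by auto
  have fin: "finite b" if "b \<in> unshift N B" for b using that limit.prems(2) by (auto simp: unshift_def)
  have ne: "{} \<notin> unshift N B"
  proof
    assume "{} \<in> unshift N B"
    then have e: "{} \<in> B" by (auto simp: unshift_def)
    have "section_at B (N + 0) \<noteq> {}" using uniform_on_nonempty[OF limit.hyps(7)[OF M(1)]] .
    then obtain a where "insert N a \<in> B" by (auto simp: section_at_def)
    then show False using limit.prems(3)[OF e] by blast
  qed
  show ?case
  proof (rule ubar.step[OF ne fin])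
    fix n
    show "ubar (shifted_section (unshift N B) n)"
      unfolding sec
    proof (rule limit.IH[OF M])
      show "finite b" if "b \<in> section_at B (N + n)" for b
        using that limit.prems(2)[of "insert (N + n) b"] by (auto simp: section_at_def)
      show "\<not> a \<subseteq> b" if "a \<in> section_at B (N + n)" "b \<in> section_at B (N + n)" "a \<noteq> b" for a b
        by (rule section_antichain[OF limit.prems(3) that])
      show "Suc (N + n) \<le> x" if "b \<in> section_at B (N + n)" "x \<in> b" for b x
        using that by (auto simp: section_at_def)
    qed
    assume z: "shifted_section (unshift N B) n = {{}}"
    then have z: "section_at B (N + n) = {{}}" unfolding sec unshift_eq_zero .
    then have "f (N + n) \<le> f (N + 0)" using limit.hyps(7)[OF M(1)[of n]] uniform_on_zero by simp
    then have "\<not> N + 0 < N + n"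
      using limit.hyps(4) M(1)[of 0] M(1)[of n] unfolding strict_mono_on_def by (meson leD)
    then show "n = 0 \<or> unshift N B = singletons" by simp
  qed
qed

lemma uniform_barrier_ubar:
  assumes "uniform_barrier B"
  shows "ubar B" "{} \<notin> B"
proof -
  from assms obtain \<alpha> \<beta> where B: "barrier B" and \<alpha>: "\<beta> < \<alpha>" "uniform_on \<alpha> UNIV B"
    by (auto simp: uniform_barrier_def)
  have "ubar (unshift 0 B)"
    by (rule uniform_on_ubar[OF \<alpha>(2)]) (use B in \<open>auto simp: barrier_def\<close>)
  then show "ubar B" by (simp add: unshift_def)
  show "{} \<notin> B"
  proof
    assume e: "{} \<in> B"
    then have "B = {{}}" using B by (auto simp: barrier_def)
    then have "\<alpha> \<le> \<beta>" using \<alpha>(2) uniform_on_zero by blast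
    then show False using \<alpha>(1) by simp
  qed
qed

section \<open>The order of the sequences and its type\<close>

abbreviation lex_less :: "nat list \<Rightarrow> nat list \<Rightarrow> bool"
  where "lex_less s t \<equiv> (s, t) \<in> lexord {(x, y). x < y}"

lemma lex_less_trans: "lex_less s t \<Longrightarrow> lex_less t u \<Longrightarrow> lex_less s u"
  by (rule lexord_trans) (auto simp: trans_def)

lemma lex_less_irrefl: "\<not> lex_less s s"
  by (rule lexord_irreflexive) auto

lemma lex_less_linear: "lex_less s t \<or> s = t \<or> lex_less t s"
  by (rule lexord_linear) auto

lemma lex_less_map_add: "lex_less (map (\<lambda>x. x + n) s) (map (\<lambda>x. x + n) t) \<longleftrightarrow> lex_less s t"
proof (induction s arbitrary: t)
  case Nil
  then show ?case by (cases t) auto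
next
  case (Cons a s)
  then show ?case by (cases t) auto
qed

text \<open>With the value 0 at \<open>[]\<close>, the empty sequence is no longer an exception in
  \<open>prec\<close>: it is lexicographically below all others.\<close>

definition max_entry :: "nat list \<Rightarrow> nat"
  where "max_entry s = (if s = [] then 0 else Max (set s))"

lemma prec_iff: "s \<prec> t \<longleftrightarrow> max_entry s < max_entry t \<or> max_entry s = max_entry t \<and> lex_less s t"
  by (cases s; cases t) (auto simp: prec_def max_entry_def)

lemma prec_irrefl: "\<not> s \<prec> s"
  by (simp add: prec_iff lex_less_irrefl)

lemma prec_trans: "s \<prec> t \<Longrightarrow> t \<prec> u \<Longrightarrow> s \<prec> u"
  unfolding prec_iff using lex_less_trans[of s t u] by auto

lemma prec_linear: "s \<prec> t \<or> s = t \<or> t \<prec> s"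
  unfolding prec_iff using lex_less_linear[of s t] by auto

lemma prec_asym: "s \<prec> t \<Longrightarrow> \<not> t \<prec> s"
  using prec_trans prec_irrefl by blast

lemma max_entry_upsilon: "max_entry (upsilon n t) = max_entry t + n"
proof (cases "t = []")
  case False
  then have "Max ((\<lambda>x. x + n) ` set t) = Max (set t) + n"
    by (intro mono_Max_commute[symmetric]) (auto simp: mono_def)
  moreover have "Max (insert n ((\<lambda>x. x + n) ` set t)) = max n (Max ((\<lambda>x. x + n) ` set t))"
    using False by (intro Max_insert) auto
  ultimately show ?thesis using False by (simp add: max_entry_def upsilon_def)
qed (simp add: max_entry_def upsilon_def)

lemma prec_upsilon: "upsilon n s \<prec> upsilon n t \<longleftrightarrow> s \<prec> t"
  unfolding prec_iff max_entry_upsilon by (simp add: upsilon_def lex_less_map_add)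

lemma max_entry_ge: "e \<in> set s \<Longrightarrow> e \<le> max_entry s"
  by (auto simp: max_entry_def)

lemma max_entry_le: "(\<And>e. e \<in> set s \<Longrightarrow> e \<le> m) \<Longrightarrow> max_entry s \<le> m"
  by (auto simp: max_entry_def)

lemma prec_prefix:
  assumes "prefix s t" "s \<noteq> t"
  shows "s \<prec> t"
proof -
  obtain u where u: "t = s @ u" "u \<noteq> []" using assms by (auto simp: prefix_def)
  have "max_entry s \<le> max_entry t" by (rule max_entry_le) (use u max_entry_ge in auto)
  moreover have "lex_less s t" using u by (cases u) (auto simp: lexord_append_rightI)
  ultimately show ?thesis unfolding prec_iff by auto
qed

lemma max_entry_snoc_sorted: "sorted (x @ [m]) \<Longrightarrow> max_entry (x @ [m]) = m"
  by (rule antisym) (auto intro!: max_entry_le max_entry_ge simp: sorted_append)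

lemma prec_sibling:
  assumes "sorted (x @ [m])" "sorted (x @ [m'])"
  shows "x @ [m] \<prec> x @ [m'] \<longleftrightarrow> m < m'"
  unfolding prec_iff max_entry_snoc_sorted[OF assms(1)] max_entry_snoc_sorted[OF assms(2)]
  using lex_less_irrefl by auto

text \<open>\<open>f\<close> counts predecessors. The predecessors of \<open>x\<close> already
  exhaust the values below \<open>f x\<close>, so the range is downward closed, and an infinite such
  set is everything.\<close>

lemma order_iso_nat:
  fixes lt :: "'a \<Rightarrow> 'a \<Rightarrow> bool"
  assumes inf: "infinite T" and irr: "\<And>x. \<not> lt x x"
    and tr: "\<And>x y z. lt x y \<Longrightarrow> lt y z \<Longrightarrow> lt x z"
    and lin: "\<And>x y. x \<in> T \<Longrightarrow> y \<in> T \<Longrightarrow> lt x y \<or> x = y \<or> lt y x"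
    and fin: "\<And>x. x \<in> T \<Longrightarrow> finite {y \<in> T. lt y x}"
  shows "\<exists>f :: 'a \<Rightarrow> nat. bij_betw f T UNIV \<and> (\<forall>s\<in>T. \<forall>t\<in>T. lt s t \<longleftrightarrow> f s < f t)"
proof -
  define f where "f x = card {y \<in> T. lt y x}" for x
  have mono: "f x < f y" if "x \<in> T" "y \<in> T" "lt x y" for x y
  proof -
    have "{z \<in> T. lt z x} \<subseteq> {z \<in> T. lt z y}" using tr[OF _ that(3)] by blast
    moreover have "x \<in> {z \<in> T. lt z y} - {z \<in> T. lt z x}" using that irr by simp
    ultimately have "{z \<in> T. lt z x} \<subset> {z \<in> T. lt z y}" by blast
    then show ?thesis unfolding f_def using fin[OF that(2)] by (rule psubset_card_mono[rotated])
  qed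
  have iff: "lt s t \<longleftrightarrow> f s < f t" if "s \<in> T" "t \<in> T" for s t
    using mono[OF that] mono[OF that(2,1)] lin[OF that] by auto
  have inj: "inj_on f T"
    by (rule inj_onI) (metis iff irr lin order_less_irrefl)
  have down: "k \<in> f ` T" if "x \<in> T" "k < f x" for x k
  proof -
    let ?D = "{y \<in> T. lt y x}"
    have "f ` ?D \<subseteq> {..<f x}" using mono that(1) by auto
    moreover have "card (f ` ?D) = card {..<f x}"
      using card_image[OF inj_on_subset[OF inj], of ?D] by (auto simp: f_def)
    ultimately have "f ` ?D = {..<f x}" by (intro card_subset_eq) auto
    then show ?thesis using that(2) by auto
  qed
  have "f ` T = UNIV"
  proof (rule UNIV_eq_I[symmetric])
    fix k
    have "infinite (f ` T)" using inf inj finite_imageD by blast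
    then obtain n where "n \<in> f ` T" "k < n" by (meson infinite_nat_iff_unbounded)
    then show "k \<in> f ` T" using down by blast
  qed
  then show ?thesis using inj iff by (auto simp: bij_betw_def)
qed

section \<open>The domain space as an order condition on indices\<close>

definition ix :: "nat list set \<Rightarrow> nat list \<Rightarrow> nat list"
  where "ix N x = map (\<lambda>j. card {m. m < x ! j \<and> take j x @ [m] \<in> N}) [0..<length x]"

lemma ix_Nil [simp]: "ix N [] = []"
  by (simp add: ix_def)

lemma length_ix [simp]: "length (ix N x) = length x"
  by (simp add: ix_def)

lemma ix_snoc: "ix N (x @ [m]) = ix N x @ [card {m'. m' < m \<and> x @ [m'] \<in> N}]"
  unfolding ix_def by (simp add: nth_append)

lemma ix_append: "\<exists>v. ix N (x @ y) = ix N x @ v"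
proof (induction y rule: rev_induct)
  case (snoc m y)
  then show ?case using ix_snoc[of N "x @ y" m] by auto
qed simp

lemma ix_prefix: "prefix x y \<Longrightarrow> prefix (ix N x) (ix N y)"
  using ix_append[of N x] by (auto simp: prefix_def)

lemma ix_upsilon:
  assumes "\<And>t m. upsilon n t @ [m] \<in> N \<Longrightarrow> n \<le> m"
  shows "ix N (upsilon n t) = card {m. m < n \<and> [m] \<in> N} # ix (subtree N n) t"
proof (induction t rule: rev_induct)
  case Nil
  then show ?case using ix_snoc[of N "[]" n] by (simp add: upsilon_Nil)
next
  case (snoc m t)
  have "{m'. m' < m + n \<and> upsilon n t @ [m'] \<in> N} = (\<lambda>k. k + n) ` {k. k < m \<and> t @ [k] \<in> subtree N n}"
  proof (intro equalityI subsetI)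
    fix m' assume m': "m' \<in> {m'. m' < m + n \<and> upsilon n t @ [m'] \<in> N}"
    then have "n \<le> m'" using assms by blast
    then have "m' = (m' - n) + n" by simp
    moreover have "m' - n \<in> {k. k < m \<and> t @ [k] \<in> subtree N n}"
      using m' \<open>n \<le> m'\<close> by (auto simp: upsilon_snoc)
    ultimately show "m' \<in> (\<lambda>k. k + n) ` {k. k < m \<and> t @ [k] \<in> subtree N n}" by (rule image_eqI)
  qed (auto simp: upsilon_snoc)
  then have "card {m'. m' < m + n \<and> upsilon n t @ [m'] \<in> N} = card {k. k < m \<and> t @ [k] \<in> subtree N n}"
    by (simp add: card_image)
  then show ?case
    using snoc ix_snoc[of N "upsilon n t" "m + n"] ix_snoc[of "subtree N n" t m] by (simp add: upsilon_snoc)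
qed

text \<open>The order of entry in terms of indices. It has the shape of \<open>prec\<close>, with
  the sum of the entries in place of their maximum.\<close>

definition ilt :: "nat list \<Rightarrow> nat list \<Rightarrow> bool"
  where "ilt a b \<longleftrightarrow> sum_list a < sum_list b \<or> sum_list a = sum_list b \<and> lex_less a b"

lemma ilt_irrefl: "\<not> ilt a a"
  by (simp add: ilt_def lex_less_irrefl)

lemma ilt_trans: "ilt a b \<Longrightarrow> ilt b c \<Longrightarrow> ilt a c"
  unfolding ilt_def using lex_less_trans[of a b c] by auto

lemma ilt_linear: "ilt a b \<or> a = b \<or> ilt b a"
  unfolding ilt_def using lex_less_linear[of a b] by auto

lemma ilt_append: "b \<noteq> [] \<Longrightarrow> ilt a (a @ b)"
  unfolding ilt_def by (cases b) (auto simp: lexord_append_rightI)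

lemma ilt_Cons: "ilt (i # a) (i # b) \<longleftrightarrow> ilt a b"
  unfolding ilt_def by (auto simp: lex_less_irrefl)

text \<open>What remains of \<open>domain_space\<close> when its order conditions are dropped; the
  approximations can be computed from this alone.\<close>

definition infinitary :: "nat set set \<Rightarrow> nat list set \<Rightarrow> bool"
  where "infinitary B S \<longleftrightarrow> S \<noteq> {} \<and> S \<subseteq> seqs B \<and>
    (\<forall>x\<in>pre S - seqs B. infinite {m. x @ [m] \<in> pre S})"

lemma infinitary_zero: "infinitary {{}} S \<longleftrightarrow> S = {[]}"
  by (auto simp: infinitary_def seqs_zero pre_def)

lemma row_eq:
  assumes "ubar B" "{} \<notin> B" "S \<subseteq> seqs B"
  shows "row S n = upsilon n ` subtree S n"
proof (intro equalityI subsetI)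
  fix s assume s: "s \<in> row S n"
  then have "s \<in> seqs B" using assms(3) by (auto simp: row_def)
  then obtain m t where "s = upsilon m t" by (rule seqs_cases[OF assms(1,2)])
  then show "s \<in> upsilon n ` subtree S n" using s by (auto simp: row_def upsilon_def)
qed (auto simp: row_def upsilon_def)

lemma row_pullback_eq:
  assumes "ubar B" "{} \<notin> B" "S \<subseteq> seqs B"
  shows "row_pullback B S n = subtree S n"
  using sub_sub_seqs[OF assms, of n] unfolding row_pullback_def row_eq[OF assms] by auto

lemma row_nonempty_iff:
  assumes "ubar B" "{} \<notin> B" "S \<subseteq> seqs B"
  shows "row S n \<noteq> {} \<longleftrightarrow> [n] \<in> pre S"
proof -
  have "[n] \<in> pre S \<longleftrightarrow> [] \<in> pre (subtree S n)" using pre_upsilon[OF assms, of n "[]"] by (simp add: upsilon_Nil)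
  also have "\<dots> \<longleftrightarrow> subtree S n \<noteq> {}" by (auto simp: pre_def)
  finally show ?thesis by (simp add: row_eq[OF assms])
qed

lemma sub_pre_eq:
  assumes "ubar B" "{} \<notin> B" "S \<subseteq> seqs B"
  shows "subtree (pre S) n = pre (subtree S n)"
  using pre_upsilon[OF assms, of n] by (auto simp: subtree_def)

lemma infinitary_subtree:
  assumes "ubar B" "{} \<notin> B" "infinitary B S" "[n] \<in> pre S"
  shows "infinitary (shifted_section B n) (subtree S n)"
proof -
  have S: "S \<subseteq> seqs B" using assms(3) by (simp add: infinitary_def)
  have "subtree S n \<noteq> {}" using row_nonempty_iff[OF assms(1,2) S, of n] assms(4) row_eq[OF assms(1,2) S] by simp
  moreover have "infinite {m. t @ [m] \<in> pre (subtree S n)}"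
    if t: "t \<in> pre (subtree S n) - seqs (shifted_section B n)" for t
  proof -
    have "upsilon n t \<in> pre S - seqs B"
      using t pre_upsilon[OF assms(1,2) S] upsilon_in_seqs[OF assms(1,2)] by simp
    then have "infinite {m. upsilon n t @ [m] \<in> pre S}" using assms(3) by (simp add: infinitary_def)
    moreover have "{m. upsilon n t @ [m] \<in> pre S} \<subseteq> (\<lambda>m. m + n) ` {m. t @ [m] \<in> pre (subtree S n)}"
    proof
      fix m assume m: "m \<in> {m. upsilon n t @ [m] \<in> pre S}"
      then have "upsilon n t @ [m] \<in> pre (seqs B)" using pre_mono[OF S] by blast
      then have "sorted (upsilon n t @ [m])" by (rule sorted_pre[OF assms(1)])
      then have "n \<le> m" by (simp add: upsilon_def)
      then have "upsilon n t @ [m] = upsilon n (t @ [m - n])" by (simp add: upsilon_snoc)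
      then have "t @ [m - n] \<in> pre (subtree S n)" using m pre_upsilon[OF assms(1,2) S] by simp
      then show "m \<in> (\<lambda>m. m + n) ` {m. t @ [m] \<in> pre (subtree S n)}"
        using \<open>n \<le> m\<close> by (intro image_eqI[of _ _ "m - n"]) auto
    qed
    ultimately show ?thesis by (meson finite_imageI finite_subset)
  qed
  ultimately show ?thesis using sub_sub_seqs[OF assms(1,2) S] by (simp add: infinitary_def)
qed

definition pos :: "nat list set \<Rightarrow> nat \<Rightarrow> nat"
  where "pos S n = card {m. m < n \<and> [m] \<in> pre S}"

lemma ix_upsilon_pre:
  assumes "ubar B" "{} \<notin> B" "S \<subseteq> seqs B"
  shows "ix (pre S) (upsilon n t) = pos S n # ix (pre (subtree S n)) t"
proof -
  have "n \<le> m" if "upsilon n t @ [m] \<in> pre S" for t m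
  proof -
    have "upsilon n t @ [m] \<in> pre (seqs B)" using that pre_mono[OF assms(3)] by blast
    then have "sorted (upsilon n t @ [m])" by (rule sorted_pre[OF assms(1)])
    then show ?thesis by (simp add: upsilon_def)
  qed
  then show ?thesis using ix_upsilon[of n "pre S" t] sub_pre_eq[OF assms] by (simp add: pos_def)
qed

lemma card_enumerate:
  fixes X :: "nat set"
  assumes "infinite X"
  shows "card {m. m < enumerate X i \<and> m \<in> X} = i"
proof -
  have "{m. m < enumerate X i \<and> m \<in> X} = enumerate X ` {..<i}"
  proof (intro equalityI subsetI)
    fix m assume m: "m \<in> {m. m < enumerate X i \<and> m \<in> X}"
    then have "m \<in> X" by simp
    then obtain j where j: "enumerate X j = m" using enumerate_Ex[OF assms] by blast
    then have "j < i" using m enumerate_mono_iff[OF assms, of j i] by simp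
    then show "m \<in> enumerate X ` {..<i}" using j by blast
  next
    fix m assume "m \<in> enumerate X ` {..<i}"
    then obtain j where j: "m = enumerate X j" "j < i" by blast
    then show "m \<in> {m. m < enumerate X i \<and> m \<in> X}"
      using enumerate_in_set[OF assms, of j] enumerate_mono_iff[OF assms, of j i] by simp
  qed
  moreover have "inj_on (enumerate X) {..<i}"
    by (rule inj_on_subset[OF inj_enumerate[OF assms]]) simp
  ultimately show ?thesis by (simp add: card_image)
qed

lemma infinite_rows:
  assumes "ubar B" "{} \<notin> B" "infinitary B S"
  shows "infinite {n. [n] \<in> pre S}"
proof -
  have "[] \<in> pre S" using assms(3) by (auto simp: infinitary_def pre_def)
  moreover have "[] \<notin> seqs B" using Nil_in_seqs assms by blast
  ultimately have "infinite {m. [] @ [m] \<in> pre S}" using assms(3) unfolding infinitary_def by blast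
  then show ?thesis by simp
qed

lemma row_index_props:
  assumes "ubar B" "{} \<notin> B" "S \<subseteq> seqs B" "infinite {n. [n] \<in> pre S}"
  shows "[row_index S i] \<in> pre S" "pos S (row_index S i) = i"
    "[n] \<in> pre S \<Longrightarrow> row_index S (pos S n) = n"
proof -
  let ?X = "{n. [n] \<in> pre S}"
  have eq: "row_index S i = enumerate ?X i" for i
    using row_nonempty_iff[OF assms(1-3)] by (simp add: row_index_def)
  show "[row_index S i] \<in> pre S" using enumerate_in_set[OF assms(4), of i] by (simp add: eq)
  show p: "pos S (row_index S i) = i" for i
    using card_enumerate[OF assms(4), of i] by (simp add: eq pos_def)
  show "row_index S (pos S n) = n" if n: "[n] \<in> pre S"
  proof -
    have "n \<in> ?X" using n by simp
    then obtain j where j: "enumerate ?X j = n" using enumerate_Ex[OF assms(4)] by blast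
    then have "row_index S j = n" using eq by simp
    then show ?thesis using p[of j] by simp
  qed
qed

section \<open>Approximations as sets of leaves of bounded stage\<close>

abbreviation stage :: "nat list set \<Rightarrow> nat list \<Rightarrow> nat"
  where "stage S x \<equiv> Suc (sum_list (ix (pre S) x))"

lemma stage_upsilon:
  assumes "ubar B" "{} \<notin> B" "S \<subseteq> seqs B"
  shows "stage S (upsilon n t) = pos S n + stage (subtree S n) t"
  using ix_upsilon_pre[OF assms] by simp

lemma seqs_singletons: "seqs singletons = range (\<lambda>n. [n])"
proof -
  have "sigma {n} = [n]" for n by (simp add: sigma_def)
  then show ?thesis by (simp add: seqs_def image_image)
qed

lemma prec_single: "[m] \<prec> [n] \<longleftrightarrow> m < n"
  by (auto simp: prec_iff max_entry_def)

lemma pre_singletons: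
  assumes "S \<subseteq> seqs singletons"
  shows "[m] \<in> pre S \<longleftrightarrow> [m] \<in> S"
  using assms by (fastforce simp: pre_def seqs_singletons)

text \<open>Row \<open>i\<close> enters at stage \<open>i + 1\<close> and then advances by one
  approximation per stage, so the stage of a leaf exceeds its stage inside row \<open>i\<close> by
  \<open>i\<close>. Stages start at 1 because approximation 0 is empty.\<close>

lemma approx_eq:
  "ubar B \<Longrightarrow> infinitary B S \<Longrightarrow> approx B k S = {s \<in> S. stage S s \<le> k}"
  "ubar B \<Longrightarrow> {} \<notin> B \<Longrightarrow> B \<noteq> singletons \<Longrightarrow> infinitary B S \<Longrightarrow>
    row_approx B q S (row_index S i) = {s \<in> row S (row_index S i). stage S s \<le> q + i}"
proof -
  have row: "row_approx B q S (row_index S i) = {s \<in> row S (row_index S i). stage S s \<le> q + i}"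
    if u: "ubar B" "{} \<notin> B" and S: "infinitary B S" and
      IH: "\<And>n S k. infinitary (shifted_section B n) S \<Longrightarrow> approx (shifted_section B n) k S = {s \<in> S. stage S s \<le> k}"
    for B S q i
  proof -
    let ?n = "row_index S i"
    have SB: "S \<subseteq> seqs B" using S by (simp add: infinitary_def)
    note ri = row_index_props[OF u SB infinite_rows[OF u S]]
    have "approx (shifted_section B ?n) q (subtree S ?n) = {t \<in> subtree S ?n. stage (subtree S ?n) t \<le> q}"
      by (rule IH[OF infinitary_subtree[OF u S ri(1)]])
    then have "row_approx B q S ?n = upsilon ?n ` {t \<in> subtree S ?n. stage (subtree S ?n) t \<le> q}"
      by (simp add: row_approx_def row_pullback_eq[OF u SB])
    also have "\<dots> = {s \<in> upsilon ?n ` subtree S ?n. stage S s \<le> q + i}"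
      using stage_upsilon[OF u SB, of ?n] ri(2)[of i] by auto
    finally show ?thesis using row_eq[OF u SB] by simp
  qed
  show main: "ubar B \<Longrightarrow> infinitary B S \<Longrightarrow> approx B k S = {s \<in> S. stage S s \<le> k}" for B S k
  proof (induction arbitrary: S k rule: ubar.induct)
    case zero
    then show ?case by (auto simp: infinitary_zero approx_rank0)
  next
    case (step B)
    have u: "ubar B" by (rule ubar.step[OF step.hyps])
    note u = u step.hyps(1)
    have SB: "S \<subseteq> seqs B" using step.prems by (simp add: infinitary_def)
    show ?case
    proof (cases "B = singletons")
      case True
      have "s \<in> least_elems (\<prec>) k S \<longleftrightarrow> stage S s \<le> k" if s: "s \<in> S" for s
      proof -
        obtain n where n: "s = [n]" using SB s unfolding True seqs_singletons by blast
        have "{y \<in> S. y \<prec> [n]} = (\<lambda>m. [m]) ` {m. m < n \<and> [m] \<in> pre S}"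
          using SB pre_singletons[of S] unfolding True seqs_singletons by (auto simp: prec_single)
        then have "card {y \<in> S. y \<prec> s} = pos S n" "finite {y \<in> S. y \<prec> s}"
          unfolding n pos_def by (simp_all add: card_image inj_on_def)
        moreover have "stage S s = Suc (pos S n)" using ix_snoc[of "pre S" "[]" n] by (simp add: n pos_def)
        ultimately show ?thesis using s by (simp add: least_elems_def Suc_le_eq)
      qed
      then have "least_elems (\<prec>) k S = {s \<in> S. stage S s \<le> k}" by (auto simp: least_elems_def)
      then show ?thesis unfolding True approx_rank1 .
    next
      case False
      have B0: "B \<noteq> {{}}" using step.hyps(1) by blast
      note ri = row_index_props[OF u SB infinite_rows[OF u step.prems]]
      show ?thesis
      proof (induction k)
        case 0
        then show ?case by (simp add: approx_0[OF B0 False])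
      next
        case (Suc k)
        have r: "row_approx B (k + 1 - i) S (row_index S i) =
          {s \<in> row S (row_index S i). stage S s \<le> k + 1 - i + i}" for i
          by (rule row[OF u step.prems step.IH])
        show ?case
        proof (intro equalityI subsetI)
          fix s assume "s \<in> approx B (Suc k) S"
          then consider "s \<in> approx B k S" | i where "i \<le> k" "s \<in> row_approx B (k + 1 - i) S (row_index S i)"
            unfolding approx_Suc[OF B0 False] by blast
          then show "s \<in> {s \<in> S. stage S s \<le> Suc k}"
          proof cases
            case 1
            then show ?thesis using Suc.IH by simp
          next
            case 2
            then show ?thesis unfolding r by (simp add: row_def)
          qed
        next
          fix s assume s: "s \<in> {s \<in> S. stage S s \<le> Suc k}"
          then have "s \<in> seqs B" using SB by blast
          then obtain n t where t: "s = upsilon n t" by (rule seqs_cases[OF u])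
          have "prefix (upsilon n []) s" by (simp add: t prefix_upsilon)
          then have "upsilon n [] \<in> pre S" using s by (auto simp: pre_def)
          then have n: "row_index S (pos S n) = n" using ri(3) by (simp add: upsilon_Nil)
          have st: "stage S s = pos S n + stage (subtree S n) t" unfolding t by (rule stage_upsilon[OF u SB])
          have i: "pos S n \<le> k" using s st by simp
          have "s \<in> row S n" using s by (simp add: row_def t upsilon_def)
          then have "s \<in> row_approx B (k + 1 - pos S n) S (row_index S (pos S n))"
            unfolding r using s n i by simp
          then show "s \<in> approx B (Suc k) S" unfolding approx_Suc[OF B0 False] using i by blast
        qed
      qed
    qed
  qed
  show "ubar B \<Longrightarrow> {} \<notin> B \<Longrightarrow> B \<noteq> singletons \<Longrightarrow> infinitary B S \<Longrightarrow>
    row_approx B q S (row_index S i) = {s \<in> row S (row_index S i). stage S s \<le> q + i}"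
  proof (rule row)
    fix n S' k assume "ubar B" "{} \<notin> B" "infinitary (shifted_section B n) S'"
    moreover from \<open>ubar B\<close> \<open>{} \<notin> B\<close> have "ubar (shifted_section B n)" by cases auto
    ultimately show "approx (shifted_section B n) k S' = {s \<in> S'. stage S' s \<le> k}" using main by blast
  qed auto
qed

text \<open>Keep passing to the first child until a leaf is reached. The leaf has the same stage as
  \<open>x\<close>, so statements about nodes can be passed on to leaves, of which the
  approximations consist.\<close>

lemma zero_extension:
  "ubar B \<Longrightarrow> infinitary B S \<Longrightarrow> x \<in> pre S \<Longrightarrow>
    \<exists>s\<in>S. \<exists>k. prefix x s \<and> ix (pre S) s = ix (pre S) x @ replicate k 0"
proof (induction arbitrary: S x rule: ubar.induct)
  case zero
  then show ?case by (auto simp: infinitary_zero pre_def)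
next
  case (step B)
  have u: "ubar B" by (rule ubar.step[OF step.hyps])
  note u = u step.hyps(1)
  have SB: "S \<subseteq> seqs B" using step.prems(1) by (simp add: infinitary_def)
  have rec: "\<exists>s\<in>S. \<exists>k. prefix (upsilon n t) s \<and> ix (pre S) s = ix (pre S) (upsilon n t) @ replicate k 0"
    if t: "t \<in> pre (subtree S n)" for n t
  proof -
    have "upsilon n t \<in> pre S" using t pre_upsilon[OF u SB] by simp
    then have "[n] \<in> pre S" by (rule pre_prefix) (simp add: upsilon_def)
    then obtain s k where s: "s \<in> subtree S n" "prefix t s" "ix (pre (subtree S n)) s = ix (pre (subtree S n)) t @ replicate k 0"
      using step.IH[OF infinitary_subtree[OF u step.prems(1)] t] by blast
    have "ix (pre S) (upsilon n s) = ix (pre S) (upsilon n t) @ replicate k 0"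
      using s(3) ix_upsilon_pre[OF u SB] by simp
    moreover have "prefix (upsilon n t) (upsilon n s)" using s(2) by (simp add: prefix_upsilon)
    ultimately show ?thesis using s(1) by auto
  qed
  show ?case
  proof (rule pre_cases[OF u SB step.prems(2)])
    assume x: "x = []"
    note ri = row_index_props[OF u SB infinite_rows[OF u step.prems(1)]]
    let ?n = "row_index S 0"
    have "[] \<in> pre (subtree S ?n)" using ri(1)[of 0] pre_upsilon[OF u SB, of ?n "[]"] by (simp add: upsilon_Nil)
    then obtain s k where s: "s \<in> S" "ix (pre S) s = ix (pre S) (upsilon ?n []) @ replicate k 0"
      using rec by blast
    moreover have "ix (pre S) (upsilon ?n []) = [0]" using ix_upsilon_pre[OF u SB] ri(2) by simp
    ultimately have "ix (pre S) s = ix (pre S) x @ replicate (Suc k) 0" by (simp add: x)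
    then show ?thesis using s(1) x by (intro bexI[of _ s] exI[of _ "Suc k"]) auto
  next
    fix n t assume "x = upsilon n t" "t \<in> pre (subtree S n)"
    then show ?thesis using rec by simp
  qed
qed

lemma sum_list_ix_prefix: "prefix x y \<Longrightarrow> sum_list (ix N x) \<le> sum_list (ix N y)"
  using ix_prefix[of x y N] by (auto simp: prefix_def)

lemma preI: "s \<in> S \<Longrightarrow> prefix x s \<Longrightarrow> x \<in> pre S"
  by (auto simp: pre_def)

lemma preE:
  assumes "x \<in> pre S"
  obtains s where "s \<in> S" "prefix x s"
  using assms by (auto simp: pre_def)

lemma seq_hat_stage:
  assumes "ubar B" "infinitary B S"
  shows "seq_hat {s \<in> S. stage S s \<le> k} = {x \<in> pre S. x \<noteq> [] \<and> stage S x \<le> k}"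
proof (intro equalityI subsetI)
  fix x assume "x \<in> seq_hat {s \<in> S. stage S s \<le> k}"
  then obtain s where s: "s \<in> S" "stage S s \<le> k" "prefix x s" "x \<noteq> []"
    unfolding seq_hat_pre by (auto elim!: preE)
  then show "x \<in> {x \<in> pre S. x \<noteq> [] \<and> stage S x \<le> k}"
    using sum_list_ix_prefix[of x s "pre S"] preI[of s S x] by auto
next
  fix x assume x: "x \<in> {x \<in> pre S. x \<noteq> [] \<and> stage S x \<le> k}"
  then obtain s j where "s \<in> S" "prefix x s" "ix (pre S) s = ix (pre S) x @ replicate j 0"
    using zero_extension[OF assms] by blast
  then show "x \<in> seq_hat {s \<in> S. stage S s \<le> k}"
    using x unfolding seq_hat_pre by (auto simp: sum_list_replicate intro!: preI[of s])
qed

lemma seq_hat_row_stage: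
  assumes "ubar B" "{} \<notin> B" "infinitary B S"
  shows "seq_hat {s \<in> row S n. stage S s \<le> k} = {x \<in> pre S. x \<noteq> [] \<and> x ! 0 = n \<and> stage S x \<le> k}"
proof (intro equalityI subsetI)
  fix x assume "x \<in> seq_hat {s \<in> row S n. stage S s \<le> k}"
  then obtain s where s: "s \<in> row S n" "stage S s \<le> k" "prefix x s" "x \<noteq> []"
    unfolding seq_hat_pre by (auto elim!: preE)
  moreover have "x ! 0 = s ! 0" using s(3,4) by (auto simp: prefix_def nth_append)
  ultimately show "x \<in> {x \<in> pre S. x \<noteq> [] \<and> x ! 0 = n \<and> stage S x \<le> k}"
    using sum_list_ix_prefix[of x s "pre S"] preI[of s S x] by (auto simp: row_def)
next
  fix x assume x: "x \<in> {x \<in> pre S. x \<noteq> [] \<and> x ! 0 = n \<and> stage S x \<le> k}"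
  then obtain s j where s: "s \<in> S" "prefix x s" "ix (pre S) s = ix (pre S) x @ replicate j 0"
    using zero_extension[OF assms(1,3)] by blast
  moreover have "s ! 0 = n" "s \<noteq> []" using s(2) x by (auto simp: prefix_def nth_append)
  ultimately show "x \<in> seq_hat {s \<in> row S n. stage S s \<le> k}"
    using x unfolding seq_hat_pre by (auto simp: row_def sum_list_replicate intro!: preI[of s])
qed

text \<open>A positive first entry excludes row 0. Asking for strict increase carries this over to
  all sections: in \<open>upsilon n t\<close> it says that \<open>t\<close> begins with a positive
  number too.\<close>

definition strict :: "nat list \<Rightarrow> bool"
  where "strict t \<longleftrightarrow> sorted_wrt (<) (0 # t)"

lemma strict_upsilon: "strict (upsilon n t) \<Longrightarrow> strict t"
  by (auto simp: strict_def upsilon_def sorted_wrt_map)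

lemma domain_space_infinitary: "ubar B \<Longrightarrow> domain_space B S \<Longrightarrow> infinitary B S"
proof (induction arbitrary: S rule: ubar.induct)
  case zero
  from zero show ?case
    by (cases rule: domain_space.cases) (auto simp: infinitary_zero)
next
  case (step B)
  have u: "ubar B" by (rule ubar.step[OF step.hyps])
  note u = u step.hyps(1)
  from step.prems show ?case
  proof (cases rule: domain_space.cases)
    case rank0
    then show ?thesis using u(2) by simp
  next
    case rank1
    have SB: "S \<subseteq> seqs B" using rank1 by simp
    have "S \<subseteq> (\<lambda>m. [m]) ` {m. [m] \<in> pre S}"
      using rank1(2) pre_singletons[OF rank1(2)] by (auto simp: seqs_singletons)
    then have inf: "infinite {m. [m] \<in> pre S}" using rank1(3) by (meson finite_imageI finite_subset)
    have nil: "x = []" if x: "x \<in> pre S - seqs B" for x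
    proof (rule pre_cases[OF u, of S x])
      show "S \<subseteq> seqs B" using rank1 by simp
      show "x \<in> pre S" using x by simp
      fix n t assume "x = upsilon n t" "t \<in> pre (subtree S n)"
      then obtain s where "upsilon n s \<in> S" "prefix t s" by (auto elim!: preE)
      moreover from this have "s = []" using rank1(2) by (auto simp: seqs_singletons upsilon_def)
      ultimately have "x \<in> seqs B" using \<open>x = upsilon n t\<close> rank1 by auto
      then show ?thesis using x by simp
    qed
    have "infinite {m. x @ [m] \<in> pre S}" if "x \<in> pre S - seqs B" for x
      using nil[OF that] inf by simp
    moreover have "S \<noteq> {}" using rank1(3) by auto
    ultimately show ?thesis using SB by (simp add: infinitary_def)
  next
    case step': step
    have SB: "S \<subseteq> seqs B" by fact
    have rows: "{n. row S n \<noteq> {}} = {n. [n] \<in> pre S}" using row_nonempty_iff[OF u SB] by simp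
    have sub: "infinitary (shifted_section B n) (subtree S n)" if "[n] \<in> pre S" for n
    proof -
      have "row S n \<noteq> {}" using row_nonempty_iff[OF u SB] that by simp
      then obtain T where T: "domain_space (shifted_section B n) T" "row S n = upsilon n ` T"
        using step'(5) by blast
      have "T = subtree S n" using T(2) row_eq[OF u SB, of n] inj_image_eq_iff[OF inj_upsilon] by metis
      then show ?thesis using step.IH T(1) by blast
    qed
    have "infinite {m. x @ [m] \<in> pre S}" if x: "x \<in> pre S - seqs B" for x
    proof (rule pre_cases[OF u SB, of x])
      show "x \<in> pre S" using x by simp
      show ?thesis if "x = []" using that step'(4) unfolding rows by simp
      fix n t assume t: "x = upsilon n t" "t \<in> pre (subtree S n)"
      have "[n] \<in> pre S" using x by (auto intro: pre_prefix simp: t upsilon_def)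
      then have "infinitary (shifted_section B n) (subtree S n)" by (rule sub)
      moreover have "t \<in> pre (subtree S n) - seqs (shifted_section B n)"
        using t x upsilon_in_seqs[OF u] by simp
      ultimately have "infinite {m. t @ [m] \<in> pre (subtree S n)}" unfolding infinitary_def by blast
      then have "infinite ((\<lambda>m. m + n) ` {m. t @ [m] \<in> pre (subtree S n)})"
        by (simp add: finite_image_iff)
      moreover have "(\<lambda>m. m + n) ` {m. t @ [m] \<in> pre (subtree S n)} \<subseteq> {m. x @ [m] \<in> pre S}"
        using pre_upsilon[OF u SB] by (auto simp: t upsilon_snoc[symmetric])
      ultimately show ?thesis using finite_subset by blast
    qed
    moreover have "S \<noteq> {}" using step'(4) by (auto simp: row_def)
    ultimately show ?thesis using SB by (simp add: infinitary_def)
  qed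
qed

section \<open>The domain space as agreement of two orders\<close>

lemma stage_leaf_exists:
  assumes "ubar B" "{} \<notin> B" "infinitary B S" "0 < q"
  shows "\<exists>s\<in>S. stage S s = q"
proof -
  have SB: "S \<subseteq> seqs B" using assms by (simp add: infinitary_def)
  note ri = row_index_props[OF assms(1,2) SB infinite_rows[OF assms(1-3)]]
  let ?n = "row_index S (q - 1)"
  have "upsilon ?n [] \<in> pre S" using ri(1) by (simp add: upsilon_Nil)
  then obtain s k where s: "s \<in> S" "ix (pre S) s = ix (pre S) (upsilon ?n []) @ replicate k 0"
    using zero_extension[OF assms(1,3)] by blast
  have "ix (pre S) (upsilon ?n []) = [q - 1]" using ix_upsilon_pre[OF assms(1,2) SB] ri(2) by simp
  then have "stage S s = q" using s(2) assms(4) by (simp add: sum_list_replicate)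
  then show ?thesis using s(1) by blast
qed

lemma zero_prec_all: "y \<noteq> [] \<Longrightarrow> [0] = y \<or> [0] \<prec> y"
proof -
  assume "y \<noteq> []"
  then obtain a r where y: "y = a # r" by (cases y) auto
  show ?thesis
  proof (cases "max_entry y = 0")
    case True
    then have "a = 0" using max_entry_ge[of a y] y by simp
    then show ?thesis using y prec_prefix[of "[0]" y] by (cases r) auto
  next
    case False
    then show ?thesis by (auto simp: prec_iff max_entry_def)
  qed
qed

text \<open>If the first row has rank \<open>0\<close>, the conditions of \<open>domain_space\<close> do not order the remaining
  rows among each other.  This can only be the row \<open>0\<close>, and is excluded by the strictness of the
  leaves up to \<open>y\<close>.\<close>

lemma domain_space_order:
  "ubar B \<Longrightarrow> domain_space B S \<Longrightarrow> x \<in> pre S \<Longrightarrow> y \<in> pre S \<Longrightarrow> ilt (ix (pre S) x) (ix (pre S) y) \<Longrightarrow>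
    (\<And>t. t \<in> S \<Longrightarrow> t = y \<or> t \<prec> y \<Longrightarrow> strict t) \<Longrightarrow> x \<prec> y"
proof (induction arbitrary: S x y rule: ubar.induct)
  case zero
  have "infinitary {{}} S" by (rule domain_space_infinitary[OF ubar.zero zero.prems(1)])
  then have "S = {[]}" by (simp add: infinitary_zero)
  then have "x = []" "y = []" using zero.prems by (auto simp: pre_def)
  then show ?case using zero.prems(4) by (simp add: ilt_irrefl)
next
  case (step B)
  have u: "ubar B" by (rule ubar.step[OF step.hyps])
  have T: "infinitary B S" by (rule domain_space_infinitary[OF u step.prems(1)])
  note u = u step.hyps(1)
  have SB: "S \<subseteq> seqs B" using T by (simp add: infinitary_def)
  note ri = row_index_props[OF u SB infinite_rows[OF u T]]
  have "y \<noteq> []"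
  proof
    assume "y = []"
    then show False using step.prems(4) by (simp add: ilt_def)
  qed
  show ?case
  proof (rule pre_cases[OF u SB step.prems(2)])
    assume "x = []"
    then show ?thesis using \<open>y \<noteq> []\<close> by (simp add: prec_def)
  next
    fix n x' assume x: "x = upsilon n x'" "x' \<in> pre (subtree S n)"
    obtain m y' where y: "y = upsilon m y'" "y' \<in> pre (subtree S m)"
      by (rule pre_cases[OF u SB step.prems(3)]) (use \<open>y \<noteq> []\<close> in auto)
    have nS: "[n] \<in> pre S" using step.prems(2) by (auto intro: pre_prefix simp: x upsilon_def)
    have mS: "[m] \<in> pre S" using step.prems(3) by (auto intro: pre_prefix simp: y upsilon_def)
    from step.prems(1) show ?thesis
    proof (cases rule: domain_space.cases)
      case rank0
      then show ?thesis using u(2) by simp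
    next
      case rank1
      have "x' = []" "y' = []"
        using step.prems(2,3) rank1(2) x y by (fastforce elim!: preE simp: seqs_singletons upsilon_def)+
      then have xy: "x = [n]" "y = [m]" using x y by (simp_all add: upsilon_Nil)
      have "n < m"
      proof (rule ccontr)
        assume "\<not> n < m"
        then have "pos S m \<le> pos S n" unfolding pos_def by (intro card_mono) auto
        moreover have "ilt [pos S n] [pos S m]"
          using step.prems(4) ix_upsilon_pre[OF u SB, of _ "[]"] by (simp add: xy upsilon_Nil)
        ultimately show False by (auto simp: ilt_def)
      qed
      then show ?thesis by (simp add: xy prec_single)
    next
      case step': step
      show ?thesis
      proof (cases "n = m")
        case True
        have "row S n \<noteq> {}" using row_nonempty_iff[OF u SB] nS by simp
        then obtain T' where T': "domain_space (shifted_section B n) T'" "row S n = upsilon n ` T'"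
          using step'(5) by blast
        have "T' = subtree S n" using T'(2) row_eq[OF u SB, of n] inj_image_eq_iff[OF inj_upsilon] by metis
        then have d: "domain_space (shifted_section B n) (subtree S n)" using T'(1) by simp
        have "x' \<prec> y'"
        proof (rule step.IH[OF d x(2)])
          show "y' \<in> pre (subtree S n)" using y(2) True by simp
          show "ilt (ix (pre (subtree S n)) x') (ix (pre (subtree S n)) y')"
            using step.prems(4) ix_upsilon_pre[OF u SB, of n] by (simp add: x y True ilt_Cons)
          show "strict t" if t: "t \<in> subtree S n" "t = y' \<or> t \<prec> y'" for t
          proof -
            have "upsilon n t = y \<or> upsilon n t \<prec> y" using t(2) by (auto simp: y True prec_upsilon)
            then have "strict (upsilon n t)" using step.prems(5) t(1) by simp
            then show ?thesis by (rule strict_upsilon)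
          qed
        qed
        then show ?thesis by (simp add: x y True prec_upsilon)
      next
        case False
        define i where "i = pos S n"
        define j where "j = pos S m"
        have ne: "i \<noteq> j" using ri(3)[OF nS] ri(3)[OF mS] False unfolding i_def j_def by metis
        have m: "row_index S j = m" using ri(3)[OF mS] by (simp add: j_def)
        \<comment> \<open>As \<open>B\<close> is not \<open>singletons\<close>, a section of rank 0
          belongs to row 0. Then \<open>[0]\<close> is a leaf; being the least nonempty sequence it
          does not exceed \<open>y\<close>, but it is not strict.\<close>
        have rank: "{} \<notin> shifted_section B (row_index S r)" for r
        proof
          assume e: "{} \<in> shifted_section B (row_index S r)"
          have c: "shifted_section B (row_index S r) = {{}}"
            using step.hyps(3)[of "row_index S r"] e by cases auto
          have z: "row_index S r = 0" using step.hyps(4)[OF c] step'(2) by linarith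
          have "infinitary (shifted_section B 0) (subtree S 0)" using infinitary_subtree[OF u T ri(1)[of r]] z by simp
          then have "[] \<in> subtree S 0" using c z by (simp add: infinitary_zero)
          then have "[0] \<in> S" by (simp add: upsilon_Nil)
          then have "strict [0]" using step.prems(5) zero_prec_all[OF \<open>y \<noteq> []\<close>] by blast
          then show False by (simp add: strict_def)
        qed
        have leaf: "\<exists>s\<in>row S (row_index S r). stage S s = b" if "r < b" for r b
        proof -
          let ?n = "row_index S r"
          have "0 < b - r" using that by simp
          then have "\<exists>t\<in>subtree S ?n. stage (subtree S ?n) t = b - r"
            by (rule stage_leaf_exists[OF step.hyps(3) rank infinitary_subtree[OF u T ri(1)]])
          then obtain t where t: "t \<in> subtree S ?n" "stage (subtree S ?n) t = b - r" ..
          then have "stage S (upsilon (row_index S r) t) = b"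
            using stage_upsilon[OF u SB] ri(2) \<open>r < b\<close> by simp
          then show ?thesis using t(1) row_eq[OF u SB] by blast
        qed
        note rapp = approx_eq(2)[OF u step'(2) T]
        \<comment> \<open>The last condition of \<open>domain_space\<close> in terms of stages: a
          leaf of row \<open>r - 1\<close> with stage at most \<open>b\<close> precedes the nodes
          that row \<open>r\<close> acquires at stage \<open>b\<close>.\<close>
        have condb: "s \<prec> z" if h: "1 \<le> r" "r < b" "s \<in> row S (row_index S (r - 1))" "stage S s \<le> b"
          "z \<in> pre S" "z \<noteq> []" "z ! 0 = row_index S r" "stage S z = b" for r b s z
        proof -
          obtain k where k: "b = Suc k" using h(2) by (cases b) auto
          have rk: "r \<le> k" using h(2) k by simp
          have "row_approx B (k + 2 - r) S (row_index S (r - 1)) \<prec>\<prec>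
            seq_hat (row_approx B (k + 1 - r) S (row_index S r)) -
            seq_hat (row_approx B (k - r) S (row_index S r))"
            by (rule step'(7)[OF h(1) rk])
          moreover have "s \<in> row_approx B (k + 2 - r) S (row_index S (r - 1))"
            unfolding rapp using h(1,3,4) k rk by simp
          moreover have "z \<in> seq_hat (row_approx B (k + 1 - r) S (row_index S r)) -
            seq_hat (row_approx B (k - r) S (row_index S r))"
            unfolding rapp seq_hat_row_stage[OF u T] using h(5-8) k rk by simp
          ultimately show ?thesis by (simp add: prec_sets_def)
        qed
        \<comment> \<open>From neighbouring rows to distant ones, by passing through leaves of stage
          exactly \<open>b\<close> in the rows between; \<open>leaf\<close> supplies them.\<close>
        have chain: "s \<prec> z" if "r < r'" "r' < b" "s \<in> row S (row_index S r)" "stage S s \<le> b"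
          "z \<in> pre S" "z \<noteq> []" "z ! 0 = row_index S r'" "stage S z = b" for r r' b s z
          using that
        proof (induction r' arbitrary: z)
          case (Suc r')
          show ?case
          proof (cases "r = r'")
            case True
            show ?thesis
              by (rule condb[of "Suc r'" b]) (use Suc.prems True in auto)
          next
            case False
            obtain w where w: "w \<in> row S (row_index S r')" "stage S w = b" using leaf[of r' b] Suc.prems(2) by auto
            have "s \<prec> w"
              by (rule Suc.IH) (use Suc.prems False w in \<open>auto simp: row_def intro: preI[of w]\<close>)
            moreover have "w \<prec> z"
              by (rule condb[of "Suc r'" b]) (use Suc.prems w in auto)
            ultimately show ?thesis by (rule prec_trans)
          qed
        qed simp
        \<comment> \<open>The left sides of the conditions consist of leaves, so \<open>x\<close> is
          replaced by a leaf above it with the same stage.\<close>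
        obtain s k where s: "s \<in> S" "prefix x s" "ix (pre S) s = ix (pre S) x @ replicate k 0"
          using zero_extension[OF u(1) T step.prems(2)] by blast
        have st: "stage S s = stage S x" using s(3) by (simp add: sum_list_replicate)
        have "s ! 0 = n" "s \<noteq> []" using s(2) by (auto simp: x upsilon_def prefix_def)
        then have srow: "s \<in> row S (row_index S i)" using s(1) ri(3)[OF nS] by (simp add: row_def i_def)
        have y0: "y ! 0 = row_index S j" by (simp add: m y upsilon_def)
        have ixx: "ix (pre S) x = i # ix (pre (subtree S n)) x'" using ix_upsilon_pre[OF u SB] by (simp add: x i_def)
        have ixy: "ix (pre S) y = j # ix (pre (subtree S m)) y'" using ix_upsilon_pre[OF u SB] by (simp add: y j_def)
        define b where "b = stage S y"
        have jb: "j < b" by (simp add: b_def ixy)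
        \<comment> \<open>At equal stages the rows decide. If \<open>x\<close> has an earlier stage,
          \<open>s\<close> precedes what row 0 acquires at stage \<open>b\<close>, and from a leaf
          of that kind \<open>chain\<close> leads to the row of \<open>y\<close>.\<close>
        have sy: "s \<prec> y"
        proof (cases "stage S x = b")
          case True
          then have "lex_less (ix (pre S) x) (ix (pre S) y)" using step.prems(4) by (simp add: ilt_def b_def)
          then have "i < j" using ne by (simp add: ixx ixy)
          then show ?thesis
            by (rule chain[OF _ jb srow]) (use True st step.prems(3) y0 \<open>y \<noteq> []\<close> in \<open>simp_all add: b_def\<close>)
        next
          case False
          then have lt: "stage S s < b" using step.prems(4) st by (simp add: ilt_def b_def)
          then obtain k where k: "b = Suc k" "1 \<le> k" by (cases b) auto
          have conda: "s \<prec> z" if z: "z \<in> pre S" "z \<noteq> []" "z ! 0 = row_index S 0" "stage S z = b" for z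
          proof -
            have "approx B k S \<prec>\<prec> seq_hat (row_approx B (k + 1) S (row_index S 0)) - seq_hat (approx B k S)"
              by (rule step'(6)[OF k(2)])
            moreover have "s \<in> approx B k S" unfolding approx_eq(1)[OF u(1) T] using s(1) lt k(1) by simp
            moreover have "z \<in> seq_hat (row_approx B (k + 1) S (row_index S 0)) - seq_hat (approx B k S)"
              unfolding rapp approx_eq(1)[OF u(1) T] seq_hat_row_stage[OF u T] seq_hat_stage[OF u(1) T]
              using z k(1) by simp
            ultimately show ?thesis by (simp add: prec_sets_def)
          qed
          show ?thesis
          proof (cases "j = 0")
            case True
            then show ?thesis using conda[OF step.prems(3) \<open>y \<noteq> []\<close>] y0 by (simp add: b_def)
          next
            case False
            obtain w where w: "w \<in> row S (row_index S 0)" "stage S w = b" using leaf[of 0 b] k(1) by auto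
            have wp: "w \<in> pre S" "w \<noteq> []" "w ! 0 = row_index S 0"
              using w(1) by (auto simp: row_def intro: preI[of w])
            have "s \<prec> w" by (rule conda[OF wp w(2)])
            moreover have "w \<prec> y"
              by (rule chain[OF _ jb w(1)]) (use False w(2) step.prems(3) y0 \<open>y \<noteq> []\<close> in \<open>simp_all add: b_def\<close>)
            ultimately show ?thesis by (rule prec_trans)
          qed
        qed
        show ?thesis
        proof (cases "x = s")
          case False
          then have "x \<prec> s" by (rule prec_prefix[OF s(2)])
          then show ?thesis using sy by (rule prec_trans)
        qed (use sy in simp)
      qed
    qed
  qed
qed

text \<open>In both conditions the left side is earlier in the order of entry: either its stage is
  smaller, or the stages agree and its row comes first. Agreement of \<open>ilt\<close> with
  \<open>prec\<close> does the rest, also inside the rows.\<close>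

lemma domain_spaceI:
  "ubar B \<Longrightarrow> infinitary B S \<Longrightarrow>
    (\<And>x y. x \<in> pre S \<Longrightarrow> y \<in> pre S \<Longrightarrow> ilt (ix (pre S) x) (ix (pre S) y) \<Longrightarrow> x \<prec> y) \<Longrightarrow> domain_space B S"
proof (induction arbitrary: S rule: ubar.induct)
  case zero
  then show ?case using domain_space.rank0 by (simp add: infinitary_zero)
next
  case (step B)
  have u: "ubar B" by (rule ubar.step[OF step.hyps])
  note u = u step.hyps(1)
  have T: "infinitary B S" by (rule step.prems(1))
  have SB: "S \<subseteq> seqs B" using T by (simp add: infinitary_def)
  note ri = row_index_props[OF u SB infinite_rows[OF u T]]
  show ?case
  proof (cases "B = singletons")
    case True
    have "{n. [n] \<in> pre S} = {n. [n] \<in> S}" using pre_singletons[of S] SB True by simp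
    then have "infinite {n. [n] \<in> S}" using infinite_rows[OF u T] by simp
    then have "infinite ((\<lambda>n. [n]) ` {n. [n] \<in> S})" by (simp add: finite_image_iff inj_on_def)
    moreover have "(\<lambda>n. [n]) ` {n. [n] \<in> S} \<subseteq> S" by auto
    ultimately have "infinite S" using finite_subset by blast
    then show ?thesis using SB domain_space.rank1 unfolding True by blast
  next
    case False
    note rapp = approx_eq(2)[OF u False T]
    show ?thesis
    proof (rule domain_space.step[OF _ False SB])
      show "B \<noteq> {{}}" using u(2) by blast
      show "infinite {n. row S n \<noteq> {}}" using infinite_rows[OF u T] row_nonempty_iff[OF u SB] by simp
    next
      fix n assume "row S n \<noteq> {}"
      then have n: "[n] \<in> pre S" using row_nonempty_iff[OF u SB] by simp
      have "domain_space (shifted_section B n) (subtree S n)"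
      proof (rule step.IH[OF infinitary_subtree[OF u T n]])
        fix x y assume xy: "x \<in> pre (subtree S n)" "y \<in> pre (subtree S n)" "ilt (ix (pre (subtree S n)) x) (ix (pre (subtree S n)) y)"
        have "upsilon n x \<prec> upsilon n y"
          by (rule step.prems(2)) (use xy pre_upsilon[OF u SB] ix_upsilon_pre[OF u SB] in \<open>simp_all add: ilt_Cons\<close>)
        then show "x \<prec> y" by (simp add: prec_upsilon)
      qed
      then show "\<exists>T. domain_space (shifted_section B n) T \<and> row S n = upsilon n ` T"
        using row_eq[OF u SB] by blast
    next
      fix k :: nat assume "1 \<le> k"
      show "approx B k S \<prec>\<prec> seq_hat (row_approx B (k + 1) S (row_index S 0)) - seq_hat (approx B k S)"
        unfolding prec_sets_def rapp approx_eq(1)[OF u(1) T] seq_hat_row_stage[OF u T] seq_hat_stage[OF u(1) T]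
      proof (intro ballI)
        fix s z assume s: "s \<in> {s \<in> S. stage S s \<le> k}" and
          z: "z \<in> {x \<in> pre S. x \<noteq> [] \<and> x ! 0 = row_index S 0 \<and> stage S x \<le> k + 1 + 0} -
            {x \<in> pre S. x \<noteq> [] \<and> stage S x \<le> k}"
        show "s \<prec> z"
          by (rule step.prems(2)) (use s z in \<open>auto simp: ilt_def intro: preI[of s]\<close>)
      qed
    next
      fix k i :: nat assume i: "1 \<le> i" "i \<le> k"
      show "row_approx B (k + 2 - i) S (row_index S (i - 1)) \<prec>\<prec>
        seq_hat (row_approx B (k + 1 - i) S (row_index S i)) - seq_hat (row_approx B (k - i) S (row_index S i))"
        unfolding prec_sets_def rapp seq_hat_row_stage[OF u T]
      proof (intro ballI)
        fix s z assume s: "s \<in> {s \<in> row S (row_index S (i - 1)). stage S s \<le> k + 2 - i + (i - 1)}" and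
          z: "z \<in> {x \<in> pre S. x \<noteq> [] \<and> x ! 0 = row_index S i \<and> stage S x \<le> k + 1 - i + i} -
            {x \<in> pre S. x \<noteq> [] \<and> x ! 0 = row_index S i \<and> stage S x \<le> k - i + i}"
        have s1: "s \<in> S" "stage S s \<le> k + 1" using s i by (auto simp: row_def)
        have z1: "z \<in> pre S" "z \<noteq> []" "z ! 0 = row_index S i" "stage S z = k + 1" using z i by auto
        have "s \<in> pre S" using s1(1) by (auto intro: preI[of s])
        obtain t where t: "s = upsilon (row_index S (i - 1)) t" using s row_eq[OF u SB] by auto
        obtain w where w: "z = upsilon (row_index S i) w"
        proof (rule pre_cases[OF u SB z1(1)])
          fix n w assume "z = upsilon n w"
          moreover from this have "n = row_index S i" using z1(3) by (simp add: upsilon_def)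
          ultimately show ?thesis using that by blast
        qed (use z1 in simp)
        have "lex_less (ix (pre S) s) (ix (pre S) z)"
          unfolding t w ix_upsilon_pre[OF u SB] ri(2) using i by simp
        then have "ilt (ix (pre S) s) (ix (pre S) z)" using s1(2) z1(4) by (auto simp: ilt_def)
        then show "s \<prec> z" by (rule step.prems(2)[OF \<open>s \<in> pre S\<close> z1(1)])
      qed
    qed
  qed
qed

section \<open>The schedule of a barrier\<close>

lemma finite_least:
  assumes "finite A" "A \<noteq> {}"
    and tr: "\<And>x y z. lt x y \<Longrightarrow> lt y z \<Longrightarrow> lt x z"
    and lin: "\<And>x y. x \<in> A \<Longrightarrow> y \<in> A \<Longrightarrow> lt x y \<or> x = y \<or> lt y x"
  shows "\<exists>x\<in>A. \<forall>y\<in>A. y \<noteq> x \<longrightarrow> lt x y"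
  using assms(1,2) lin
proof (induction rule: finite_ne_induct)
  case (insert a A)
  have "\<exists>x\<in>A. \<forall>y\<in>A. y \<noteq> x \<longrightarrow> lt x y" by (rule insert.IH) (rule insert.prems; simp)
  then obtain x where x: "x \<in> A" "\<And>y. y \<in> A \<Longrightarrow> y \<noteq> x \<Longrightarrow> lt x y" by blast
  consider "lt x a" | "x = a" | "lt a x" using insert.prems[of x a] x(1) by blast
  then show ?case
  proof cases
    case 3
    have "lt a y" if "y \<in> A" for y
      using tr[OF 3] x(2)[OF that] 3 by (cases "y = x") auto
    then show ?thesis by blast
  qed (use x in blast)+
qed simp

definition prefix_closed :: "nat list set \<Rightarrow> bool"
  where "prefix_closed M \<longleftrightarrow> (\<forall>x\<in>M. \<forall>y. prefix y x \<longrightarrow> y \<in> M)"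

lemma prefix_closedD: "prefix_closed M \<Longrightarrow> x \<in> M \<Longrightarrow> prefix y x \<Longrightarrow> y \<in> M"
  by (auto simp: prefix_closed_def)

lemma prefix_closed_pre: "prefix_closed (pre S)"
  unfolding prefix_closed_def using pre_prefix by blast

lemma ix_inj:
  assumes "prefix_closed M"
  shows "x \<in> M \<Longrightarrow> y \<in> M \<Longrightarrow> ix M x = ix M y \<Longrightarrow> x = y"
proof (induction x arbitrary: y rule: rev_induct)
  case Nil
  then have "length y = 0" by (metis length_ix list.size(3))
  then show ?case by simp
next
  case (snoc m x)
  have "y \<noteq> []"
  proof
    assume "y = []"
    then have "length (ix M (x @ [m])) = 0" using snoc.prems(3) by simp
    then show False by simp
  qed
  then obtain y' m' where y: "y = y' @ [m']" by (cases y rule: rev_cases) auto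
  have e: "ix M x = ix M y'" "card {k. k < m \<and> x @ [k] \<in> M} = card {k. k < m' \<and> y' @ [k] \<in> M}"
    using snoc.prems(3) by (simp_all add: y ix_snoc)
  have "x \<in> M" "y' \<in> M"
    using prefix_closedD[OF assms snoc.prems(1), of x] prefix_closedD[OF assms snoc.prems(2), of y'] by (simp_all add: y)
  then have xy: "x = y'" using snoc.IH e(1) by blast
  have less: "card {k. k < a \<and> x @ [k] \<in> M} < card {k. k < b \<and> x @ [k] \<in> M}"
    if "a < b" "x @ [a] \<in> M" for a b
    using that by (intro psubset_card_mono) auto
  have "m = m'"
  proof (rule ccontr)
    assume "m \<noteq> m'"
    then consider "m < m'" | "m' < m" by linarith
    then show False
      using less[of m m'] less[of m' m] snoc.prems(1,2) e(2) by cases (auto simp: y xy)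
  qed
  then show ?case by (simp add: y xy)
qed

lemma ix_cong:
  assumes "\<And>j k. j < length x \<Longrightarrow> k < x ! j \<Longrightarrow> take j x @ [k] \<in> M \<longleftrightarrow> take j x @ [k] \<in> N"
  shows "ix M x = ix N x"
proof -
  have "{m. m < x ! j \<and> take j x @ [m] \<in> M} = {m. m < x ! j \<and> take j x @ [m] \<in> N}" if "j < length x" for j
    using assms that by blast
  then show ?thesis by (simp add: ix_def)
qed

text \<open>A path that can always be continued ends in a leaf since the tree has no infinite paths;
  technically this is an induction over the sections.\<close>

lemma leaf_extension:
  "ubar B \<Longrightarrow> M \<subseteq> pre (seqs B) \<Longrightarrow> (\<And>x. x \<in> M - seqs B \<Longrightarrow> \<exists>m. x @ [m] \<in> M) \<Longrightarrow> x \<in> M \<Longrightarrow>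
    \<exists>s\<in>M \<inter> seqs B. prefix x s"
proof (induction arbitrary: M x rule: ubar.induct)
  case zero
  then have "x \<in> M \<inter> seqs {{}}" by (auto simp: pre_def seqs_zero)
  then show ?case by blast
next
  case (step B)
  have u: "ubar B" by (rule ubar.step[OF step.hyps])
  note u = u step.hyps(1)
  have rec: "\<exists>s\<in>M \<inter> seqs B. prefix (upsilon n t) s" if t: "upsilon n t \<in> M" for n t
  proof -
    have "\<exists>s\<in>subtree M n \<inter> seqs (shifted_section B n). prefix t s"
    proof (rule step.IH)
      show "subtree M n \<subseteq> pre (seqs (shifted_section B n))"
        using step.prems(1) sub_pre_seqs[OF u] by auto
      show "t \<in> subtree M n" using t by simp
      fix x assume x: "x \<in> subtree M n - seqs (shifted_section B n)"
      then have "upsilon n x \<in> M - seqs B" using upsilon_in_seqs[OF u] by simp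
      then obtain m where m: "upsilon n x @ [m] \<in> M" using step.prems(2) by blast
      then have "upsilon n x @ [m] \<in> pre (seqs B)" using step.prems(1) by blast
      then have "sorted (upsilon n x @ [m])" by (rule sorted_pre[OF u(1)])
      then have "n \<le> m" by (simp add: upsilon_def)
      then have "x @ [m - n] \<in> subtree M n" using m by (simp add: upsilon_snoc)
      then show "\<exists>m. x @ [m] \<in> subtree M n" ..
    qed
    then obtain s where s: "upsilon n s \<in> M" "s \<in> seqs (shifted_section B n)" "prefix t s" by auto
    then have "upsilon n s \<in> M \<inter> seqs B" using upsilon_in_seqs[OF u] by simp
    moreover have "prefix (upsilon n t) (upsilon n s)" using s(3) by (simp add: prefix_upsilon)
    ultimately show ?thesis by blast
  qed
  have "x \<in> pre (seqs B)" using step.prems(1,3) by blast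
  then show ?case
  proof (rule pre_cases[OF u order_refl])
    assume x: "x = []"
    have "[] \<notin> seqs B" using Nil_in_seqs[OF u(1)] u(2) by simp
    then obtain m where "[] @ [m] \<in> M" using step.prems(2)[of "[]"] step.prems(3) x by blast
    then have "upsilon m [] \<in> M" by (simp add: upsilon_Nil)
    from rec[OF this] show ?thesis using x by auto
  next
    fix n t assume "x = upsilon n t"
    then show ?thesis using rec step.prems(3) by blast
  qed
qed

definition children :: "nat list set \<Rightarrow> nat list \<Rightarrow> nat set"
  where "children M x = {m. x @ [m] \<in> M}"

text \<open>The index that the next child of \<open>x\<close> will have.\<close>

definition key :: "nat list set \<Rightarrow> nat list \<Rightarrow> nat list"
  where "key M x = ix M x @ [card (children M x)]"

section \<open>Codes of nodes and the choice of the next parent\<close>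

locale ubarrier =
  fixes B :: "nat set set"
  assumes ubar: "ubar B" and nonzero: "{} \<notin> B"
begin

abbreviation leaves :: "nat list set" where "leaves \<equiv> seqs B"
abbreviation nodes :: "nat list set" where "nodes \<equiv> pre (seqs B)"
abbreviation code :: "nat list \<Rightarrow> nat" where "code \<equiv> nu B"

lemma Nil_node: "[] \<in> nodes"
  using seqs_nonempty[OF ubar] by (auto simp: pre_def)

lemma Nil_not_leaf: "[] \<notin> leaves"
  using Nil_in_seqs[OF ubar] nonzero by simp

lemma child_node: "x \<in> nodes - leaves \<Longrightarrow> (\<And>e. e \<in> set x \<Longrightarrow> e \<le> m) \<Longrightarrow> x @ [m] \<in> nodes"
  using pre_children[OF ubar] by blast

text \<open>All predecessors of \<open>x\<close> have entries at most \<open>max_entry x\<close>, so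
  they lie in a finitely branching subtree, which is finite. Hence the nodes have order type omega
  and the choice in \<open>nu\<close> does return the isomorphism.\<close>

lemma code_iso: "bij_betw code nodes UNIV" "x \<in> nodes \<Longrightarrow> y \<in> nodes \<Longrightarrow> x \<prec> y \<longleftrightarrow> code x < code y"
proof -
  have hat: "seqs (hat B) = nodes" by (rule seqs_hat[OF ubar_finite[OF ubar]])
  have "(\<lambda>m. [m]) ` UNIV \<subseteq> nodes" using child_node[of "[]"] Nil_node Nil_not_leaf by auto
  moreover have "infinite ((\<lambda>m :: nat. [m]) ` UNIV)" by (simp add: finite_image_iff inj_on_def)
  ultimately have inf: "infinite nodes" using finite_subset by blast
  have fin: "finite {y \<in> nodes. y \<prec> x}" for x
  proof -
    have "finite {y \<in> nodes. \<forall>e\<in>set y. e \<le> max_entry x}"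
    proof (rule finite_branching_finite[OF ubar])
      show "finite {m. y @ [m] \<in> {y \<in> nodes. \<forall>e\<in>set y. e \<le> max_entry x}}" for y
        by (rule finite_subset[of _ "{..max_entry x}"]) auto
      show "w \<in> {y \<in> nodes. \<forall>e\<in>set y. e \<le> max_entry x}"
        if "y \<in> {y \<in> nodes. \<forall>e\<in>set y. e \<le> max_entry x}" "prefix w y" for y w
        using that set_mono_prefix[OF that(2)] pre_prefix[OF _ that(2)] by auto
    qed auto
    moreover have "{y \<in> nodes. y \<prec> x} \<subseteq> {y \<in> nodes. \<forall>e\<in>set y. e \<le> max_entry x}"
      using max_entry_ge by (fastforce simp: prec_iff)
    ultimately show ?thesis using finite_subset by blast
  qed
  have "\<exists>f :: nat list \<Rightarrow> nat. bij_betw f nodes UNIV \<and> (\<forall>s\<in>nodes. \<forall>t\<in>nodes. s \<prec> t \<longleftrightarrow> f s < f t)"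
    by (rule order_iso_nat[OF inf]) (use prec_irrefl prec_trans prec_linear fin in blast)+
  then have "bij_betw code nodes UNIV \<and> (\<forall>s\<in>nodes. \<forall>t\<in>nodes. s \<prec> t \<longleftrightarrow> code s < code t)"
    unfolding nu_def hat by (rule someI_ex)
  then show "bij_betw code nodes UNIV" "x \<in> nodes \<Longrightarrow> y \<in> nodes \<Longrightarrow> x \<prec> y \<longleftrightarrow> code x < code y" by auto
qed

definition decode :: "nat \<Rightarrow> nat list"
  where "decode = inv_into nodes code"

lemma decode_node [simp]: "decode n \<in> nodes"
  unfolding decode_def by (rule inv_into_into) (use code_iso(1) in \<open>simp add: bij_betw_def\<close>)

lemma code_decode [simp]: "code (decode n) = n"
  unfolding decode_def by (rule f_inv_into_f) (use code_iso(1) in \<open>simp add: bij_betw_def\<close>)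

lemma decode_code [simp]: "x \<in> nodes \<Longrightarrow> decode (code x) = x"
  unfolding decode_def by (rule inv_into_f_f) (use code_iso(1) in \<open>simp_all add: bij_betw_def\<close>)

lemma decode_less: "decode m \<prec> decode n \<longleftrightarrow> m < n"
  using code_iso(2)[of "decode m" "decode n"] by simp

lemma code_le: "x \<in> nodes \<Longrightarrow> y \<in> nodes \<Longrightarrow> x = y \<or> x \<prec> y \<longleftrightarrow> code x \<le> code y"
  using code_iso(2)[of x y] decode_code[of x] decode_code[of y] by (metis le_less)

lemma decode_0 [simp]: "decode 0 = []"
proof (rule ccontr)
  assume "decode 0 \<noteq> []"
  then have "[] \<prec> decode 0" by (simp add: prec_def)
  then have "code [] < code (decode 0)" using code_iso(2)[OF Nil_node decode_node] by blast
  then show False by simp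
qed

lemma code_Nil [simp]: "code [] = 0"
  using code_decode[of 0] by simp

lemma decode_eq_Nil: "decode n = [] \<longleftrightarrow> n = 0"
  by (metis code_Nil code_decode decode_0)

definition par :: "nat \<Rightarrow> nat"
  where "par n = code (butlast (decode n))"

text \<open>The inner node whose next child would enter first, compared by the indices that these
  children would get.\<close>

definition next_parent :: "nat list set \<Rightarrow> nat list"
  where "next_parent M = (SOME x. x \<in> M - leaves \<and> (\<forall>y\<in>M - leaves. y \<noteq> x \<longrightarrow> ilt (key M x) (key M y)))"

definition nxt :: "nat set \<Rightarrow> nat"
  where "nxt P = code (next_parent (decode ` P))"

sublocale schedule par nxt .

lemma next_parent_least:
  assumes "finite M" "[] \<in> M" "prefix_closed M"
  shows "next_parent M \<in> M - leaves"
    "y \<in> M - leaves \<Longrightarrow> y \<noteq> next_parent M \<Longrightarrow> ilt (key M (next_parent M)) (key M y)"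
proof -
  have "\<exists>x\<in>M - leaves. \<forall>y\<in>M - leaves. y \<noteq> x \<longrightarrow> ilt (key M x) (key M y)"
  proof (rule finite_least)
    show "finite (M - leaves)" using assms(1) by simp
    show "M - leaves \<noteq> {}" using assms(2) Nil_not_leaf by blast
    show "ilt (key M x) (key M y) \<Longrightarrow> ilt (key M y) (key M z) \<Longrightarrow> ilt (key M x) (key M z)" for x y z
      by (rule ilt_trans)
    show "ilt (key M x) (key M y) \<or> x = y \<or> ilt (key M y) (key M x)"
      if "x \<in> M - leaves" "y \<in> M - leaves" for x y
      using ilt_linear[of "key M x" "key M y"] ix_inj[OF assms(3), of x y] that by (auto simp: key_def)
  qed
  then have "\<exists>x. x \<in> M - leaves \<and> (\<forall>y\<in>M - leaves. y \<noteq> x \<longrightarrow> ilt (key M x) (key M y))" by blast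
  from someI_ex[OF this] show "next_parent M \<in> M - leaves"
    "y \<in> M - leaves \<Longrightarrow> y \<noteq> next_parent M \<Longrightarrow> ilt (key M (next_parent M)) (key M y)"
    unfolding next_parent_def by blast+
qed

lemma next_parent_unique:
  assumes "finite M" "[] \<in> M" "prefix_closed M" "x \<in> M - leaves"
    "\<And>y. y \<in> M - leaves \<Longrightarrow> y \<noteq> x \<Longrightarrow> ilt (key M x) (key M y)"
  shows "next_parent M = x"
proof (rule ccontr)
  assume ne: "next_parent M \<noteq> x"
  have "ilt (key M (next_parent M)) (key M x)" using next_parent_least(2)[OF assms(1-4)] ne by blast
  moreover have "ilt (key M x) (key M (next_parent M))"
    by (rule assms(5)[OF next_parent_least(1)[OF assms(1-3)] ne])
  ultimately show False using ilt_trans ilt_irrefl by blast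
qed

lemma sibling_less:
  assumes "x @ [m] \<in> nodes" "x @ [m'] \<in> nodes"
  shows "x @ [m] \<prec> x @ [m'] \<longleftrightarrow> m < m'"
  by (rule prec_sibling) (use assms sorted_pre[OF ubar] in blast)+

lemma decode_par: "0 < n \<Longrightarrow> decode n = decode (par n) @ [last (decode n)]"
proof -
  assume "0 < n"
  then have ne: "decode n \<noteq> []" by (simp add: decode_eq_Nil)
  have "butlast (decode n) \<in> nodes"
    by (rule pre_prefix[OF decode_node prefixeq_butlast])
  then show ?thesis using ne by (simp add: par_def)
qed

text \<open>The invariant of the stages. By its last clause every present node enters before any
  child still to come; this allows a new node to be placed last.\<close>

definition ordered :: "nat list set \<Rightarrow> bool"
  where "ordered M \<longleftrightarrow> M \<subseteq> nodes \<and> [] \<in> M \<and> prefix_closed M \<and>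
    (\<forall>x\<in>M. \<forall>y\<in>M. x \<prec> y \<longrightarrow> ilt (ix M x) (ix M y)) \<and>
    (\<forall>x\<in>M - leaves. \<forall>y\<in>M. ilt (ix M y) (key M x))"

text \<open>Being the last of its siblings, \<open>y\<close> receives the key of its parent as index
  and disturbs no other index. That index lies above the present ones by the invariant, and below
  all keys after the insertion: only the keys of the parent and of \<open>y\<close> are new, and
  they are larger; the others were larger by the choice of the parent.\<close>

lemma ordered_insert:
  assumes M: "ordered M" "finite M" and y: "y \<in> nodes" "y = next_parent M @ [m]" "\<And>x. x \<in> M \<Longrightarrow> x \<prec> y"
  shows "ordered (insert y M)"
proof -
  let ?p = "next_parent M"
  let ?M = "insert y M"
  have sub: "M \<subseteq> nodes" "[] \<in> M" and pc: "prefix_closed M"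
    and ord: "\<And>x z. x \<in> M \<Longrightarrow> z \<in> M \<Longrightarrow> x \<prec> z \<Longrightarrow> ilt (ix M x) (ix M z)"
    and fut: "\<And>x z. x \<in> M - leaves \<Longrightarrow> z \<in> M \<Longrightarrow> ilt (ix M z) (key M x)"
    using M(1) by (auto simp: ordered_def)
  note np = next_parent_least[OF M(2) sub(2) pc]
  have yM: "y \<notin> M" using y(3) prec_irrefl by blast
  have pc': "prefix_closed ?M"
    unfolding prefix_closed_def
  proof (intro ballI allI impI)
    fix x w assume "x \<in> ?M" "prefix w x"
    then consider "x \<in> M" | "w = y" | "prefix w ?p" using y(2) by auto
    then show "w \<in> ?M"
      using np(1) prefix_closedD[OF pc] \<open>prefix w x\<close> by cases auto
  qed
  have sib: "k < m" if "?p @ [k] \<in> M" for k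
    using y(3)[OF that] sibling_less[of ?p k m] that sub(1) y(1,2) by auto
  have ixM: "ix ?M z = ix M z" if z: "z \<in> M" for z
  proof (rule ix_cong)
    fix j k assume j: "j < length z" "k < z ! j"
    have "take j z @ [k] \<noteq> y"
    proof
      assume eq: "take j z @ [k] = y"
      then have e: "take j z = ?p" "k = m" using y(2) by auto
      have "take (Suc j) z \<in> M" using prefix_closedD[OF pc z] take_is_prefix by blast
      then have "?p @ [z ! j] \<in> M" using e j by (simp add: take_Suc_conv_app_nth)
      then show False using sib j(2) e by fastforce
    qed
    then show "take j z @ [k] \<in> ?M \<longleftrightarrow> take j z @ [k] \<in> M" by simp
  qed
  have "{k. k < m \<and> ?p @ [k] \<in> ?M} = children M ?p" using sib y(2) by (auto simp: children_def)
  then have ixy: "ix ?M y = key M ?p" using ixM np(1) by (simp add: y(2) ix_snoc key_def)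
  have ch: "children ?M z = children M z" if "z \<noteq> ?p" for z using that y(2) by (auto simp: children_def)
  have chp: "children ?M ?p = insert m (children M ?p)" using y(2) by (auto simp: children_def)
  have "finite (children M ?p)"
  proof -
    have "children M ?p \<subseteq> {..<m}" using sib by (auto simp: children_def)
    then show ?thesis using finite_subset by blast
  qed
  moreover have "m \<notin> children M ?p" using yM y(2) by (simp add: children_def)
  ultimately have keyp: "key ?M ?p = ix M ?p @ [Suc (card (children M ?p))]"
    using ixM np(1) chp by (simp add: key_def)
  have "children M y = {}"
  proof (rule ccontr)
    assume "children M y \<noteq> {}"
    then obtain k where "y @ [k] \<in> M" by (auto simp: children_def)
    then have "y \<in> M" using prefix_closedD[OF pc] by (meson prefixI)
    then show False using yM by simp
  qed
  then have keyy: "key ?M y = key M ?p @ [0]" using ch[of y] y(2) ixy by (simp add: key_def)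
  have pp: "ilt (key M ?p) (key ?M ?p)" unfolding keyp by (simp add: key_def ilt_def)
  have py: "ilt (key M ?p) (key ?M y)" unfolding keyy by (rule ilt_append) simp
  have key_gt: "ilt (key M ?p) (key ?M z)" if z: "z \<in> ?M - leaves" for z
  proof -
    consider "z = y" | "z = ?p" | "z \<in> M - leaves" "z \<noteq> ?p" "z \<noteq> y" using z by blast
    then show ?thesis
    proof cases
      case 3
      then have "key ?M z = key M z" using ixM ch by (simp add: key_def)
      then show ?thesis using np(2)[OF 3(1,2)] by simp
    qed (use pp py in auto)
  qed
  have le: "ix ?M z = key M ?p \<or> ilt (ix ?M z) (key M ?p)" if "z \<in> ?M" for z
    using that ixy ixM fut[OF np(1)] by auto
  show ?thesis
    unfolding ordered_def
  proof (intro conjI ballI impI)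
    show "?M \<subseteq> nodes" "[] \<in> ?M" "prefix_closed ?M" using sub y(1) pc' by auto
    show "ilt (ix ?M x) (ix ?M z)" if x: "x \<in> ?M" and z: "z \<in> ?M" and xz: "x \<prec> z" for x z
    proof (cases "z = y")
      case True
      then have "x \<in> M" using x xz prec_irrefl by auto
      then show ?thesis using True ixy ixM fut[OF np(1)] by simp
    next
      case False
      then have "z \<in> M" using z by simp
      moreover have "x \<in> M"
      proof (rule ccontr)
        assume "x \<notin> M"
        then have "x = y" using x by simp
        then show False using y(3)[OF \<open>z \<in> M\<close>] xz prec_asym by blast
      qed
      ultimately show ?thesis using ord xz ixM by simp
    qed
    show "ilt (ix ?M z) (key ?M x)" if "x \<in> ?M - leaves" "z \<in> ?M" for x z
      using le[OF that(2)] key_gt[OF that(1)] ilt_trans by auto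
  qed
qed

lemma ordered_root: "ordered {[]}"
proof -
  have "\<not> [] \<prec> []" by (rule prec_irrefl)
  moreover have "ilt [] (key {[]} [])" by (simp add: key_def ilt_def children_def)
  ultimately show ?thesis using Nil_node by (auto simp: ordered_def prefix_closed_def)
qed

lemma valid_ordered: "valid P \<Longrightarrow> ordered (decode ` P)"
proof (induction rule: valid.induct)
  case root
  then show ?case using ordered_root by simp
next
  case (node P y)
  have fin: "finite (decode ` P)" using valid_finite[OF node.hyps(1)] by simp
  have "0 < y" using node.hyps(3)[OF valid_0[OF node.hyps(1)]] .
  have np: "next_parent (decode ` P) \<in> decode ` P"
    using next_parent_least(1)[OF fin] node.IH by (auto simp: ordered_def)
  then have "decode (nxt P) = next_parent (decode ` P)" by (auto simp: nxt_def)
  then have y: "decode y = next_parent (decode ` P) @ [last (decode y)]"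
    using decode_par[OF \<open>0 < y\<close>] node.hyps(2) by simp
  have "ordered (insert (decode y) (decode ` P))"
  proof (rule ordered_insert[OF node.IH fin decode_node y])
    fix x assume "x \<in> decode ` P"
    then obtain n where n: "n \<in> P" "x = decode n" by blast
    then show "x \<prec> decode y" using node.hyps(3)[OF n(1)] by (simp add: decode_less)
  qed
  then show ?case by simp
qed

lemma valid_nxt: 
  assumes "valid P"
  shows "nxt P \<in> P" "decode (nxt P) \<in> decode ` P - leaves"
proof -
  have np: "next_parent (decode ` P) \<in> decode ` P - leaves"
    using next_parent_least(1) valid_finite[OF assms] valid_ordered[OF assms] by (auto simp: ordered_def)
  then show "nxt P \<in> P" by (auto simp: nxt_def)
  have "decode (nxt P) = next_parent (decode ` P)" using np by (auto simp: nxt_def)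
  then show "decode (nxt P) \<in> decode ` P - leaves" using np by simp
qed

end

lemma lex_less_append_right:
  "lex_less a b \<Longrightarrow> \<not> prefix a b \<Longrightarrow> lex_less (a @ c) b"
proof (induction a arbitrary: b)
  case (Cons x a)
  then show ?case by (cases b) auto
qed simp

context ubarrier
begin

lemma prec_leq_trans: "x = y \<or> x \<prec> y \<Longrightarrow> y = z \<or> y \<prec> z \<Longrightarrow> x = z \<or> x \<prec> z"
  using prec_trans by blast

lemma finite_prec_nodes: "M \<subseteq> nodes \<Longrightarrow> finite {x \<in> M. x \<prec> y}" "M \<subseteq> nodes \<Longrightarrow> y \<in> nodes \<Longrightarrow> finite {x \<in> M. x = y \<or> x \<prec> y}"
proof -
  show 1: "finite {x \<in> M. x \<prec> y}" if M: "M \<subseteq> nodes" for y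
  proof -
    have "{x \<in> M. x \<prec> y} \<subseteq> decode ` {n. decode n \<prec> y}"
    proof
      fix x assume x: "x \<in> {x \<in> M. x \<prec> y}"
      then have "x = decode (code x)" using M by auto
      then show "x \<in> decode ` {n. decode n \<prec> y}" using x by (intro image_eqI[of _ _ "code x"]) auto
    qed
    moreover have "finite {n. decode n \<prec> y}"
    proof -
      obtain m where "y \<prec> [m]"
        using that[of "Suc (max_entry y)"] by (auto simp: prec_iff max_entry_def)
      have "[m] \<in> nodes" using child_node[of "[]" m] Nil_node Nil_not_leaf by simp
      have "{n. decode n \<prec> y} \<subseteq> {..<code [m]}"
      proof
        fix n assume "n \<in> {n. decode n \<prec> y}"
        then have "decode n \<prec> [m]" using prec_trans \<open>y \<prec> [m]\<close> by blast
        then show "n \<in> {..<code [m]}" using code_iso(2)[OF decode_node \<open>[m] \<in> nodes\<close>] by simp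
      qed
      then show ?thesis using finite_subset by blast
    qed
    ultimately show ?thesis by (meson finite_imageI finite_subset)
  qed
  show "finite {x \<in> M. x = y \<or> x \<prec> y}" if "M \<subseteq> nodes" "y \<in> nodes"
    by (rule finite_subset[of _ "insert y {x \<in> M. x \<prec> y}"]) (use 1[OF that(1)] in auto)
qed

text \<open>Smaller siblings come earlier in \<open>prec\<close>, so a downward closed subtree
  contains all that are counted in the index.\<close>

lemma ix_initial:
  assumes "M \<subseteq> nodes" "prefix_closed M" "N \<subseteq> M" "x \<in> N" "prefix_closed N"
    and down: "\<And>w v. v \<in> N \<Longrightarrow> w \<in> M \<Longrightarrow> w \<prec> v \<Longrightarrow> w \<in> N"
  shows "ix N x = ix M x"
proof (rule ix_cong)
  fix j k assume j: "j < length x" "k < x ! j"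
  have v: "take j x @ [x ! j] \<in> N"
    using prefix_closedD[OF assms(5,4) take_is_prefix[of "Suc j"]] j(1) by (simp add: take_Suc_conv_app_nth)
  have "take j x @ [k] \<in> N" if "take j x @ [k] \<in> M"
  proof (rule down[OF v that])
    show "take j x @ [k] \<prec> take j x @ [x ! j]"
      using sibling_less[of "take j x" k "x ! j"] that v assms(1,3) j(2) by blast
  qed
  then show "take j x @ [k] \<in> N \<longleftrightarrow> take j x @ [k] \<in> M" using assms(3) by blast
qed

section \<open>Branches are members of the space\<close>

lemma orderedD:
  assumes "ordered M"
  shows "x \<in> M \<Longrightarrow> y \<in> M \<Longrightarrow> x \<prec> y \<Longrightarrow> ilt (ix M x) (ix M y)"
    "x \<in> M - leaves \<Longrightarrow> y \<in> M \<Longrightarrow> ilt (ix M y) (key M x)"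
  using assms unfolding ordered_def by blast+

lemma branch_init:
  assumes "branch N"
  shows "x \<in> decode ` N \<Longrightarrow> \<exists>k\<in>N. x \<in> decode ` (N \<inter> {..k})"
    "k \<in> N \<Longrightarrow> ordered (decode ` (N \<inter> {..k}))"
    "decode ` N \<subseteq> nodes" "[] \<in> decode ` N" "prefix_closed (decode ` N)"
proof -
  show 1: "\<exists>k\<in>N. x \<in> decode ` (N \<inter> {..k})" if "x \<in> decode ` N" for x using that by auto
  show 2: "ordered (decode ` (N \<inter> {..k}))" if "k \<in> N" for k
    using assms that valid_ordered unfolding branch_def by blast
  show "decode ` N \<subseteq> nodes" by auto
  have "0 \<in> N" using assms by (simp add: branch_def)
  then have "decode 0 \<in> decode ` N" by (rule imageI)
  then show "[] \<in> decode ` N" by simp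
  show "prefix_closed (decode ` N)"
    unfolding prefix_closed_def
  proof (intro ballI allI impI)
    fix x y assume x: "x \<in> decode ` N" and y: "prefix y x"
    obtain k where k: "k \<in> N" "x \<in> decode ` (N \<inter> {..k})" using 1[OF x] by blast
    have "y \<in> decode ` (N \<inter> {..k})"
      using 2[OF k(1)] prefix_closedD[OF _ k(2) y] by (simp add: ordered_def)
    then show "y \<in> decode ` N" by blast
  qed
qed

lemma branch_ix:
  assumes "branch N" "k \<in> N" "x \<in> decode ` (N \<inter> {..k})"
  shows "ix (decode ` (N \<inter> {..k})) x = ix (decode ` N) x"
proof (rule ix_initial[OF branch_init(3,5)[OF assms(1)] _ assms(3)])
  show "prefix_closed (decode ` (N \<inter> {..k}))" using branch_init(2)[OF assms(1,2)] by (simp add: ordered_def)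
  fix w v assume "v \<in> decode ` (N \<inter> {..k})" "w \<in> decode ` N" "w \<prec> v"
  then obtain a b where ab: "v = decode a" "a \<le> k" "w = decode b" "b \<in> N" "decode b \<prec> decode a" by auto
  then have "b < a" by (simp add: decode_less)
  then show "w \<in> decode ` (N \<inter> {..k})" using ab by auto
qed auto

lemma branch_order:
  assumes "branch N" "x \<in> decode ` N" "y \<in> decode ` N" "x \<prec> y"
  shows "ilt (ix (decode ` N) x) (ix (decode ` N) y)"
proof -
  obtain a b where ab: "x = decode a" "y = decode b" "a \<in> N" "b \<in> N" using assms by blast
  have "a < b" using assms(4) by (simp add: ab decode_less)
  then have in': "x \<in> decode ` (N \<inter> {..b})" "y \<in> decode ` (N \<inter> {..b})" using ab by auto
  then have "ilt (ix (decode ` (N \<inter> {..b})) x) (ix (decode ` (N \<inter> {..b})) y)"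
    using orderedD(1)[OF branch_init(2)[OF assms(1) ab(4)]] assms(4) by blast
  then show ?thesis using branch_ix[OF assms(1) ab(4)] in' by simp
qed

lemma infinite_card_less:
  fixes X :: "nat set"
  assumes "infinite X"
  shows "\<exists>m\<in>X. card {k. k < m \<and> k \<in> X} = i"
  using card_enumerate[OF assms, of i] enumerate_in_set[OF assms, of i] by blast

text \<open>If a node stopped having children, then all indices would stay below the index of its next
  child, so that the branch would be finitely branching.\<close>

lemma branch_infinite_children:
  assumes N: "branch N" and x: "x \<in> decode ` N - leaves"
  shows "infinite (children (decode ` N) x)"
proof
  let ?M = "decode ` N"
  assume fin: "finite (children ?M x)"
  let ?\<kappa> = "ix ?M x @ [card (children ?M x)]"
  have below: "ilt (ix ?M y) ?\<kappa>" if y: "y \<in> ?M" for y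
  proof -
    \<comment> \<open>A stage that contains \<open>?E\<close> already has all children that
      \<open>x\<close> will ever get. There the key of \<open>x\<close> is \<open>?\<kappa>\<close>,
      and the invariant puts the index of \<open>y\<close> below it.\<close>
    let ?E = "insert x (insert y ((\<lambda>m. x @ [m]) ` children ?M x))"
    have "?E \<subseteq> ?M" using x y by (auto simp: children_def)
    then have "code ` ?E \<subseteq> N" by auto
    moreover have "finite (code ` ?E)" using fin by simp
    moreover have "infinite N" using N by (simp add: branch_def)
    ultimately obtain k where k: "k \<in> N" "Max (code ` ?E) < k" by (meson infinite_nat_iff_unbounded)
    have E: "e \<in> decode ` (N \<inter> {..k})" if "e \<in> ?E" for e
    proof -
      have "code e \<le> k" using that k(2) \<open>finite (code ` ?E)\<close> by (meson Max_ge imageI le_less_trans less_imp_le)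
      moreover have "code e \<in> N" using \<open>code ` ?E \<subseteq> N\<close> that by blast
      moreover have "e = decode (code e)" using that \<open>?E \<subseteq> ?M\<close> branch_init(3)[OF N] by auto
      ultimately show ?thesis by blast
    qed
    let ?P = "decode ` (N \<inter> {..k})"
    have "children ?P x = children ?M x" using E by (auto simp: children_def)
    then have "key ?P x = ?\<kappa>" using branch_ix[OF N k(1)] E by (simp add: key_def)
    moreover have "ilt (ix ?P y) (key ?P x)"
      using orderedD(2)[OF branch_init(2)[OF N k(1)]] E x by blast
    ultimately show ?thesis using branch_ix[OF N k(1)] E by simp
  qed
  have "finite ?M"
  proof (rule finite_branching_finite[OF ubar branch_init(3)[OF N]])
    show "\<And>x y. x \<in> ?M \<Longrightarrow> prefix y x \<Longrightarrow> y \<in> ?M" using branch_init(5)[OF N] prefix_closedD by blast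
    fix y assume y: "y \<in> ?M"
    show "finite {m. y @ [m] \<in> ?M}"
    proof (rule ccontr)
      assume "infinite {m. y @ [m] \<in> ?M}"
      \<comment> \<open>The child in this position has an index whose sum exceeds that of
        \<open>?\<kappa>\<close>.\<close>
      then obtain m where m: "y @ [m] \<in> ?M" "card {k. k < m \<and> y @ [k] \<in> ?M} = Suc (sum_list ?\<kappa>)"
        using infinite_card_less[of "{m. y @ [m] \<in> ?M}" "Suc (sum_list ?\<kappa>)"] by auto
      then have "sum_list ?\<kappa> < sum_list (ix ?M (y @ [m]))" by (simp add: ix_snoc)
      then show False using below[OF m(1)] by (simp add: ilt_def)
    qed
  qed
  moreover have "inj_on decode N" by (metis code_decode inj_onI)
  ultimately have "finite N" by (simp add: finite_image_iff)
  then show False using N by (simp add: branch_def)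
qed

lemma branch_pre:
  assumes "branch N"
  shows "pre (decode ` N \<inter> leaves) = decode ` N"
proof (intro equalityI subsetI)
  fix x assume "x \<in> pre (decode ` N \<inter> leaves)"
  then obtain s where "s \<in> decode ` N \<inter> leaves" "prefix x s" by (rule preE)
  then show "x \<in> decode ` N" using prefix_closedD[OF branch_init(5)[OF assms]] by blast
next
  fix x assume x: "x \<in> decode ` N"
  have "\<exists>s\<in>decode ` N \<inter> leaves. prefix x s"
  proof (rule leaf_extension[OF ubar branch_init(3)[OF assms] _ x])
    fix y assume "y \<in> decode ` N - leaves"
    then have "infinite (children (decode ` N) y)" by (rule branch_infinite_children[OF assms])
    then have "children (decode ` N) y \<noteq> {}" by auto
    then show "\<exists>m. y @ [m] \<in> decode ` N" by (auto simp: children_def)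
  qed
  then show "x \<in> pre (decode ` N \<inter> leaves)" by (auto simp: pre_def)
qed

lemma branch_infinitary:
  assumes "branch N"
  shows "infinitary B (decode ` N \<inter> leaves)"
proof -
  have "[] \<in> pre (decode ` N \<inter> leaves)" using branch_pre[OF assms] branch_init(4)[OF assms] by simp
  then have "decode ` N \<inter> leaves \<noteq> {}" by (auto elim: preE)
  moreover have "infinite {m. x @ [m] \<in> decode ` N}" if "x \<in> decode ` N - leaves" for x
    using branch_infinite_children[OF assms that] by (simp add: children_def)
  ultimately show ?thesis using branch_pre[OF assms] by (simp add: infinitary_def)
qed

lemma branch_index_order:
  assumes "branch N" "x \<in> decode ` N" "y \<in> decode ` N" "ilt (ix (decode ` N) x) (ix (decode ` N) y)"
  shows "x \<prec> y"
proof (rule ccontr)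
  assume "\<not> x \<prec> y"
  then consider "x = y" | "y \<prec> x" using prec_linear by blast
  then show False
  proof cases
    case 1
    then show ?thesis using assms(4) ilt_irrefl by simp
  next
    case 2
    then show ?thesis using branch_order[OF assms(1,3,2)] assms(4) ilt_trans ilt_irrefl by blast
  qed
qed

lemma branch_domain_space:
  assumes "branch N"
  shows "domain_space B (decode ` N \<inter> leaves)"
  by (rule domain_spaceI[OF ubar branch_infinitary[OF assms]])
    (unfold branch_pre[OF assms], rule branch_index_order[OF assms])

text \<open>Bounded by \<open>z\<close>, because a member of the space satisfies it only as far as
  its leaves are strict; branches satisfy it for every \<open>z\<close>.\<close>

definition ordered_below :: "nat list set \<Rightarrow> nat list \<Rightarrow> bool"
  where "ordered_below S z \<longleftrightarrow> (\<forall>x\<in>pre S. \<forall>y\<in>pre S. y = z \<or> y \<prec> z \<longrightarrow>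
    ilt (ix (pre S) x) (ix (pre S) y) \<longrightarrow> x \<prec> y)"

lemma ordered_belowD:
  assumes "ordered_below S z" "x \<in> pre S" "y \<in> pre S" "x \<prec> y" "x = z \<or> x \<prec> z"
  shows "ilt (ix (pre S) x) (ix (pre S) y)"
proof (rule ccontr)
  assume "\<not> ilt (ix (pre S) x) (ix (pre S) y)"
  then consider "ix (pre S) x = ix (pre S) y" | "ilt (ix (pre S) y) (ix (pre S) x)" using ilt_linear by blast
  then show False
  proof cases
    case 1
    then have "x = y" using ix_inj[OF prefix_closed_pre assms(2,3)] by simp
    then show ?thesis using assms(4) prec_irrefl by simp
  next
    case 2
    then have "y \<prec> x" using assms unfolding ordered_below_def by blast
    then show ?thesis using assms(4) prec_asym by blast
  qed
qed

text \<open>The nodes before \<open>y\<close> form a stage \<open>Q\<close> by induction. The parent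
  of \<open>y\<close> has the index of \<open>y\<close> as its key in \<open>Q\<close>. For another
  candidate \<open>x\<close>, its key is the index of its next child in \<open>S\<close>, which lies
  outside \<open>Q\<close> and so comes after \<open>y\<close>; hence the schedule, too, calls for a
  child of the parent of \<open>y\<close>.\<close>

lemma valid_below:
  assumes S: "infinitary B S" and O: "ordered_below S z"
  shows "y \<in> pre S \<Longrightarrow> y = z \<or> y \<prec> z \<Longrightarrow> valid (code ` {x \<in> pre S. x = y \<or> x \<prec> y})"
proof (induction "code y" arbitrary: y rule: less_induct)
  case less
  let ?N = "pre S"
  have SB: "S \<subseteq> seqs B" using S by (simp add: infinitary_def)
  have sub: "?N \<subseteq> nodes" by (rule pre_mono[OF SB])
  have nil: "[] \<in> ?N" using S by (auto simp: infinitary_def pre_def)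
  show ?case
  proof (cases "y = []")
    case True
    have "{x \<in> ?N. x = [] \<or> x \<prec> []} = {[]}" using nil by (auto simp: prec_def)
    then show ?thesis unfolding True using root by simp
  next
    case False
    define Q where "Q = {x \<in> ?N. x \<prec> y}"
    have Qnil: "[] \<in> Q" using nil False by (simp add: Q_def prec_def)
    have Qsub: "Q \<subseteq> ?N" by (auto simp: Q_def)
    have Qfin: "finite Q" unfolding Q_def by (rule finite_prec_nodes(1)[OF sub])
    have Qpc: "prefix_closed Q"
      unfolding prefix_closed_def
    proof (intro ballI allI impI)
      fix x w assume x: "x \<in> Q" and w: "prefix w x"
      have "w = x \<or> w \<prec> x" using prec_prefix[OF w] by blast
      then have "w \<prec> y" using x prec_trans unfolding Q_def by blast
      then show "w \<in> Q" using x w pre_prefix unfolding Q_def by blast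
    qed
    have ixQ: "ix Q x = ix ?N x" if "x \<in> Q" for x
      by (rule ix_initial[OF sub prefix_closed_pre Qsub that Qpc]) (use prec_trans in \<open>auto simp: Q_def\<close>)
    have vQ: "valid (code ` Q)"
    proof -
      define c where "c = Max (code ` Q)"
      have "c \<in> code ` Q" unfolding c_def using Qfin Qnil by (intro Max_in) auto
      then obtain w where w: "w \<in> Q" "c = code w" by blast
      have wN: "w \<in> ?N" "w \<prec> y" using w(1) by (auto simp: Q_def)
      have "Q = {x \<in> ?N. x = w \<or> x \<prec> w}"
      proof (intro equalityI subsetI)
        fix x assume x: "x \<in> Q"
        then have "code x \<le> code w" unfolding w(2)[symmetric] c_def using Qfin by (intro Max_ge) auto
        then show "x \<in> {x \<in> ?N. x = w \<or> x \<prec> w}"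
          using x code_le[of x w] wN(1) sub by (auto simp: Q_def)
      next
        fix x assume "x \<in> {x \<in> ?N. x = w \<or> x \<prec> w}"
        then show "x \<in> Q" using prec_trans[of x w y] wN(2) by (auto simp: Q_def)
      qed
      moreover have "code w < code y" using code_iso(2)[of w y] wN less.prems(1) sub by blast
      moreover have "w = z \<or> w \<prec> z" using prec_leq_trans[of w y z] wN(2) less.prems(2) by blast
      ultimately show ?thesis using less.hyps[OF _ wN(1)] by simp
    qed
    define p where "p = butlast y"
    define m where "m = last y"
    have y: "y = p @ [m]" using False by (simp add: p_def m_def)
    have pN: "p \<in> ?N" using less.prems(1) by (rule pre_prefix) (simp add: y)
    have "p \<prec> y" by (rule prec_prefix) (simp_all add: y)
    then have pQ: "p \<in> Q" using pN by (simp add: Q_def)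
    have "p \<notin> leaves"
    proof
      assume "p \<in> leaves"
      then have "y \<notin> nodes" unfolding y by (rule pre_not_leaf[OF ubar])
      then show False using less.prems(1) sub by blast
    qed
    then have pQL: "p \<in> Q - leaves" using pQ by simp
    have "children Q p = {k. k < m \<and> p @ [k] \<in> ?N}"
    proof -
      have "p @ [k] \<prec> y \<longleftrightarrow> k < m" if "p @ [k] \<in> ?N" for k
        unfolding y by (rule sibling_less) (use that less.prems(1) sub in \<open>auto simp: y\<close>)
      then show ?thesis by (auto simp: children_def Q_def)
    qed
    then have keyp: "key Q p = ix ?N y" using ixQ[OF pQ] by (simp add: key_def y ix_snoc)
    have "next_parent Q = p"
    proof (rule next_parent_unique[OF Qfin Qnil Qpc pQL])
      fix x assume x: "x \<in> Q - leaves" "x \<noteq> p"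
      let ?X = "children ?N x"
      have "infinite ?X" using x S Qsub unfolding infinitary_def children_def by blast
      define c where "c = card (children Q x)"
      obtain k where k: "k \<in> ?X" "card {i. i < k \<and> i \<in> ?X} = c" using infinite_card_less[OF \<open>infinite ?X\<close>] by blast
      \<comment> \<open>The child of \<open>x\<close> with position \<open>c\<close> in
        \<open>S\<close>, where \<open>c\<close> counts the children of \<open>x\<close> already in
        \<open>Q\<close>.\<close>
      let ?w = "x @ [k]"
      have wN: "?w \<in> ?N" using k(1) by (simp add: children_def)
      have "?w \<notin> Q"
      proof
        assume wQ: "?w \<in> Q"
        have "insert k {i. i < k \<and> i \<in> ?X} \<subseteq> children Q x"
        proof
          fix i assume i: "i \<in> insert k {i. i < k \<and> i \<in> ?X}"
          show "i \<in> children Q x"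
          proof (cases "i = k")
            case True
            then show ?thesis using wQ by (simp add: children_def)
          next
            case False
            then have iN: "x @ [i] \<in> ?N" "i < k" using i by (auto simp: children_def)
            then have "x @ [i] \<prec> ?w" using sibling_less[of x i k] wN sub by blast
            then have "x @ [i] \<prec> y" using wQ prec_trans unfolding Q_def by blast
            then show ?thesis using iN by (simp add: children_def Q_def)
          qed
        qed
        moreover have "finite (children Q x)"
        proof -
          have "(\<lambda>i. x @ [i]) ` children Q x \<subseteq> Q" by (auto simp: children_def)
          then have "finite ((\<lambda>i. x @ [i]) ` children Q x)" using Qfin finite_subset by blast
          then show ?thesis by (simp add: finite_image_iff inj_on_def)
        qed
        ultimately have "card (insert k {i. i < k \<and> i \<in> ?X}) \<le> c" unfolding c_def by (rule card_mono[rotated])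
        then show False using k(2) by simp
      qed
      moreover have "?w \<noteq> y" using x(2) by (auto simp: y)
      ultimately have "y \<prec> ?w" using prec_linear[of y ?w] wN by (auto simp: Q_def)
      then have "ilt (ix ?N y) (ix ?N ?w)" by (rule ordered_belowD[OF O less.prems(1) wN _ less.prems(2)])
      moreover have "key Q x = ix ?N ?w"
        using ixQ[of x] x(1) k(2) by (simp add: key_def ix_snoc c_def children_def)
      ultimately show "ilt (key Q p) (key Q x)" using keyp by simp
    qed
    moreover have "decode ` code ` Q = Q"
    proof -
      have "(decode \<circ> code) ` Q = id ` Q" using Qsub sub by (intro image_cong) auto
      then show ?thesis by (simp add: image_comp)
    qed
    ultimately have "nxt (code ` Q) = code p" by (simp add: nxt_def)
    moreover have "par (code y) = code p" using less.prems(1) sub by (simp add: par_def p_def subset_iff)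
    moreover have "\<And>x. x \<in> code ` Q \<Longrightarrow> x < code y"
      using code_iso(2) less.prems(1) sub by (auto simp: Q_def)
    ultimately have "valid (insert (code y) (code ` Q))" using node[OF vQ] by simp
    moreover have "insert (code y) (code ` Q) = code ` {x \<in> ?N. x = y \<or> x \<prec> y}"
      using less.prems(1) by (auto simp: Q_def)
    ultimately show ?thesis by simp
  qed
qed

text \<open>A node \<open>x\<close> before \<open>z\<close> that is no prefix of \<open>z\<close>
  extends by first children to a leaf still before \<open>z\<close>: the sum of the index is
  unchanged, and appended zeros cannot reverse the lexicographic comparison, as the index of
  \<open>x\<close> is no prefix of that of \<open>z\<close>.\<close>

lemma below_eq_pre:
  assumes S: "infinitary B S" and O: "ordered_below S z" and z: "z \<in> S"
  shows "{x \<in> pre S. x = z \<or> x \<prec> z} = pre {s \<in> S. s = z \<or> s \<prec> z}"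
proof (intro equalityI subsetI)
  fix x assume x: "x \<in> {x \<in> pre S. x = z \<or> x \<prec> z}"
  have zN: "z \<in> pre S" using z by (auto intro: preI)
  show "x \<in> pre {s \<in> S. s = z \<or> s \<prec> z}"
  proof (cases "prefix x z")
    case True
    then show ?thesis using z by (auto intro: preI[of z])
  next
    case False
    then have xz: "x \<prec> z" "x \<in> pre S" using x by auto
    have lt: "ilt (ix (pre S) x) (ix (pre S) z)" by (rule ordered_belowD[OF O xz(2) zN xz(1)]) (use xz in simp)
    obtain s k where s: "s \<in> S" "prefix x s" "ix (pre S) s = ix (pre S) x @ replicate k 0"
      using zero_extension[OF ubar S xz(2)] by blast
    have "\<not> prefix (ix (pre S) x) (ix (pre S) z)"
    proof
      assume p: "prefix (ix (pre S) x) (ix (pre S) z)"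
      have q: "prefix (ix (pre S) (take (length x) z)) (ix (pre S) z)" by (rule ix_prefix) (rule take_is_prefix)
      have "length x \<le> length z" using prefix_length_le[OF p] by simp
      then have "ix (pre S) (take (length x) z) = ix (pre S) x"
        using prefix_length_prefix[OF p q] prefix_length_prefix[OF q p] by (intro prefix_order.antisym) simp_all
      then have "take (length x) z = x"
        by (rule ix_inj[OF prefix_closed_pre pre_prefix[OF zN take_is_prefix] xz(2)])
      then show False using False take_is_prefix by metis
    qed
    then have "ilt (ix (pre S) s) (ix (pre S) z)"
      using lt lex_less_append_right by (auto simp: ilt_def s(3) sum_list_replicate)
    then have "s \<prec> z" using O s(1) zN unfolding ordered_below_def by (auto intro: preI[of s])
    then show ?thesis using s by (auto intro: preI[of s])
  qed
next
  fix x assume "x \<in> pre {s \<in> S. s = z \<or> s \<prec> z}"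
  then obtain s where s: "s \<in> S" "s = z \<or> s \<prec> z" "prefix x s" by (auto elim: preE)
  have "x = s \<or> x \<prec> s" using prec_prefix[OF s(3)] by blast
  then show "x \<in> {x \<in> pre S. x = z \<or> x \<prec> z}"
    using s prec_leq_trans[of x s z] by (auto intro: preI[of s])
qed

lemma domain_space_ordered_below:
  assumes "domain_space B S" "\<And>s. s \<in> S \<Longrightarrow> s = z \<or> s \<prec> z \<Longrightarrow> strict s"
  shows "ordered_below S z"
  unfolding ordered_below_def
proof (intro ballI impI)
  fix x y assume xy: "x \<in> pre S" "y \<in> pre S" "ilt (ix (pre S) x) (ix (pre S) y)" and y: "y = z \<or> y \<prec> z"
  show "x \<prec> y"
  proof (rule domain_space_order[OF ubar assms(1) xy])
    fix t assume "t \<in> S" "t = y \<or> t \<prec> y"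
    then show "strict t" using assms(2) prec_leq_trans[OF _ y] by blast
  qed
qed

lemma branch_ordered_below: "branch N \<Longrightarrow> ordered_below (decode ` N \<inter> leaves) z"
  unfolding ordered_below_def using branch_index_order branch_pre by simp

end

section \<open>Members of the space as sets of codes\<close>

lemma least_elems_image:
  assumes "inj_on f S" "\<And>x y. x \<in> S \<Longrightarrow> y \<in> S \<Longrightarrow> lt (f x) (f y) \<longleftrightarrow> lt' x y"
  shows "least_elems lt k (f ` S) = f ` least_elems lt' k S"
proof -
  have eq: "{b \<in> f ` S. lt b (f x)} = f ` {y \<in> S. lt' y x}" if "x \<in> S" for x
    using assms(2) that by auto
  have "finite {b \<in> f ` S. lt b (f x)} \<longleftrightarrow> finite {y \<in> S. lt' y x}"
    "card {b \<in> f ` S. lt b (f x)} = card {y \<in> S. lt' y x}" if "x \<in> S" for x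
  proof -
    have "inj_on f {y \<in> S. lt' y x}" by (rule inj_on_subset[OF assms(1)]) auto
    then show "finite {b \<in> f ` S. lt b (f x)} \<longleftrightarrow> finite {y \<in> S. lt' y x}"
      "card {b \<in> f ` S. lt b (f x)} = card {y \<in> S. lt' y x}"
      unfolding eq[OF that] by (simp_all add: finite_image_iff card_image)
  qed
  then show ?thesis by (auto simp: least_elems_def)
qed

definition top_nodes :: "nat list set \<Rightarrow> nat list set"
  where "top_nodes M = {x \<in> M. children M x = {}}"

lemma top_nodes_antichain:
  assumes "prefix_closed M" "x \<in> top_nodes M" "y \<in> M" "prefix x y"
  shows "x = y"
proof (rule ccontr)
  assume "x \<noteq> y"
  then obtain m v where "y = x @ m # v" using assms(4) by (metis append_Nil2 neq_Nil_conv prefixE)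
  then have "prefix (x @ [m]) y" by simp
  then have "x @ [m] \<in> M" by (rule prefix_closedD[OF assms(1,3)])
  then show False using assms(2) by (auto simp: top_nodes_def children_def)
qed

lemma pre_top_nodes:
  assumes "finite M" "prefix_closed M"
  shows "pre (top_nodes M) = M"
proof (intro equalityI subsetI)
  fix x assume "x \<in> pre (top_nodes M)"
  then show "x \<in> M" using prefix_closedD[OF assms(2)] by (auto simp: top_nodes_def elim: preE)
next
  fix x assume x: "x \<in> M"
  let ?E = "{y \<in> M. prefix x y}"
  have fin: "finite ?E" "?E \<noteq> {}" using assms(1) x by auto
  define n where "n = Max (length ` ?E)"
  have "n \<in> length ` ?E" unfolding n_def using fin by (intro Max_in) auto
  then obtain y where y: "y \<in> M" "prefix x y" "n = length y" by blast
  have "children M y = {}"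
  proof (rule ccontr)
    assume "children M y \<noteq> {}"
    then obtain m where "y @ [m] \<in> M" by (auto simp: children_def)
    then have "length (y @ [m]) \<in> length ` ?E" using y(2) by (intro imageI) simp
    then have "length (y @ [m]) \<le> n" unfolding n_def using fin by (intro Max_ge) auto
    then show False using y(3) by simp
  qed
  then show "x \<in> pre (top_nodes M)" using y by (auto simp: top_nodes_def intro: preI[of y])
qed

lemma strict_Nil: "strict []"
  by (simp add: strict_def)

lemma strict_snoc: "strict x \<Longrightarrow> max_entry x < m \<Longrightarrow> strict (x @ [m])"
  using max_entry_ge[of _ x] by (fastforce simp: strict_def sorted_wrt_append)

context ubarrier
begin

section \<open>Translating members of the space into codes\<close>

lemma leaf_node: "s \<in> leaves \<Longrightarrow> s \<in> nodes"
  using sub_pre by blast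

lemma code_inj: "x \<in> nodes \<Longrightarrow> y \<in> nodes \<Longrightarrow> code x = code y \<longleftrightarrow> x = y"
  using decode_code by metis

lemma decode_image_code: "M \<subseteq> nodes \<Longrightarrow> decode ` code ` M = M"
  by (force simp: image_image)

lemma prefix_node: "x \<in> nodes \<Longrightarrow> prefix w x \<Longrightarrow> w \<in> nodes"
  by (rule pre_prefix)

lemma prefix_code_le: "x \<in> nodes \<Longrightarrow> prefix w x \<Longrightarrow> code w \<le> code x"
  using code_le[of w x] prec_prefix[of w x] prefix_node by blast

lemma psi_eq: "psi B s = code ` {w. prefix w s \<and> w \<noteq> []}"
proof -
  have "{w. prefix w s \<and> w \<noteq> []} = {take m s | m. 1 \<le> m \<and> m \<le> length s}"
  proof (intro equalityI subsetI)
    fix w assume "w \<in> {w. prefix w s \<and> w \<noteq> []}"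
    then have "w = take (length w) s" "1 \<le> length w" "length w \<le> length s"
      by (auto simp: prefix_def Suc_le_eq)
    then show "w \<in> {take m s | m. 1 \<le> m \<and> m \<le> length s}" by blast
  qed (auto simp: take_is_prefix)
  then show ?thesis unfolding psi_def by auto
qed

lemma finite_psi: "finite (psi B s)"
  by (simp add: psi_def)

lemma psi_mem: "s \<in> nodes \<Longrightarrow> x \<in> nodes \<Longrightarrow> code x \<in> psi B s \<longleftrightarrow> prefix x s \<and> x \<noteq> []"
  unfolding psi_eq using code_inj prefix_node by blast

lemma Max_psi: "s \<in> nodes \<Longrightarrow> s \<noteq> [] \<Longrightarrow> Max (psi B s) = code s"
  by (rule Max_eqI) (auto simp: finite_psi psi_mem, auto simp: psi_eq prefix_code_le)

lemma psi_inj: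
  assumes "x \<in> nodes" "y \<in> nodes" "psi B x = psi B y"
  shows "x = y"
proof -
  have "prefix x y \<or> x = []" using psi_mem[of x x] psi_mem[of y x] assms by auto
  moreover have "prefix y x \<or> y = []" using psi_mem[of y y] psi_mem[of x y] assms by auto
  ultimately show ?thesis by (metis Nil_prefix prefix_order.antisym)
qed

lemma inj_on_psi: "M \<subseteq> nodes \<Longrightarrow> inj_on (psi B) M"
  using psi_inj by (meson inj_onI subsetD)

text \<open>Codes increase along prefixes, so cutting \<open>psi B y\<close> at a number amounts to
  taking the longest prefix of \<open>y\<close> whose code is below it; \<open>[]\<close> stands for
  the empty cut.\<close>

lemma init_seg_psi_iff:
  assumes y: "y \<in> nodes"
  shows "a \<unlhd> psi B y \<longleftrightarrow> (\<exists>x. prefix x y \<and> a = psi B x)"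
proof
  assume "a \<unlhd> psi B y"
  then obtain m where a: "a = psi B y \<inter> {..<m}" using init_seg_finite_iff[OF finite_psi] by blast
  let ?E = "{w. prefix w y \<and> (w = [] \<or> code w < m)}"
  have fin: "finite ?E" by (rule finite_subset[of _ "set (prefixes y)"]) auto
  have "[] \<in> ?E" by simp
  define n where "n = Max (length ` ?E)"
  have "n \<in> length ` ?E" unfolding n_def using fin \<open>[] \<in> ?E\<close> by (intro Max_in) blast+
  then obtain x where x: "x \<in> ?E" "n = length x" by blast
  have xn: "x \<in> nodes" using x(1) prefix_node[OF y] by blast
  have "psi B x = psi B y \<inter> {..<m}"
  proof (intro equalityI subsetI)
    fix k assume "k \<in> psi B x"
    then obtain w where w: "k = code w" "prefix w x" "w \<noteq> []" unfolding psi_eq by blast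
    then have "x \<noteq> []" "prefix w y" using x(1) by auto
    then have "code w < m" using prefix_code_le[OF xn w(2)] x(1) by simp
    then show "k \<in> psi B y \<inter> {..<m}" using w \<open>prefix w y\<close> by (auto simp: psi_eq)
  next
    fix k assume "k \<in> psi B y \<inter> {..<m}"
    then obtain w where w: "k = code w" "prefix w y" "w \<noteq> []" "code w < m" unfolding psi_eq by blast
    then have "length w \<in> length ` ?E" by blast
    then have "length w \<le> length x" unfolding x(2)[symmetric] n_def using fin by (intro Max_ge) auto
    then have "prefix w x" using prefix_length_prefix[OF w(2)] x(1) by blast
    then show "k \<in> psi B x" using w by (auto simp: psi_eq)
  qed
  then show "\<exists>x. prefix x y \<and> a = psi B x" using a x(1) by blast
next
  assume "\<exists>x. prefix x y \<and> a = psi B x"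
  then obtain x where x: "prefix x y" "a = psi B x" by blast
  have xn: "x \<in> nodes" by (rule prefix_node[OF y x(1)])
  have "psi B x = psi B y \<inter> {..<Suc (code x)}"
  proof (intro equalityI subsetI)
    fix k assume "k \<in> psi B x"
    then obtain w where w: "k = code w" "prefix w x" "w \<noteq> []" unfolding psi_eq by blast
    have "prefix w y" using w(2) x(1) by (rule prefix_order.trans)
    then show "k \<in> psi B y \<inter> {..<Suc (code x)}"
      using w prefix_code_le[OF xn w(2)] by (auto simp: psi_eq)
  next
    fix k assume "k \<in> psi B y \<inter> {..<Suc (code x)}"
    then obtain w where w: "k = code w" "prefix w y" "w \<noteq> []" "code w \<le> code x" by (auto simp: psi_eq)
    have "prefix w x \<or> prefix x w" using prefix_same_cases[OF w(2) x(1)] .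
    moreover have "w = x" if "prefix x w"
    proof -
      have "w \<in> nodes" by (rule prefix_node[OF y w(2)])
      then show ?thesis using prefix_code_le[of w x] that w(4) code_inj xn by (metis le_antisym)
    qed
    ultimately show "k \<in> psi B x" using w by (auto simp: psi_eq)
  qed
  then show "a \<unlhd> psi B y" using x(2) init_seg_finite_iff[OF finite_psi] by blast
qed

lemma init_seg_psi: "x \<in> nodes \<Longrightarrow> y \<in> nodes \<Longrightarrow> psi B x \<unlhd> psi B y \<longleftrightarrow> prefix x y"
  using init_seg_psi_iff psi_inj prefix_node by metis

lemma hat_psi:
  assumes "S \<subseteq> nodes"
  shows "hat (psi B ` S) = psi B ` pre S"
proof -
  have "a \<in> hat (psi B ` S) \<longleftrightarrow> (\<exists>y\<in>S. \<exists>x. prefix x y \<and> a = psi B x)" for a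
    using init_seg_psi_iff assms unfolding hat_def by blast
  then show ?thesis unfolding pre_def by blast
qed

lemma pre_leaves: "S \<subseteq> leaves \<Longrightarrow> pre S \<inter> leaves = S"
  using seqs_antichain[OF ubar] sub_pre[of S] by (fastforce elim: preE)

text \<open>A member of the space, or an approximation, is coded by its set of nodes; \<open>0\<close> is the root, which
  \<open>psi\<close> leaves out.\<close>

definition codes :: "nat set set \<Rightarrow> nat set"
  where "codes u = insert 0 (\<Union>u)"

lemma codes_psi: "codes (psi B ` S) = insert 0 (code ` pre S)"
proof -
  have "\<Union>(psi B ` S) = code ` (pre S - {[]})" unfolding psi_eq pre_def by blast
  then show ?thesis by (cases "[] \<in> pre S") (auto simp: codes_def)
qed

lemma decode_codes:
  assumes "S \<subseteq> leaves" "S \<noteq> {}"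
  shows "codes (psi B ` S) = code ` pre S" "decode ` codes (psi B ` S) = pre S"
    "decode ` codes (psi B ` S) \<inter> leaves = S"
proof -
  have "[] \<in> pre S" using assms(2) by (auto simp: pre_def)
  then have "0 \<in> code ` pre S" using code_Nil by force
  then show c: "codes (psi B ` S) = code ` pre S" unfolding codes_psi by (rule insert_absorb)
  show d: "decode ` codes (psi B ` S) = pre S" unfolding c by (rule decode_image_code) (rule pre_mono[OF assms(1)])
  show "decode ` codes (psi B ` S) \<inter> leaves = S" unfolding d by (rule pre_leaves[OF assms(1)])
qed

lemma r_approx_psi:
  assumes "S \<subseteq> leaves"
  shows "r_approx k (psi B ` S) = psi B ` least_elems (\<prec>) k S"
  unfolding r_approx_def
proof (rule least_elems_image)
  show "inj_on (psi B) S" by (rule inj_on_psi) (use assms leaf_node in blast)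
  fix x y assume "x \<in> S" "y \<in> S"
  then have "x \<in> nodes" "y \<in> nodes" "x \<noteq> []" "y \<noteq> []" using assms leaf_node Nil_not_leaf by auto
  then show "Max (psi B x) < Max (psi B y) \<longleftrightarrow> x \<prec> y" by (simp add: Max_psi code_iso(2))
qed

lemma least_elems_below:
  assumes S: "S \<subseteq> nodes" and ne: "least_elems (\<prec>) k S \<noteq> {}"
  obtains z where "z \<in> S" "least_elems (\<prec>) k S = {s \<in> S. s = z \<or> s \<prec> z}"
proof -
  let ?L = "least_elems (\<prec>) k S"
  have down: "y \<in> ?L" if "x \<in> ?L" "y \<in> S" "y \<prec> x" for x y
  proof -
    have "{w \<in> S. w \<prec> y} \<subseteq> {w \<in> S. w \<prec> x}" using that(3) prec_trans by blast
    then show ?thesis using that unfolding least_elems_def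
      by (auto intro: finite_subset dest: card_mono[rotated])
  qed
  have "finite ?L"
  proof (rule ccontr)
    assume "infinite ?L"
    then obtain G where G: "G \<subseteq> ?L" "finite G" "card G = Suc k" by (meson infinite_arbitrarily_large)
    have "Max (code ` G) \<in> code ` G" using G by (intro Max_in) auto
    then obtain g where g: "g \<in> G" "code g = Max (code ` G)" by force
    have "G - {g} \<subseteq> {w \<in> S. w \<prec> g}"
    proof
      fix w assume w: "w \<in> G - {g}"
      then have "w \<in> S" "g \<in> S" using G(1) g(1) by (auto simp: least_elems_def)
      moreover have "code w \<le> code g" unfolding g(2) using w G(2) by (intro Max_ge) auto
      ultimately show "w \<in> {w \<in> S. w \<prec> g}" using code_le[of w g] S w by blast
    qed
    moreover have "finite {w \<in> S. w \<prec> g}" "card {w \<in> S. w \<prec> g} < k"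
      using g(1) G(1) by (auto simp: least_elems_def)
    ultimately have "card (G - {g}) < k" by (meson card_mono le_less_trans)
    then show False using G(2,3) g(1) by simp
  qed
  then have "Max (code ` ?L) \<in> code ` ?L" using ne by (intro Max_in) auto
  then obtain z where z: "z \<in> ?L" "code z = Max (code ` ?L)" by force
  have zS: "z \<in> S" using z(1) by (simp add: least_elems_def)
  have "?L = {s \<in> S. s = z \<or> s \<prec> z}"
  proof (intro equalityI subsetI)
    fix s assume s: "s \<in> ?L"
    then have "s \<in> S" by (simp add: least_elems_def)
    moreover have "code s \<le> code z" unfolding z(2) using s \<open>finite ?L\<close> by (intro Max_ge) auto
    ultimately show "s \<in> {s \<in> S. s = z \<or> s \<prec> z}" using code_le[of s z] S zS by blast
  qed (use z(1) down in auto)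
  then show ?thesis using that zS by blast
qed

lemma least_elems_initial:
  assumes "finite T" "S \<subseteq> T" "\<And>s t. s \<in> S \<Longrightarrow> t \<in> T - S \<Longrightarrow> s \<prec> t"
  shows "least_elems (\<prec>) (card S) T = S"
proof (intro equalityI subsetI)
  fix x assume x: "x \<in> least_elems (\<prec>) (card S) T"
  show "x \<in> S"
  proof (rule ccontr)
    assume "x \<notin> S"
    then have "S \<subseteq> {y \<in> T. y \<prec> x}" using assms(2,3) x by (auto simp: least_elems_def)
    then have "card S \<le> card {y \<in> T. y \<prec> x}" using assms(1) by (intro card_mono) auto
    then show False using x by (simp add: least_elems_def)
  qed
next
  fix x assume x: "x \<in> S"
  have "{y \<in> T. y \<prec> x} \<subseteq> S - {x}"
    using assms(3)[OF x] prec_asym prec_irrefl by blast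
  then have "card {y \<in> T. y \<prec> x} < card S"
    using assms(1,2) x by (meson card_Diff1_less card_mono finite_Diff finite_subset le_less_trans)
  then show "x \<in> least_elems (\<prec>) (card S) T" using assms x by (auto simp: least_elems_def)
qed

lemma domain_space_leaves: "domain_space B S \<Longrightarrow> S \<subseteq> leaves"
  using domain_space_infinitary[OF ubar] by (simp add: infinitary_def)

lemma AE_cases:
  assumes "u \<in> AE B" "u \<noteq> {}"
  obtains S z where "domain_space B S" "z \<in> S" "u = psi B ` {s \<in> S. s = z \<or> s \<prec> z}"
    "finite {s \<in> S. s = z \<or> s \<prec> z}" "{s \<in> S. s = z \<or> s \<prec> z} \<noteq> {}" "{s \<in> S. s = z \<or> s \<prec> z} \<subseteq> leaves"
proof -
  obtain k S where S: "u = r_approx k (psi B ` S)" "domain_space B S"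
    using assms(1) by (auto simp: AE_def E_space_def)
  have SL: "S \<subseteq> leaves" by (rule domain_space_leaves[OF S(2)])
  then have SN: "S \<subseteq> nodes" using leaf_node by blast
  have u: "u = psi B ` least_elems (\<prec>) k S" using S(1) r_approx_psi[OF SL] by simp
  then have "least_elems (\<prec>) k S \<noteq> {}" using assms(2) by auto
  then obtain z where z: "z \<in> S" "least_elems (\<prec>) k S = {s \<in> S. s = z \<or> s \<prec> z}"
    using least_elems_below[OF SN] by blast
  have "finite {s \<in> S. s = z \<or> s \<prec> z}" by (rule finite_prec_nodes(2)[OF SN]) (use z(1) SN in blast)
  then show ?thesis using that[OF S(2) z(1)] u z SL by auto
qed

lemma codes_below:
  assumes "infinitary B S" "ordered_below S z" "z \<in> S"
  shows "codes (psi B ` {s \<in> S. s = z \<or> s \<prec> z}) = code ` {x \<in> pre S. x = z \<or> x \<prec> z}"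
proof -
  have "S \<subseteq> leaves" using assms(1) by (simp add: infinitary_def)
  then have "{s \<in> S. s = z \<or> s \<prec> z} \<subseteq> leaves" "{s \<in> S. s = z \<or> s \<prec> z} \<noteq> {}" using assms(3) by auto
  then show ?thesis using decode_codes(1) below_eq_pre[OF assms] by simp
qed

text \<open>The nodes of \<open>u\<close> include all leaves of \<open>S\<close> up to the last leaf
  \<open>z\<close> of \<open>u\<close>. Their strictness is just what makes the two orders agree up
  to \<open>z\<close>, and \<open>valid_below\<close> applies.\<close>

lemma valid_codes:
  assumes "u \<in> AE B" "u \<noteq> {}" "\<And>x. x \<in> decode ` codes u \<Longrightarrow> strict x"
  shows "valid (codes u)"
proof -
  obtain S z where S: "domain_space B S" "z \<in> S" and u: "u = psi B ` {s \<in> S. s = z \<or> s \<prec> z}"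
    and L: "{s \<in> S. s = z \<or> s \<prec> z} \<noteq> {}" "{s \<in> S. s = z \<or> s \<prec> z} \<subseteq> leaves"
    by (rule AE_cases[OF assms(1,2)])
  have T: "infinitary B S" by (rule domain_space_infinitary[OF ubar S(1)])
  have "ordered_below S z"
  proof (rule domain_space_ordered_below[OF S(1)])
    fix s assume "s \<in> S" "s = z \<or> s \<prec> z"
    then have "s \<in> {s \<in> S. s = z \<or> s \<prec> z}" by simp
    then have "s \<in> decode ` codes u" unfolding u decode_codes(2)[OF L(2,1)] by (rule subsetD[OF sub_pre])
    then show "strict s" by (rule assms(3))
  qed
  note O = this
  have "codes u = code ` {x \<in> pre S. x = z \<or> x \<prec> z}" unfolding u by (rule codes_below[OF T O S(2)])
  moreover have "z \<in> pre S" using S(2) sub_pre by blast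
  ultimately show ?thesis using valid_below[OF T O, of z] by simp
qed

text \<open>The leaves among the decoded codes give back the members of the approximation.\<close>

lemma codes_inj:
  assumes "u \<in> AE B" "v \<in> AE B" "u \<noteq> {}" "v \<noteq> {}" "codes u = codes v"
  shows "u = v"
proof -
  have rec: "u = psi B ` (decode ` codes u \<inter> leaves)" if u: "u \<in> AE B" "u \<noteq> {}" for u
  proof -
    obtain S z where "u = psi B ` {s \<in> S. s = z \<or> s \<prec> z}"
      and "{s \<in> S. s = z \<or> s \<prec> z} \<noteq> {}" "{s \<in> S. s = z \<or> s \<prec> z} \<subseteq> leaves"
      by (rule AE_cases[OF u])
    then show ?thesis using decode_codes(3) by simp
  qed
  show ?thesis using rec[OF assms(1,3)] rec[OF assms(2,4)] assms(5) by simp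
qed

lemma prefix_closed_decode:
  assumes "\<And>y. y \<in> K \<Longrightarrow> y \<noteq> 0 \<Longrightarrow> par y \<in> K"
  shows "prefix_closed (decode ` K)"
proof -
  have "w \<in> decode ` K" if "x \<in> decode ` K" "prefix w x" for x w
    using that
  proof (induction x rule: rev_induct)
    case (snoc m x)
    then obtain n where n: "n \<in> K" "decode n = x @ [m]" by (metis imageE)
    then have "n \<noteq> 0" by (metis decode_0 snoc_eq_iff_butlast)
    then have "decode n = decode (par n) @ [last (decode n)]" by (intro decode_par) simp
    then have "x = decode (par n)" using n(2) by simp
    then have "x \<in> decode ` K" using assms[OF n(1) \<open>n \<noteq> 0\<close>] by simp
    then show ?case using snoc n by auto
  qed auto
  then show ?thesis unfolding prefix_closed_def by blast
qed

end

section \<open>Fronts and meets in terms of codes\<close>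

lemma front_exists: "front B V F \<Longrightarrow> Y \<in> E_space B \<Longrightarrow> Y \<subseteq> V \<Longrightarrow> \<exists>u\<in>F. \<exists>n. u = r_approx n Y"
  by (simp add: front_def)

lemma front_AE: "front B V F \<Longrightarrow> u \<in> F \<Longrightarrow> u \<in> AE B"
  by (auto simp: front_def)

lemma front_antichain: "front B V F \<Longrightarrow> u \<in> F \<Longrightarrow> r_approx m u \<in> F \<Longrightarrow> r_approx m u = u"
  unfolding front_def by metis

context ubarrier
begin

lemma codes_finite_psi:
  assumes "u \<in> AE B" "u \<noteq> {}"
  obtains S where "S \<subseteq> leaves" "S \<noteq> {}" "finite S" "u = psi B ` S" "codes u = code ` pre S"
    "decode ` codes u = pre S"
proof -
  obtain S z where "u = psi B ` {s \<in> S. s = z \<or> s \<prec> z}" "finite {s \<in> S. s = z \<or> s \<prec> z}"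
    and L: "{s \<in> S. s = z \<or> s \<prec> z} \<noteq> {}" "{s \<in> S. s = z \<or> s \<prec> z} \<subseteq> leaves"
    by (rule AE_cases[OF assms])
  then show ?thesis using that[OF L(2,1)] decode_codes[OF L(2,1)] by simp
qed

lemma codes_initial:
  assumes u: "u \<in> AE B" "u \<noteq> {}" and v: "v \<in> AE B" "v \<noteq> {}" and initial: "initial (codes u) (codes v)"
  shows "\<exists>m. u = r_approx m v"
proof -
  obtain S where S: "S \<subseteq> leaves" "S \<noteq> {}" "finite S" "u = psi B ` S" "codes u = code ` pre S"
    "decode ` codes u = pre S" by (rule codes_finite_psi[OF u])
  obtain T where T: "T \<subseteq> leaves" "T \<noteq> {}" "finite T" "v = psi B ` T" "codes v = code ` pre T"
    "decode ` codes v = pre T" by (rule codes_finite_psi[OF v])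
  have mem: "s \<in> S \<longleftrightarrow> code s \<in> codes u" "s \<in> T \<longleftrightarrow> code s \<in> codes v" if "s \<in> leaves" for s
  proof -
    have 1: "s \<in> A \<longleftrightarrow> code s \<in> code ` pre A" if "A \<subseteq> leaves" for A
    proof -
      have "s \<in> A \<longleftrightarrow> s \<in> pre A" using pre_leaves[OF that] \<open>s \<in> leaves\<close> by blast
      also have "\<dots> \<longleftrightarrow> code s \<in> code ` pre A"
        using code_inj[OF leaf_node[OF \<open>s \<in> leaves\<close>]] pre_mono[OF that] by (auto simp: image_iff)
      finally show ?thesis .
    qed
    show "s \<in> S \<longleftrightarrow> code s \<in> codes u" "s \<in> T \<longleftrightarrow> code s \<in> codes v"
      using 1[OF S(1)] 1[OF T(1)] S(5) T(5) by simp_all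
  qed
  have ST: "S \<subseteq> T"
  proof
    fix s assume s: "s \<in> S"
    then have l: "s \<in> leaves" using S(1) by blast
    then have "code s \<in> codes v" using mem(1)[OF l] s initial by (auto simp: initial_def)
    then show "s \<in> T" using mem(2)[OF l] by simp
  qed
  have lt: "s \<prec> t" if s: "s \<in> S" and t: "t \<in> T - S" for s t
  proof -
    have l: "s \<in> leaves" "t \<in> leaves" using s t S(1) T(1) by auto
    then have "code t \<in> codes v - codes u" "code s \<in> codes u" using mem s t by auto
    then have "code s < code t" using initial by (auto simp: initial_def)
    then show ?thesis using code_iso(2) leaf_node l by blast
  qed
  have "r_approx (card S) v = psi B ` least_elems (\<prec>) (card S) T"
    unfolding T(4) by (rule r_approx_psi[OF T(1)])
  also have "least_elems (\<prec>) (card S) T = S" by (rule least_elems_initial[OF T(3) ST lt])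
  also have "psi B ` S = u" by (rule S(4)[symmetric])
  finally show ?thesis by metis
qed

lemma branch_approx:
  assumes N: "branch N" and u: "u = r_approx n (psi B ` (decode ` N \<inter> leaves))" "u \<noteq> {}"
  shows "\<exists>m. codes u = N \<inter> {..m}"
proof -
  let ?S = "decode ` N \<inter> leaves"
  have SL: "?S \<subseteq> leaves" by simp
  have SN: "?S \<subseteq> nodes" by auto
  have u': "u = psi B ` least_elems (\<prec>) n ?S" unfolding u(1) by (rule r_approx_psi[OF SL])
  then have "least_elems (\<prec>) n ?S \<noteq> {}" using u(2) by auto
  then obtain z where z: "z \<in> ?S" "least_elems (\<prec>) n ?S = {s \<in> ?S. s = z \<or> s \<prec> z}"
    using least_elems_below[OF SN] by blast
  have "codes u = code ` {x \<in> pre ?S. x = z \<or> x \<prec> z}"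
    unfolding u' z(2) by (rule codes_below[OF branch_infinitary[OF N] branch_ordered_below[OF N] z(1)])
  also have "\<dots> = code ` {x \<in> decode ` N. x = z \<or> x \<prec> z}" unfolding branch_pre[OF N] by (rule refl)
  also have "\<dots> = N \<inter> {..code z}"
  proof -
    have zn: "z \<in> nodes" using z(1) by auto
    have "decode k = z \<or> decode k \<prec> z \<longleftrightarrow> k \<le> code z" for k
      using code_le[OF decode_node[of k] zn] by simp
    then have "{x \<in> decode ` N. x = z \<or> x \<prec> z} = decode ` (N \<inter> {..code z})" by auto
    then show ?thesis by (simp add: image_image)
  qed
  finally show ?thesis by blast
qed

lemma restrict_codes:
  assumes N: "branch N" and u: "u \<in> AE B" "u \<noteq> {}"
  shows "u \<subseteq> psi B ` (decode ` N \<inter> leaves) \<longleftrightarrow> codes u \<subseteq> N"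
proof -
  obtain S where S: "S \<subseteq> leaves" "S \<noteq> {}" "finite S" "u = psi B ` S" "codes u = code ` pre S"
    "decode ` codes u = pre S" by (rule codes_finite_psi[OF u])
  let ?S = "decode ` N \<inter> leaves"
  show ?thesis
  proof
    assume "u \<subseteq> psi B ` ?S"
    have "S \<subseteq> ?S"
    proof
      fix s assume s: "s \<in> S"
      then obtain t where t: "t \<in> ?S" "psi B s = psi B t" using \<open>u \<subseteq> psi B ` ?S\<close> S(4) by blast
      then have "s = t" using psi_inj[of s t] s S(1) leaf_node by auto
      then show "s \<in> ?S" using t(1) by simp
    qed
    then have "pre S \<subseteq> decode ` N" using pre_mono[of S ?S] branch_pre[OF N] by simp
    then have "code ` pre S \<subseteq> code ` decode ` N" by (rule image_mono)
    then show "codes u \<subseteq> N" unfolding S(5) by (simp add: image_image)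
  next
    assume "codes u \<subseteq> N"
    then have "decode ` codes u \<subseteq> decode ` N" by (rule image_mono)
    then have "S \<subseteq> ?S" using S(1,6) sub_pre[of S] by blast
    then show "u \<subseteq> psi B ` ?S" unfolding S(4) by (rule image_mono)
  qed
qed

lemma hat_codes:
  assumes "u \<in> AE B" "u \<noteq> {}"
  shows "hat u = psi B ` decode ` codes u"
proof -
  obtain S where S: "S \<subseteq> leaves" "S \<noteq> {}" "finite S" "u = psi B ` S" "codes u = code ` pre S"
    "decode ` codes u = pre S" by (rule codes_finite_psi[OF assms])
  have "S \<subseteq> nodes" using S(1) leaf_node by blast
  then show ?thesis unfolding S(6) unfolding S(4) by (rule hat_psi)
qed

text \<open>\<open>psi\<close> carries prefixes to initial segments, so the maximal common initial
  segments are the images of the childless nodes in the common subtree.\<close>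

lemma meet_codes:
  assumes "u \<in> AE B" "u \<noteq> {}" "v \<in> AE B" "v \<noteq> {}" and pc: "prefix_closed (decode ` (codes u \<inter> codes v))"
  shows "meet u v = psi B ` top_nodes (decode ` (codes u \<inter> codes v))"
proof -
  let ?M = "decode ` (codes u \<inter> codes v)"
  have "inj_on decode UNIV" by (metis code_decode inj_onI)
  then have dM: "decode ` codes u \<inter> decode ` codes v = ?M" by (simp add: image_Int)
  have hat: "hat u \<inter> hat v = psi B ` ?M"
    unfolding hat_codes[OF assms(1,2)] hat_codes[OF assms(3,4)] dM[symmetric]
    by (rule inj_on_image_Int[OF inj_on_psi[OF order_refl], symmetric]) auto
  have "(\<forall>b\<in>psi B ` ?M. psi B x \<unlhd> b \<longrightarrow> psi B x = b) \<longleftrightarrow> x \<in> top_nodes ?M" if x: "x \<in> ?M" for x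
  proof
    assume max: "\<forall>b\<in>psi B ` ?M. psi B x \<unlhd> b \<longrightarrow> psi B x = b"
    have "children ?M x = {}"
    proof (rule ccontr)
      assume "children ?M x \<noteq> {}"
      then obtain m where m: "x @ [m] \<in> ?M" by (auto simp: children_def)
      have n: "x \<in> nodes" "x @ [m] \<in> nodes" using x m by auto
      then have "psi B x \<unlhd> psi B (x @ [m])" using init_seg_psi by simp
      then have "psi B x = psi B (x @ [m])" using max m by blast
      then show False using psi_inj[OF n] by simp
    qed
    then show "x \<in> top_nodes ?M" using x by (simp add: top_nodes_def)
  next
    assume t: "x \<in> top_nodes ?M"
    show "\<forall>b\<in>psi B ` ?M. psi B x \<unlhd> b \<longrightarrow> psi B x = b"
    proof (intro ballI impI)
      fix b assume "b \<in> psi B ` ?M" "psi B x \<unlhd> b"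
      then obtain y where y: "y \<in> ?M" "b = psi B y" "psi B x \<unlhd> psi B y" by blast
      have "x \<in> nodes" "y \<in> nodes" using x y(1) by auto
      then have "prefix x y" using y(3) init_seg_psi by blast
      then show "psi B x = b" using top_nodes_antichain[OF pc t y(1)] y(2) by simp
    qed
  qed
  note iff = this
  have "top_nodes ?M \<subseteq> ?M" by (auto simp: top_nodes_def)
  show ?thesis
  proof (intro equalityI subsetI)
    fix a assume a: "a \<in> meet u v"
    then have "a \<in> psi B ` ?M" and max: "\<forall>b\<in>psi B ` ?M. a \<unlhd> b \<longrightarrow> a = b"
      unfolding meet_def hat by simp_all
    then obtain x where x: "x \<in> ?M" "a = psi B x" by blast
    have "x \<in> top_nodes ?M" using iff[OF x(1)] max x(2) by simp
    then show "a \<in> psi B ` top_nodes ?M" using x(2) by blast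
  next
    fix a assume "a \<in> psi B ` top_nodes ?M"
    then obtain x where x: "x \<in> top_nodes ?M" "a = psi B x" by blast
    then have "x \<in> ?M" using \<open>top_nodes ?M \<subseteq> ?M\<close> by blast
    then have "a \<in> psi B ` ?M" "\<forall>b\<in>psi B ` ?M. a \<unlhd> b \<longrightarrow> a = b" using iff[of x] x by simp_all
    then show "a \<in> meet u v" unfolding meet_def hat by simp
  qed
qed

text \<open>Children of nodes outside \<open>NV\<close> are kept, since \<open>cond\<close> asks for infinitely many children of every
  possible parent.\<close>

definition base :: "nat list set \<Rightarrow> nat set"
  where "base NV = {n. (strict (decode (par n)) \<longrightarrow> strict (decode n)) \<and>
    (decode (par n) \<in> NV \<longrightarrow> decode n \<in> NV)}"

lemma par_0: "par 0 = 0"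
  by (simp add: par_def)

lemma zero_base: "0 \<in> base NV"
  by (simp add: base_def par_0)

text \<open>Children with entries beyond \<open>max_entry\<close> of the parent preserve strictness.
  Infinitely many of them remain, both among all children and among those in \<open>pre SV\<close>,
  since inner nodes there branch infinitely.\<close>

lemma cond_base:
  assumes "infinitary B SV"
  shows "cond (base (pre SV))"
  unfolding cond_def
proof (intro allI impI)
  fix P assume "valid P"
  then have x: "decode (nxt P) \<in> nodes - leaves" using valid_nxt(2) by auto
  define x where "x = decode (nxt P)"
  define X where "X = (if x \<in> pre SV then children (pre SV) x else UNIV) \<inter> {max_entry x<..}"
  have "infinite (if x \<in> pre SV then children (pre SV) x else UNIV)"
    using assms x unfolding infinitary_def children_def x_def by auto
  moreover have "(if x \<in> pre SV then children (pre SV) x else UNIV) \<subseteq> X \<union> {..max_entry x}" by (auto simp: X_def)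
  ultimately have X: "infinite X" by (meson finite_UnI finite_atMost finite_subset)
  have node: "x @ [m] \<in> nodes" if "m \<in> X" for m
  proof (rule child_node)
    show "x \<in> nodes - leaves" using x by (simp add: x_def)
    show "e \<le> m" if "e \<in> set x" for e using max_entry_ge[OF that] \<open>m \<in> X\<close> by (simp add: X_def)
  qed
  have "(\<lambda>m. code (x @ [m])) ` X \<subseteq> {y \<in> base (pre SV). par y = nxt P}"
  proof
    fix y assume "y \<in> (\<lambda>m. code (x @ [m])) ` X"
    then obtain m where m: "m \<in> X" "y = code (x @ [m])" by blast
    have d: "decode y = x @ [m]" using node[OF m(1)] m(2) by simp
    then have p: "par y = nxt P" by (simp add: par_def x_def)
    have "strict x \<longrightarrow> strict (x @ [m])" using strict_snoc m(1) by (auto simp: X_def)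
    moreover have "x \<in> pre SV \<longrightarrow> x @ [m] \<in> pre SV" using m(1) by (auto simp: X_def children_def)
    ultimately show "y \<in> {y \<in> base (pre SV). par y = nxt P}"
      using p d by (simp add: base_def x_def)
  qed
  moreover have "inj_on (\<lambda>m. code (x @ [m])) X"
  proof (rule inj_onI)
    fix m m' assume "m \<in> X" "m' \<in> X" "code (x @ [m]) = code (x @ [m'])"
    then show "m = m'" using code_inj[OF node node] by simp
  qed
  ultimately show "infinite {y \<in> base (pre SV). par y = nxt P}"
    using X by (meson finite_imageD finite_subset)
qed

lemma base_nodes:
  assumes "prefix_closed (decode ` P)" "P \<subseteq> base NV" "[] \<in> NV" "x \<in> decode ` P"
  shows "strict x \<and> x \<in> NV"
  using assms(4)
proof (induction x rule: rev_induct)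
  case Nil
  then show ?case using assms(3) strict_Nil by simp
next
  case (snoc m x)
  then obtain n where n: "n \<in> P" "decode n = x @ [m]" by (metis imageE)
  have "x \<in> decode ` P" by (rule prefix_closedD[OF assms(1) snoc.prems]) simp
  then have "strict x" "x \<in> NV" using snoc.IH by auto
  moreover have "x \<in> nodes" using \<open>x \<in> decode ` P\<close> by auto
  then have "decode (par n) = x" using n(2) by (simp add: par_def)
  ultimately show ?case using n assms(2) by (auto simp: base_def)
qed

lemma prefix_closed_codes: "u \<in> AE B \<Longrightarrow> u \<noteq> {} \<Longrightarrow> prefix_closed (decode ` codes u)"
  by (rule codes_finite_psi) (auto simp: prefix_closed_pre)

section \<open>The canonical form on a subspace\<close>

lemma front_restrict:
  assumes "front B V F" "W \<subseteq> V"
  shows "front B W (restrict_to F W)"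
proof -
  have "\<exists>u\<in>restrict_to F W. \<exists>n. u = r_approx n Y" if Y: "Y \<in> E_space B" "Y \<subseteq> W" for Y
  proof -
    have "Y \<subseteq> V" using Y(2) assms(2) by blast
    then obtain u n where u: "u \<in> F" "u = r_approx n Y" using front_exists[OF assms(1) Y(1)] by blast
    have "u \<subseteq> W" using u(2) Y(2) by (auto simp: r_approx_def least_elems_def)
    then show ?thesis using u by (auto simp: restrict_to_def)
  qed
  moreover have "restrict_to F W \<subseteq> AE B" using front_AE[OF assms(1)] by (auto simp: restrict_to_def)
  moreover have "v \<noteq> r_approx m u" if "u \<in> restrict_to F W" "v \<in> restrict_to F W" "u \<noteq> v" for u v m
    using front_antichain[OF assms(1), of u m] that by (auto simp: restrict_to_def)
  ultimately show ?thesis unfolding front_def by simp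
qed

lemma canonical_front:
  assumes V: "V \<in> E_space B" and F: "front B V F" and R: "equiv F R" and ne: "{} \<notin> F"
  shows "\<exists>W\<in>E_space B. W \<subseteq> V \<and> canonical_on B W (restrict_to F W) R"
proof -
  from V obtain SV where SV: "V = psi B ` SV" "domain_space B SV" by (auto simp: E_space_def)
  have T: "infinitary B SV" by (rule domain_space_infinitary[OF ubar SV(2)])
  have SVL: "SV \<subseteq> leaves" by (rule domain_space_leaves[OF SV(2)])
  have nil: "[] \<in> pre SV" using T by (auto simp: infinitary_def pre_def)
  \<comment> \<open>Stages inside \<open>A0\<close> consist of strict nodes of \<open>V\<close>:
    strictness makes the codes of approximations valid, and membership keeps branches within
    \<open>V\<close>.\<close>
  define A0 where "A0 = base (pre SV)"
  define F1 where "F1 = {u \<in> F. codes u \<subseteq> A0}"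
  define F' where "F' = codes ` F1"
  define R' where "R' = {(codes u, codes v) | u v. u \<in> F1 \<and> v \<in> F1 \<and> (u, v) \<in> R}"
  have FA: "u \<in> AE B" "u \<noteq> {}" if "u \<in> F" for u using front_AE[OF F that] ne that by auto
  have F1F: "u \<in> F" if "u \<in> F1" for u using that by (simp add: F1_def)
  have inj: "u = v" if "u \<in> F1" "v \<in> F1" "codes u = codes v" for u v
    using codes_inj[OF FA(1)[OF F1F] FA(1)[OF F1F] FA(2)[OF F1F] FA(2)[OF F1F]] that by blast
  have R'iff: "(codes u, codes v) \<in> R' \<longleftrightarrow> (u, v) \<in> R" if "u \<in> F1" "v \<in> F1" for u v
    using inj that unfolding R'_def by blast
  have in_A0: "codes u \<in> F'" "u \<in> F1" if "u \<in> F" "codes u \<subseteq> A0" for u using that by (auto simp: F'_def F1_def)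
  have branch_sub: "psi B ` (decode ` N \<inter> leaves) \<subseteq> V" if N: "branch N" "N \<subseteq> A0" for N
  proof -
    have "decode ` N \<subseteq> pre SV"
      using base_nodes[OF branch_init(5)[OF N(1)] _ nil] N(2) unfolding A0_def by blast
    then have "decode ` N \<inter> leaves \<subseteq> SV" using pre_leaves[OF SVL] by blast
    then show ?thesis unfolding SV(1) by (rule image_mono)
  qed
  have branch_E: "psi B ` (decode ` N \<inter> leaves) \<in> E_space B" if "branch N" for N
    using branch_domain_space[OF that] unfolding E_space_def by blast
  have fr: "front_relation par nxt F' A0 R'"
  proof
    show "nxt P \<in> P" if "valid P" for P by (rule valid_nxt(1)[OF that])
    show "cond A0" unfolding A0_def by (rule cond_base[OF T])
    show "0 \<in> A0" unfolding A0_def by (rule zero_base)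
    show "valid p" if p: "p \<in> F'" for p
    proof -
      obtain u where u: "p = codes u" "u \<in> F" "codes u \<subseteq> A0" using p by (auto simp: F'_def F1_def)
      show ?thesis unfolding u(1)
      proof (rule valid_codes[OF FA[OF u(2)]])
        fix x assume "x \<in> decode ` codes u"
        then show "strict x"
          using base_nodes[OF prefix_closed_codes[OF FA[OF u(2)]] _ nil] u(3) unfolding A0_def by blast
      qed
    qed
    show "p \<subseteq> A0" if "p \<in> F'" for p using that by (auto simp: F'_def F1_def)
    show "p = q" if pq: "p \<in> F'" "q \<in> F'" "initial p q" for p q
    proof -
      obtain u v where uv: "p = codes u" "u \<in> F" "q = codes v" "v \<in> F" using pq by (auto simp: F'_def F1_def)
      have "\<exists>m. u = r_approx m v" by (rule codes_initial[OF FA[OF uv(2)] FA[OF uv(4)]]) (use pq(3) uv in simp)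
      then have "u = v" using front_antichain[OF F uv(4)] uv(2) by auto
      then show ?thesis using uv by simp
    qed
    show "\<exists>m. N \<inter> {..m} \<in> F'" if N: "branch N" "N \<subseteq> A0" for N
    proof -
      obtain u n where u: "u \<in> F" "u = r_approx n (psi B ` (decode ` N \<inter> leaves))"
        using front_exists[OF F branch_E[OF N(1)] branch_sub[OF N]] by blast
      obtain m where m: "codes u = N \<inter> {..m}" using branch_approx[OF N(1) u(2) FA(2)[OF u(1)]] by blast
      then have "codes u \<subseteq> A0" using N(2) by blast
      then have "codes u \<in> F'" using in_A0 u(1) by blast
      then show ?thesis using m by auto
    qed
    show "equiv F' R'"
    proof (rule equivI)
      show "R' \<subseteq> F' \<times> F'" by (auto simp: R'_def F'_def)
      show "refl_on F' R'"
        unfolding refl_on_def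
      proof
        fix p assume "p \<in> F'"
        then obtain u where u: "u \<in> F1" "p = codes u" by (auto simp: F'_def)
        then have "(u, u) \<in> R" using R F1F by (meson equivE refl_onD)
        then show "(p, p) \<in> R'" using R'iff[OF u(1,1)] u(2) by simp
      qed
      show "sym R'"
      proof (rule symI)
        fix p q assume "(p, q) \<in> R'"
        then obtain u v where *: "u \<in> F1" "v \<in> F1" "(u, v) \<in> R" "p = codes u" "q = codes v"
          unfolding R'_def by blast
        then have "(v, u) \<in> R" using R by (meson equivE symD)
        then show "(q, p) \<in> R'" using R'iff * by simp
      qed
      show "trans R'"
      proof (rule transI)
        fix p q r assume "(p, q) \<in> R'" "(q, r) \<in> R'"
        then obtain u v v' w where *: "u \<in> F1" "v \<in> F1" "v' \<in> F1" "w \<in> F1" "(u, v) \<in> R" "(v', w) \<in> R"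
          "p = codes u" "q = codes v" "q = codes v'" "r = codes w" unfolding R'_def by blast
        then have "v = v'" using inj by simp
        then have "(u, w) \<in> R" using * R by (meson equivE transD)
        then show "(p, r) \<in> R'" using R'iff * by simp
      qed
    qed
  qed
  obtain A K where A: "A \<subseteq> A0" "cond A" and K': "\<forall>p\<in>F'. 0 \<in> K p \<and> K p \<subseteq> p"
    and KR': "\<forall>p\<in>F'. \<forall>q\<in>F'. p \<subseteq> insert 0 A \<longrightarrow> q \<subseteq> insert 0 A \<longrightarrow> ((p, q) \<in> R' \<longleftrightarrow> K p = K q)"
    and sparse': "\<forall>X\<subseteq>A. cond X \<longrightarrow> (\<exists>Y\<subseteq>X. cond Y \<and> (\<forall>p\<in>F'. p \<subseteq> insert 0 Y \<longrightarrow>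
      (\<exists>q\<in>F'. q \<subseteq> insert 0 X \<and> K q = K p \<and> p \<inter> q = K p) \<and>
      (\<forall>y\<in>K p. y \<noteq> 0 \<longrightarrow> par y \<in> K p)))"
    using front_relation.canonical_kernel[OF fr] by (elim exE conjE) (rule that)
  have K: "0 \<in> K p \<and> K p \<subseteq> p" if "p \<in> F'" for p using K' that by simp
  have KR: "(p, q) \<in> R' \<longleftrightarrow> K p = K q"
    if "p \<in> F'" "q \<in> F'" "p \<subseteq> insert 0 A" "q \<subseteq> insert 0 A" for p q using KR' that by simp
  have sparse: "\<exists>Y\<subseteq>X. cond Y \<and> (\<forall>p\<in>F'. p \<subseteq> insert 0 Y \<longrightarrow>
      (\<exists>q\<in>F'. q \<subseteq> insert 0 X \<and> K q = K p \<and> p \<inter> q = K p) \<and>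
      (\<forall>y\<in>K p. y \<noteq> 0 \<longrightarrow> par y \<in> K p))" if "X \<subseteq> A" "cond X" for X
    using sparse' that by simp
  \<comment> \<open>The map has to be a projection determining the kernel on all of
    \<open>W\<close>, so kernels must be subtrees there already, before \<open>Y\<close> is
    chosen.\<close>
  obtain A2 where A2: "A2 \<subseteq> A" "cond A2" and
    closed': "\<forall>p\<in>F'. p \<subseteq> insert 0 A2 \<longrightarrow>
      (\<exists>q\<in>F'. q \<subseteq> insert 0 A \<and> K q = K p \<and> p \<inter> q = K p) \<and> (\<forall>y\<in>K p. y \<noteq> 0 \<longrightarrow> par y \<in> K p)"
    using sparse[OF order_refl A(2)] by (elim exE conjE) (rule that)
  have closed: "par y \<in> K p" if "p \<in> F'" "p \<subseteq> insert 0 A2" "y \<in> K p" "y \<noteq> 0" for p y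
    using closed' that by simp
  have A20: "insert 0 A2 \<subseteq> A0" using A2(1) A(1) zero_base by (auto simp: A0_def)
  obtain N1 where N1: "N1 \<subseteq> insert 0 A2" "branch N1" using cond_branch[OF A2(2)] by blast
  define W where "W = psi B ` (decode ` N1 \<inter> leaves)"
  \<comment> \<open>The partner of \<open>u\<close> must belong to the front restricted to
    \<open>W\<close>. Children of nodes of \<open>N1\<close> are kept only if they are in
    \<open>N1\<close>, so a stage inside \<open>A3\<close> cannot leave \<open>N1\<close>; children
    of other nodes stay, to preserve \<open>cond\<close>.\<close>
  define A3 where "A3 = {n \<in> A2. par n \<in> N1 \<longrightarrow> n \<in> N1}"
  have "cond A3"
    unfolding cond_def
  proof (intro allI impI)
    fix P assume P: "valid P"
    show "infinite {y \<in> A3. par y = nxt P}"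
    proof (cases "nxt P \<in> N1")
      case False
      then have "{y \<in> A3. par y = nxt P} = {y \<in> A2. par y = nxt P}" by (auto simp: A3_def)
      then show ?thesis using A2(2) P by (simp add: cond_def)
    next
      case True
      let ?x = "decode (nxt P)"
      have "?x \<in> decode ` N1 - leaves" using True valid_nxt(2)[OF P] by blast
      then have inf: "infinite (children (decode ` N1) ?x)" by (rule branch_infinite_children[OF N1(2)])
      have node: "?x @ [m] \<in> nodes" if "m \<in> children (decode ` N1) ?x" for m
        using that branch_init(3)[OF N1(2)] unfolding children_def by blast
      have "(\<lambda>m. code (?x @ [m])) ` children (decode ` N1) ?x \<subseteq> {y \<in> A3. par y = nxt P}"
      proof
        fix y assume "y \<in> (\<lambda>m. code (?x @ [m])) ` children (decode ` N1) ?x"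
        then obtain m where m: "m \<in> children (decode ` N1) ?x" "y = code (?x @ [m])" by blast
        have d: "decode y = ?x @ [m]" using node[OF m(1)] m(2) by simp
        then have p: "par y = nxt P" by (simp add: par_def)
        have "y \<noteq> 0" using d by (metis decode_0 snoc_eq_iff_butlast)
        obtain k where "k \<in> N1" "decode k = ?x @ [m]" using m(1) unfolding children_def by auto
        then have "y \<in> N1" using m(2) by (metis code_decode)
        then show "y \<in> {y \<in> A3. par y = nxt P}" using p N1(1) \<open>y \<noteq> 0\<close> by (auto simp: A3_def)
      qed
      moreover have "inj_on (\<lambda>m. code (?x @ [m])) (children (decode ` N1) ?x)"
      proof (rule inj_onI)
        fix m m' assume "m \<in> children (decode ` N1) ?x" "m' \<in> children (decode ` N1) ?x"
          "code (?x @ [m]) = code (?x @ [m'])"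
        then show "m = m'" using code_inj[OF node node] by simp
      qed
      ultimately show ?thesis using inf by (meson finite_imageD finite_subset)
    qed
  qed
  have A3N: "P \<subseteq> N1" if "valid P" "P \<subseteq> insert 0 A3" for P
    using that
  proof (induction rule: valid.induct)
    case root
    then show ?case using N1(2) by (simp add: branch_def)
  next
    case (node P y)
    have "P \<subseteq> N1" using node by simp
    moreover have "0 < y" using node.hyps(3)[OF valid_0[OF node.hyps(1)]] .
    moreover have "par y \<in> P" using node.hyps(2) valid_nxt(1)[OF node.hyps(1)] by simp
    ultimately show ?case using node.prems by (auto simp: A3_def)
  qed
  have "A3 \<subseteq> A" using A2(1) by (auto simp: A3_def)
  obtain A4 where A4: "A4 \<subseteq> A3" "cond A4" and
    wit': "\<forall>p\<in>F'. p \<subseteq> insert 0 A4 \<longrightarrow>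
      (\<exists>q\<in>F'. q \<subseteq> insert 0 A3 \<and> K q = K p \<and> p \<inter> q = K p) \<and> (\<forall>y\<in>K p. y \<noteq> 0 \<longrightarrow> par y \<in> K p)"
    using sparse[OF \<open>A3 \<subseteq> A\<close> \<open>cond A3\<close>] by (elim exE conjE) (rule that)
  have wit: "\<exists>q\<in>F'. q \<subseteq> insert 0 A3 \<and> K q = K p \<and> p \<inter> q = K p" if "p \<in> F'" "p \<subseteq> insert 0 A4" for p
    using wit' that by simp
  obtain N2 where N2: "N2 \<subseteq> insert 0 A4" "branch N2" using cond_branch[OF A4(2)] by blast
  define Y where "Y = psi B ` (decode ` N2 \<inter> leaves)"
  have N21: "N2 \<subseteq> N1"
  proof
    fix m assume m: "m \<in> N2"
    then have "valid (N2 \<inter> {..m})" using N2(2) by (simp add: branch_def)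
    then have "N2 \<inter> {..m} \<subseteq> N1" by (rule A3N) (use N2(1) A4(1) in blast)
    then show "m \<in> N1" using m by blast
  qed
  have "N1 \<subseteq> A0" using N1(1) A20 by blast
  then have WV: "W \<subseteq> V" unfolding W_def by (rule branch_sub[OF N1(2)])
  have WE: "W \<in> E_space B" unfolding W_def by (rule branch_E[OF N1(2)])
  have YE: "Y \<in> E_space B" unfolding Y_def by (rule branch_E[OF N2(2)])
  have YW: "Y \<subseteq> W" unfolding Y_def W_def using N21 by blast
  let ?F = "restrict_to F W"
  have FW: "u \<in> ?F \<longleftrightarrow> u \<in> F \<and> codes u \<subseteq> N1" for u
    using restrict_codes[OF N1(2) FA, of u] by (auto simp: restrict_to_def W_def)
  have FW1: "codes u \<in> F'" "u \<in> F1" "codes u \<subseteq> insert 0 A2" "codes u \<subseteq> insert 0 A" "u \<in> AE B" "u \<noteq> {}"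
    if "u \<in> ?F" for u
  proof -
    have u: "u \<in> F" "codes u \<subseteq> insert 0 A2" using that FW N1(1) by auto
    then have "codes u \<subseteq> A0" using A20 by blast
    then show "codes u \<in> F'" "u \<in> F1" using in_A0 u(1) by auto
    show "codes u \<subseteq> insert 0 A2" "codes u \<subseteq> insert 0 A" using u(2) A2(1) by auto
    show "u \<in> AE B" "u \<noteq> {}" using FA u(1) by auto
  qed
  define kn where "kn u = decode ` K (codes u)" for u
  \<comment> \<open>A projection is an antichain, so only the maximal known nodes are taken. Nothing
    is lost, because the kernel is a finite subtree and consists of their prefixes.\<close>
  define \<phi> where "\<phi> u = psi B ` top_nodes (kn u)" for u
  have kn: "prefix_closed (kn u)" "finite (kn u)" "kn u \<subseteq> decode ` codes u" "pre (top_nodes (kn u)) = kn u"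
    if "u \<in> ?F" for u
  proof -
    note f = FW1[OF that]
    show pc: "prefix_closed (kn u)"
      unfolding kn_def by (rule prefix_closed_decode) (rule closed[OF f(1,3)])
    have sub: "K (codes u) \<subseteq> codes u" using K[OF f(1)] by blast
    then show "kn u \<subseteq> decode ` codes u" unfolding kn_def by (rule image_mono)
    have "finite (codes u)" using front_relation.F_valid[OF fr f(1)] by (rule valid_finite)
    then show fin: "finite (kn u)" unfolding kn_def using sub finite_subset by blast
    show "pre (top_nodes (kn u)) = kn u" by (rule pre_top_nodes[OF fin pc])
  qed
  have knN: "top_nodes (kn u) \<subseteq> nodes" for u by (auto simp: top_nodes_def kn_def)
  have \<phi>_eq: "\<phi> u = \<phi> v \<longleftrightarrow> K (codes u) = K (codes v)" if u: "u \<in> ?F" and v: "v \<in> ?F" for u v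
  proof
    assume e: "\<phi> u = \<phi> v"
    have t: "top_nodes (kn u) = top_nodes (kn v)"
      by (rule iffD1[OF inj_on_image_eq_iff[OF inj_on_psi[OF order_refl] knN knN] e[unfolded \<phi>_def]])
    have "kn u = pre (top_nodes (kn u))" by (rule kn(4)[OF u, symmetric])
    also have "\<dots> = kn v" unfolding t by (rule kn(4)[OF v])
    finally have "code ` kn u = code ` kn v" by (rule arg_cong)
    then show "K (codes u) = K (codes v)" by (simp add: kn_def image_image)
  qed (simp add: \<phi>_def kn_def)
  have proj: "projection (\<phi> u) u" if u: "u \<in> ?F" for u
    unfolding projection_def
  proof (intro conjI ballI impI)
    have "top_nodes (kn u) \<subseteq> decode ` codes u" using kn(3)[OF u] by (auto simp: top_nodes_def)
    then show "\<phi> u \<subseteq> hat u" unfolding \<phi>_def hat_codes[OF FW1(5,6)[OF u]] by (rule image_mono)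
    fix a b assume "a \<in> \<phi> u" "b \<in> \<phi> u" "a \<noteq> b"
    then obtain x y where xy: "x \<in> top_nodes (kn u)" "y \<in> top_nodes (kn u)" "a = psi B x" "b = psi B y" "x \<noteq> y"
      unfolding \<phi>_def by blast
    have n: "x \<in> nodes" "y \<in> nodes" using xy(1,2) knN by blast+
    have "\<not> prefix x y"
      using top_nodes_antichain[OF kn(1)[OF u] xy(1), of y] xy(2,5) by (auto simp: top_nodes_def)
    then show "\<not> a \<unlhd> b" using init_seg_psi[OF n] xy(3,4) by simp
  qed
  have star: "\<exists>v\<in>?F. \<phi> u = \<phi> v \<and> \<phi> v = meet u v" if "u \<in> restrict_to ?F Y" for u
  proof -
    have u: "u \<in> ?F" "u \<subseteq> Y" using that by (auto simp: restrict_to_def)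
    note f = FW1[OF u(1)]
    have "codes u \<subseteq> N2" using restrict_codes[OF N2(2) f(5,6)] u(2) by (simp add: Y_def)
    then have "codes u \<subseteq> insert 0 A4" using N2(1) by blast
    then obtain q where q: "q \<in> F'" "q \<subseteq> insert 0 A3" "K q = K (codes u)" "codes u \<inter> q = K (codes u)"
      using wit[OF f(1)] by blast
    obtain v where v: "v \<in> F1" "q = codes v" using q(1) by (auto simp: F'_def)
    have "codes v \<subseteq> N1" using A3N[OF front_relation.F_valid[OF fr q(1)] q(2)] v(2) by simp
    then have vF: "v \<in> ?F" using FW F1F[OF v(1)] by blast
    note g = FW1[OF vF]
    have eq: "\<phi> u = \<phi> v" using \<phi>_eq[OF u(1) vF] q(3) v(2) by simp
    have k: "kn u = decode ` (codes u \<inter> codes v)" using q(4) v(2) by (simp add: kn_def)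
    have "meet u v = psi B ` top_nodes (kn u)"
      unfolding k by (rule meet_codes[OF f(5,6) g(5,6)]) (use kn(1)[OF u(1)] k in simp)
    then have "\<phi> v = meet u v" using eq by (simp add: \<phi>_def)
    then show ?thesis using vF eq by blast
  qed
  have "irreducible_map B W ?F \<phi>"
    unfolding irreducible_map_def
    using front_restrict[OF F WV] proj star YE YW by blast
  moreover have "(u, v) \<in> R \<longleftrightarrow> \<phi> u = \<phi> v" if u: "u \<in> ?F" and v: "v \<in> ?F" for u v
  proof -
    note f = FW1[OF u] and g = FW1[OF v]
    have "(u, v) \<in> R \<longleftrightarrow> (codes u, codes v) \<in> R'" using R'iff[OF f(2) g(2)] by simp
    also have "\<dots> \<longleftrightarrow> K (codes u) = K (codes v)" by (rule KR[OF f(1) g(1) f(4) g(4)])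
    also have "\<dots> \<longleftrightarrow> \<phi> u = \<phi> v" by (rule \<phi>_eq[OF u v, symmetric])
    finally show ?thesis .
  qed
  ultimately have "canonical_on B W ?F R" unfolding canonical_on_def by blast
  then show ?thesis using WE WV by blast
qed

end

lemma r_approx_empty: "r_approx 0 X = {}"
  by (simp add: r_approx_def least_elems_def)

theorem theorem45:
  fixes B :: "nat set set"
    and V :: "nat set set"
    and F :: "nat set set set"
    and R :: "(nat set set \<times> nat set set) set"
  assumes "uniform_barrier B"
    and "V \<in> E_space B"
    and "front B V F"
    and "equiv F R"
  shows "\<exists>W\<in>E_space B. W \<subseteq> V \<and> canonical_on B W (restrict_to F W) R"
proof (cases "{} \<in> F")
  case False
  interpret ubarrier B
    using uniform_barrier_ubar[OF assms(1)] by unfold_locales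
  show ?thesis by (rule canonical_front[OF assms(2-4) False])
next
  case True
  \<comment> \<open>The empty approximation is an \<open>r_approx\<close> of everything, so no other
    member can stand beside it. It is kept apart from codes because \<open>hat {}\<close> is empty,
    whereas \<open>codes {}\<close> contains the root.\<close>
  have F: "F = {{}}"
  proof -
    have "u = {}" if "u \<in> F" for u
      using front_antichain[OF assms(3) that, of 0] True r_approx_empty[of u] by simp
    then show ?thesis using True by blast
  qed
  then have r: "restrict_to F X = {{}}" for X by (auto simp: restrict_to_def)
  have "irreducible_map B V {{}} (\<lambda>_. {})"
    unfolding irreducible_map_def
  proof (intro conjI ballI)
    show "front B V {{}}" using assms(3) F by simp
    show "projection {} u" for u by (simp add: projection_def)
    show "\<exists>Y\<in>E_space B. Y \<subseteq> V \<and> (\<forall>u\<in>restrict_to {{}} Y. \<exists>v\<in>{{}}. {} = ({} :: nat set set) \<and> {} = meet u v)"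
      using assms(2) by (intro bexI[of _ V]) (auto simp: restrict_to_def meet_def hat_def)
  qed
  moreover have "({}, {}) \<in> R" using assms(4) True by (meson equivE refl_onD)
  ultimately have "canonical_on B V (restrict_to F V) R"
    unfolding canonical_on_def r by (intro exI[of _ "\<lambda>_. {}"]) simp
  then show ?thesis using assms(2) by blast
qed

end
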